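(* Let $X\subset\mathbb{P}^3$ be an irreducible surface of degree at least two, not a cone, such that $\operatorname{trop}(X)\subset\mathbb{R}^3$ is smooth with generic valuations. Let $F$ be a two-dimensional cell of $\operatorname{trop}(X)$ and let $J\subset\{0,1,2,3\}$ consist of those $i$ with $e_i\in\langle F\rangle$. Assume that the recession cone of $F$ intersects $\sum_{i\in J}\mathbb{R}_{\geq0}\cdot(-e_i)$ only in $0$. Then $$F^*=-F-\sum_{i\in J}\mathbb{R}_{\geq0}\cdot e_i.$$
   Context: $\mathbb{K}$ algebraically closed of characteristic zero with nontrivial non-Archimedean valuation $\nu$ trivial on integers; $\operatorname{trop}$ is $-\nu$ coordinatewise, followed by Euclidean closure. $X=V(f)$, $f=\sum_{u\in\mathcal{A}}c_ux^u\in\mathbb{K}[x_0,\dots,x_3]$, $\mathcal{A}\subset\mathbb{Z}^4$, $c_u\neq0$, $f$ involves all variables. Torus coordinates $x_i/x_0$ on $\mathbb{P}^3$ and $y_i/y_0$ on the dual $(\mathbb{P}^3)^*$. For $p\in\mathbb{R}^4$, $\mathcal{A}(p)$ is the set of $u\in\mathcal{A}$ minimizing $\nu(c_u)-\langle p,u\rangle$; $\operatorname{trop}(\widehat X)=\{p\in\mathbb{R}^4:\#\mathcal{A}(p)>1\}$ is the tropicalization of the affine cone, and $\operatorname{trop}(X)$ is its image under $q\mapsto(q_1-q_0,q_2-q_0,q_3-q_0)$. The sets $\operatorname{conv}\mathcal{A}(p)$ form a regular subdivision of $\operatorname{conv}\mathcal{A}$, dual to the polyhedral structure of $\operatorname{trop}(X)$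 (points with equal $\mathcal{A}(p)$ lie in the same open cell); smooth means this subdivision is a unimodular triangulation. Generic valuations: for all $k\geq1$, the set of $p\in\operatorname{trop}(\widehat X)$ with $\#\{\nu(c_u)-\langle p,u\rangle: u\in\mathcal{A}\}\leq\#\mathcal{A}-k$ has dimension at most $4-k$. $e_1,e_2,e_3$ standard basis of $\mathbb{R}^3$, $e_0=-e_1-e_2-e_3$; $\langle F\rangle$ is the linear span of differences of points of $F$. A tropical tangent at $p\in\operatorname{trop}(X)$ is a point $q$ such that some smooth $x\in X\cap(\mathbb{K}^* )^3$ with $\operatorname{trop}(x)=p$ has tangent plane lying in the dual torus and tropicalizing to $q$. For a polyhedron $P\subset\operatorname{trop}(X)$, $P^*$ is the Euclidean closure of the set of tropical tangents at points of the relative interior of $P$. *)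

theory Defs
  imports "HOL-Analysis.Analysis" "HOL-Computational_Algebra.Polynomial"
begin

definition alg_closed_field :: "('a::field) itself \<Rightarrow> bool" where
  "alg_closed_field _ \<longleftrightarrow> (\<forall>p::'a poly. degree p > 0 \<longrightarrow> (\<exists>x. poly p x = 0))"

definition nonarch_valuation :: "('a::field_char_0 \<Rightarrow> real) \<Rightarrow> bool" where
  "nonarch_valuation \<nu> \<longleftrightarrow>
     (\<forall>a b. a \<noteq> 0 \<and> b \<noteq> 0 \<longrightarrow> \<nu> (a * b) = \<nu> a + \<nu> b) \<and>
     (\<forall>a b. a \<noteq> 0 \<and> b \<noteq> 0 \<and> a + b \<noteq> 0 \<longrightarrow> \<nu> (a + b) \<ge> min (\<nu> a) (\<nu> b)) \<and>
     (\<exists>a. a \<noteq> 0 \<and> \<nu> a \<noteq> 0) \<and>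
     (\<forall>n::int. n \<noteq> 0 \<longrightarrow> \<nu> (of_int n) = 0)"

definition monom_eval :: "nat^4 \<Rightarrow> 'a::comm_ring_1^4 \<Rightarrow> 'a" where
  "monom_eval u x = (\<Prod>i\<in>UNIV. x$i ^ (u$i))"

definition peval :: "(nat^4) set \<Rightarrow> (nat^4 \<Rightarrow> 'a::comm_ring_1) \<Rightarrow> 'a^4 \<Rightarrow> 'a" where
  "peval A c x = (\<Sum>u\<in>A. c u * monom_eval u x)"

definition pderiv_eval :: "(nat^4) set \<Rightarrow> (nat^4 \<Rightarrow> 'a::comm_ring_1) \<Rightarrow> 4 \<Rightarrow> 'a^4 \<Rightarrow> 'a" where
  "pderiv_eval A c i x =
     (\<Sum>u\<in>A. c u * of_nat (u$i) * (\<Prod>j\<in>UNIV. x$j ^ (if j = i then u$j - 1 else u$j)))"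

definition homogeneous_of_degree :: "(nat^4) set \<Rightarrow> nat \<Rightarrow> bool" where
  "homogeneous_of_degree A d \<longleftrightarrow> (\<forall>u\<in>A. (\<Sum>i\<in>UNIV. u$i) = d)"

definition involves_all_vars :: "(nat^4) set \<Rightarrow> bool" where
  "involves_all_vars A \<longleftrightarrow> (\<forall>i::4. \<exists>u\<in>A. u$i \<noteq> 0)"

definition poly_coeff :: "(nat^4) set \<Rightarrow> (nat^4 \<Rightarrow> 'a::zero) \<Rightarrow> nat^4 \<Rightarrow> 'a" where
  "poly_coeff A c u = (if u \<in> A then c u else 0)"

definition fs_poly :: "(nat^4 \<Rightarrow> 'a::zero) \<Rightarrow> bool" where
  "fs_poly g \<longleftrightarrow> finite {u. g u \<noteq> 0}"

definition nonconstant_poly :: "(nat^4 \<Rightarrow> 'a::zero) \<Rightarrow> bool" where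
  "nonconstant_poly g \<longleftrightarrow> (\<exists>u. g u \<noteq> 0 \<and> u \<noteq> 0)"

definition poly_mult :: "(nat^4 \<Rightarrow> 'a::comm_ring_1) \<Rightarrow> (nat^4 \<Rightarrow> 'a) \<Rightarrow> nat^4 \<Rightarrow> 'a" where
  "poly_mult g h w = (\<Sum>(u,v)\<in>{(u,v). g u \<noteq> 0 \<and> h v \<noteq> 0 \<and> u + v = w}. g u * h v)"

definition irreducible_mpoly :: "(nat^4) set \<Rightarrow> (nat^4 \<Rightarrow> 'a::comm_ring_1) \<Rightarrow> bool" where
  "irreducible_mpoly A c \<longleftrightarrow> nonconstant_poly (poly_coeff A c) \<and>
     \<not> (\<exists>g h. fs_poly g \<and> fs_poly h \<and> nonconstant_poly g \<and> nonconstant_poly h \<and>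
             poly_coeff A c = poly_mult g h)"

definition is_cone :: "(nat^4) set \<Rightarrow> (nat^4 \<Rightarrow> 'a::comm_ring_1) \<Rightarrow> bool" where
  "is_cone A c \<longleftrightarrow> (\<exists>p::'a^4. p \<noteq> 0 \<and>
     (\<forall>x. peval A c x = 0 \<longrightarrow> (\<forall>s t. peval A c (\<chi> i. s * x$i + t * p$i) = 0)))"

definition pairing :: "real^4 \<Rightarrow> nat^4 \<Rightarrow> real" where
  "pairing p u = (\<Sum>i\<in>UNIV. p$i * real (u$i))"

definition Amin :: "('a \<Rightarrow> real) \<Rightarrow> (nat^4 \<Rightarrow> 'a) \<Rightarrow> (nat^4) set \<Rightarrow> real^4 \<Rightarrow> (nat^4) set" where
  "Amin \<nu> c A p = {u\<in>A. \<forall>w\<in>A. \<nu> (c u) - pairing p u \<le> \<nu> (c w) - pairing p w}"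

definition trop_coords :: "real^4 \<Rightarrow> real^3" where
  "trop_coords q = vector [q$1 - q$0, q$2 - q$0, q$3 - q$0]"

definition trop_pt :: "('a \<Rightarrow> real) \<Rightarrow> 'a^4 \<Rightarrow> real^3" where
  "trop_pt \<nu> x = trop_coords (\<chi> i. - \<nu> (x$i))"

text \<open>e_1,e_2,e_3 standard basis, e_0 = -e_1-e_2-e_3 (only indices 0..3 are used).\<close>
definition std_e :: "nat \<Rightarrow> real^3" where
  "std_e i = (if i = 0 then vector [-1, -1, -1] else if i = 1 then vector [1, 0, 0]
              else if i = 2 then vector [0, 1, 0] else vector [0, 0, 1])"

definition dim_at_most :: "(real^4) set \<Rightarrow> int \<Rightarrow> bool" where
  "dim_at_most S d \<longleftrightarrow> (\<exists>T. finite T \<and> S \<subseteq> \<Union>T \<and> (\<forall>t\<in>T. aff_dim t \<le> d))"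

definition generic_valuations :: "('a \<Rightarrow> real) \<Rightarrow> (nat^4 \<Rightarrow> 'a) \<Rightarrow> (nat^4) set \<Rightarrow> bool" where
  "generic_valuations \<nu> c A \<longleftrightarrow> (\<forall>k::nat. k \<ge> 1 \<longrightarrow>
     dim_at_most {p. card (Amin \<nu> c A p) > 1 \<and>
                     int (card ((\<lambda>u. \<nu> (c u) - pairing p u) ` A)) \<le> int (card A) - int k}
                 (4 - int k))"

definition int_vec :: "nat^4 \<Rightarrow> int^4" where "int_vec u = (\<chi> i. int (u$i))"
definition real_vec :: "nat^4 \<Rightarrow> real^4" where "real_vec u = (\<chi> i. real (u$i))"

text \<open>Smoothness: every cell A(p) of the regular subdivision is a simplex, and the full-dimensional
  ones are unimodular (edge vectors form a basis of the lattice of integer vectors of coordinate sum 0,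
  the lattice of the hyperplane containing A).\<close>
definition unimodular_triangulation :: "('a \<Rightarrow> real) \<Rightarrow> (nat^4 \<Rightarrow> 'a) \<Rightarrow> (nat^4) set \<Rightarrow> bool" where
  "unimodular_triangulation \<nu> c A \<longleftrightarrow> (\<forall>p.
     \<not> affine_dependent (real_vec ` Amin \<nu> c A p) \<and>
     (card (Amin \<nu> c A p) = 4 \<longrightarrow>
       (\<exists>u0\<in>Amin \<nu> c A p. \<forall>v::int^4. (\<Sum>i\<in>UNIV. v$i) = 0 \<longrightarrow>
          (\<exists>a::nat^4 \<Rightarrow> int. v = (\<Sum>u\<in>Amin \<nu> c A p - {u0}. a u *s (int_vec u - int_vec u0))))))"

definition trop_cell :: "('a \<Rightarrow> real) \<Rightarrow> (nat^4 \<Rightarrow> 'a) \<Rightarrow> (nat^4) set \<Rightarrow> (nat^4) set \<Rightarrow> (real^3) set" where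
  "trop_cell \<nu> c A S = closure (trop_coords ` {p. Amin \<nu> c A p = S})"

definition lin_span_diff :: "(real^3) set \<Rightarrow> (real^3) set" where
  "lin_span_diff F = span {x - y | x y. x \<in> F \<and> y \<in> F}"

definition recession_cone :: "(real^3) set \<Rightarrow> (real^3) set" where
  "recession_cone F = {d. \<forall>x\<in>F. \<forall>t::real. t \<ge> 0 \<longrightarrow> x + t *\<^sub>R d \<in> F}"

definition nonneg_cone :: "(nat \<Rightarrow> real^3) \<Rightarrow> nat set \<Rightarrow> (real^3) set" where
  "nonneg_cone v J = {\<Sum>i\<in>J. a i *\<^sub>R v i | a. \<forall>i\<in>J. a i \<ge> 0}"

text \<open>Tropical tangents at p: tropicalizations of tangent planes [df/dx0 : ... : df/dx3] at points
  x of X in the torus with trop(x)=p, the tangent plane lying in the dual torus.\<close>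
definition tropical_tangents ::
  "('a::comm_ring_1 \<Rightarrow> real) \<Rightarrow> (nat^4) set \<Rightarrow> (nat^4 \<Rightarrow> 'a) \<Rightarrow> real^3 \<Rightarrow> (real^3) set" where
  "tropical_tangents \<nu> A c p = {q. \<exists>x::'a^4. (\<forall>i. x$i \<noteq> 0) \<and> peval A c x = 0 \<and>
      (\<forall>i. pderiv_eval A c i x \<noteq> 0) \<and> trop_pt \<nu> x = p \<and>
      q = trop_pt \<nu> (\<chi> i. pderiv_eval A c i x)}"

definition dual_cell :: "('a::comm_ring_1 \<Rightarrow> real) \<Rightarrow> (nat^4) set \<Rightarrow> (nat^4 \<Rightarrow> 'a) \<Rightarrow> (real^3) set \<Rightarrow> (real^3) set" where
  "dual_cell \<nu> A c F = closure (\<Union>p\<in>rel_interior F. tropical_tangents \<nu> A c p)"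

end

(* Let u, v be the two exponents defining F and a point x of X tropicalise into the relative interior
   of F. Subtracting u_i f from x_i df/dx_i shows that this derivative has the valuation m of the two
   leading terms when u_i /= v_i, and a larger one, m + a_i, when u_i = v_i, that is for i in J: the
   tangents are the points -p - a with a in the cone. Conversely, to realise a given q = p + a one looks
   for a critical point, in the directions of J, of f minus monomials b_i x_i x^u with val b_i = q_i.
   The recession hypothesis makes the region of admissible a compact. Maximising the least term there
   gives, by concavity and genericity of q, a point at which suitable combinations of the equations have
   exactly two leading terms with independent exponent differences. Such a system is solved to any
   precision by finitely many Newton steps, after which f = 0 is solved exactly in one variable. *)
theory Submission
  imports Defs
begin

section \<open>Valuations and approximate solutions\<close>


text \<open>The field need not be complete and its value group need not be all of the reals. This
  shapes the converse inclusion. Only the valuations of the partial derivatives matter, so the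
  tangency equations may hold up to an error of high valuation, whereas f = 0 must hold exactly; one
  coordinate is adjusted for that, by algebraic closedness. Since the dual cell is a closure, it
  suffices to realise q from a dense set: all coordinates except one index k outside J are taken in
  the value group, which is dense because the field has all roots, and q_k is forced by the equation
  of the plane of F. The same freedom avoids the q for which too many terms coincide; generic
  valuations confine these to finitely many proper affine subspaces. At the maximum the critical
  equations of single indices need not have independent leading terms, hence the integer
  combinations; nonzero integers, and so nonzero determinants, have valuation zero. As u and v have
  the same degree, they differ in at least two coordinates, so at most two indices lie in J and a
  line or a plane is all that has to be searched.\<close>

locale valued_field =
  fixes \<nu> :: "'a::field_char_0 \<Rightarrow> real"
  assumes nonarch: "nonarch_valuation \<nu>"
begin

lemma val_mult: "a \<noteq> 0 \<Longrightarrow> b \<noteq> 0 \<Longrightarrow> \<nu> (a * b) = \<nu> a + \<nu> b"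
  using nonarch by (auto simp: nonarch_valuation_def)

lemma val_add: "a \<noteq> 0 \<Longrightarrow> b \<noteq> 0 \<Longrightarrow> a + b \<noteq> 0 \<Longrightarrow> \<nu> (a + b) \<ge> min (\<nu> a) (\<nu> b)"
  using nonarch by (auto simp: nonarch_valuation_def)

lemma val_of_int: "n \<noteq> 0 \<Longrightarrow> \<nu> (of_int n) = 0"
  using nonarch by (auto simp: nonarch_valuation_def)

lemma val_1: "\<nu> 1 = 0"
  using val_of_int[of 1] by simp

lemma val_minus: "a \<noteq> 0 \<Longrightarrow> \<nu> (- a) = \<nu> a"
  using val_mult[of "-1" a] val_of_int[of "-1"] by simp

lemma val_inverse: "a \<noteq> 0 \<Longrightarrow> \<nu> (inverse a) = - \<nu> a"
  using val_mult[of a "inverse a"] val_1 by simp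

lemma val_divide: "a \<noteq> 0 \<Longrightarrow> b \<noteq> 0 \<Longrightarrow> \<nu> (a / b) = \<nu> a - \<nu> b"
  by (simp add: divide_inverse val_mult val_inverse)

lemma val_power: "a \<noteq> 0 \<Longrightarrow> \<nu> (a ^ n) = real n * \<nu> a"
  by (induction n) (auto simp: val_1 val_mult algebra_simps)

lemma val_powi: "a \<noteq> 0 \<Longrightarrow> \<nu> (a powi n) = of_int n * \<nu> a"
  by (cases n rule: int_cases2) (auto simp: val_power val_inverse power_int_minus)

lemma val_prod: "finite I \<Longrightarrow> (\<And>i. i \<in> I \<Longrightarrow> g i \<noteq> 0) \<Longrightarrow> \<nu> (prod g I) = (\<Sum>i\<in>I. \<nu> (g i))"
  by (induction I rule: finite_induct) (auto simp: val_1 val_mult)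

text \<open>The value \<open>\<nu> 0\<close> is an unconstrained real number; this predicate gives
  zero its proper infinite valuation.\<close>

definition vge :: "real \<Rightarrow> 'a \<Rightarrow> bool" where
  "vge \<rho> a \<longleftrightarrow> a = 0 \<or> \<rho> \<le> \<nu> a"

lemma vge_0 [simp]: "vge \<rho> 0"
  by (simp add: vge_def)

lemma vge_mono: "vge \<rho> a \<Longrightarrow> \<sigma> \<le> \<rho> \<Longrightarrow> vge \<sigma> a"
  by (auto simp: vge_def)

lemma vge_add: "vge \<rho> a \<Longrightarrow> vge \<rho> b \<Longrightarrow> vge \<rho> (a + b)"
  using val_add[of a b] by (cases "a = 0"; cases "b = 0"; cases "a + b = 0") (auto simp: vge_def min_le_iff_disj)

lemma vge_minus: "vge \<rho> a \<Longrightarrow> vge \<rho> (- a)"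
  by (cases "a = 0") (auto simp: vge_def val_minus)

lemma vge_diff: "vge \<rho> a \<Longrightarrow> vge \<rho> b \<Longrightarrow> vge \<rho> (a - b)"
  using vge_add[of \<rho> a "- b"] vge_minus[of \<rho> b] by simp

lemma vge_sum: "(\<And>i. i \<in> I \<Longrightarrow> vge \<rho> (g i)) \<Longrightarrow> vge \<rho> (sum g I)"
  by (induction I rule: infinite_finite_induct) (auto intro: vge_add)

lemma vge_mult: "vge \<rho> a \<Longrightarrow> vge \<sigma> b \<Longrightarrow> vge (\<rho> + \<sigma>) (a * b)"
  by (cases "a = 0"; cases "b = 0") (auto simp: vge_def val_mult)

lemma vge_of_int: "vge 0 (of_int n)"
  by (cases "n = 0") (auto simp: vge_def val_of_int)

lemma vge_of_nat: "vge 0 (of_nat n)"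
  using vge_of_int[of "int n"] by simp

text \<open>If the sum had a larger valuation than \<open>a\<close>, subtracting \<open>b\<close>
  again would give \<open>a\<close> a larger valuation as well.\<close>

lemma val_add_dominant:
  assumes "a \<noteq> 0" "vge \<rho> b" "\<nu> a < \<rho>"
  shows "a + b \<noteq> 0" "\<nu> (a + b) = \<nu> a"
proof -
  show nz: "a + b \<noteq> 0"
  proof
    assume "a + b = 0"
    then have "b = - a" by (simp add: eq_neg_iff_add_eq_0 add.commute)
    then show False using assms by (auto simp: vge_def val_minus)
  qed
  show "\<nu> (a + b) = \<nu> a"
  proof (cases "b = 0")
    case False
    then have b: "\<nu> a < \<nu> b" using assms by (auto simp: vge_def)
    have "\<nu> (a + b) \<ge> \<nu> a" using val_add[of a b] nz assms False b by auto
    moreover have "\<nu> a \<ge> min (\<nu> (a + b)) (\<nu> b)"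
      using val_add[of "a + b" "- b"] nz assms False by (simp add: val_minus)
    ultimately show ?thesis using b by linarith
  qed simp
qed

text \<open>Each linear factor \<epsilon> - \<tau> has the valuation of its root \<tau>, which is
  closer to the boundary than \<epsilon>; the induction splits off one root at a time. It serves in
  the contrapositive: a value at \<epsilon> of higher valuation than the value at 0 forces a root of
  valuation at least \<mu>.\<close>

lemma poly_val_eq_at_0_if_roots_far:
  assumes "alg_closed_field TYPE('a)" "poly H 0 \<noteq> 0"
    and "\<And>\<tau>. poly H \<tau> = 0 \<Longrightarrow> \<nu> \<tau> < \<mu>" and "\<epsilon> \<noteq> 0" "\<mu> \<le> \<nu> \<epsilon>"
  shows "poly H \<epsilon> \<noteq> 0 \<and> \<nu> (poly H \<epsilon>) = \<nu> (poly H 0)"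
  using assms(2,3)
proof (induction "degree H" arbitrary: H)
  case 0
  then obtain a where "H = [:a:]" by (metis degree_eq_zeroE)
  then show ?case using 0 by auto
next
  case (Suc n)
  then obtain \<tau> where \<tau>: "poly H \<tau> = 0"
    using assms(1) by (metis alg_closed_field_def zero_less_Suc)
  then obtain G where G: "H = [:- \<tau>, 1:] * G" by (metis poly_eq_0_iff_dvd dvdE)
  have nz: "G \<noteq> 0" using Suc.prems(1) G by auto
  have "degree H = Suc (degree G)" unfolding G using nz by (subst degree_mult_eq) auto
  then have "n = degree G" using Suc.hyps by simp
  moreover have "poly G 0 \<noteq> 0" using Suc.prems(1) by (auto simp: G)
  moreover have "\<nu> \<sigma> < \<mu>" if "poly G \<sigma> = 0" for \<sigma> using Suc.prems(2)[of \<sigma>] that by (simp add: G)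
  ultimately have IH: "poly G \<epsilon> \<noteq> 0 \<and> \<nu> (poly G \<epsilon>) = \<nu> (poly G 0)" using Suc.hyps(1) by blast
  have t0: "\<tau> \<noteq> 0" using Suc.prems(1) \<tau> by auto
  have "\<nu> \<tau> < \<nu> \<epsilon>" using Suc.prems(2)[OF \<tau>] assms by linarith
  then have "- \<tau> + \<epsilon> \<noteq> 0" "\<nu> (- \<tau> + \<epsilon>) = \<nu> (- \<tau>)"
    using val_add_dominant[of "-\<tau>" "\<nu> \<epsilon>" \<epsilon>] t0 by (auto simp: vge_def val_minus)
  moreover have "poly H x = (- \<tau> + x) * poly G x" for x by (simp add: G algebra_simps)
  ultimately show ?case using IH t0 \<open>poly G 0 \<noteq> 0\<close>
    by (simp add: val_mult val_minus)
qed

text \<open>A finite form of Hensel's lemma: since \<open>\<nu>\<close> is real valued, finitely many Newton steps reach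
  any precision, so that no completeness is needed.\<close>

lemma newton_approx:
  fixes R :: "'n::finite \<Rightarrow> 'a^'n \<Rightarrow> 'a" and D E :: "'n \<Rightarrow> 'n \<Rightarrow> 'a"
  assumes eta: "\<eta> > 0"
    and E: "\<And>j s. vge 0 (E j s)"
    and DE: "\<And>r s. (\<Sum>j\<in>UNIV. D r j * E j s) = (if r = s then 1 else 0)"
    and R1: "\<And>r. vge \<eta> (R r 1)"
    and step: "\<And>r z e \<rho>. (\<And>j. vge \<eta> (z$j - 1)) \<Longrightarrow> \<eta> \<le> \<rho> \<Longrightarrow> (\<And>j. vge \<rho> (e$j)) \<Longrightarrow>
                 vge (\<rho> + \<eta>) (R r (z + e) - R r z - (\<Sum>j\<in>UNIV. D r j * e$j))"
  shows "\<exists>z. (\<forall>j. vge \<eta> (z$j - 1)) \<and> (\<forall>r. vge (real (Suc n) * \<eta>) (R r z))"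
proof (induction n)
  case 0
  show ?case using R1 by (intro exI[of _ 1]) auto
next
  case (Suc n)
  then obtain z where z: "\<And>j. vge \<eta> (z$j - 1)" and Rz: "\<And>r. vge (real (Suc n) * \<eta>) (R r z)"
    by blast
  define \<rho> where "\<rho> = real (Suc n) * \<eta>"
  have rho: "\<eta> \<le> \<rho>" using eta by (simp add: \<rho>_def)
  \<comment> \<open>The Newton correction: \<open>E\<close> is a right inverse of \<open>D\<close>,
    so the linear part cancels \<open>R r z\<close> and only the error of \<open>step\<close>
    remains, which gains \<eta>.\<close>
  define e :: "'a^'n" where "e = (\<chi> j. - (\<Sum>s\<in>UNIV. E j s * R s z))"
  have e: "vge \<rho> (e$j)" for j
    unfolding e_def using vge_mult[OF E Rz] by (auto intro!: vge_minus vge_sum simp: \<rho>_def)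
  have "(\<Sum>j\<in>UNIV. D r j * e$j) = - R r z" for r
  proof -
    have "(\<Sum>j\<in>UNIV. D r j * e$j) = - (\<Sum>j\<in>UNIV. \<Sum>s\<in>UNIV. D r j * E j s * R s z)"
      by (simp add: e_def sum_negf sum_distrib_left mult.assoc)
    also have "\<dots> = - (\<Sum>s\<in>UNIV. (\<Sum>j\<in>UNIV. D r j * E j s) * R s z)"
      by (subst sum.swap) (simp add: sum_distrib_right)
    also have "\<dots> = - R r z" by (simp add: DE if_distrib[of "\<lambda>x. x * _"] cong: if_cong)
    finally show ?thesis .
  qed
  then have "vge (\<rho> + \<eta>) (R r (z + e))" for r
    using step[OF z rho e, of r] by simp
  moreover have "\<rho> + \<eta> = real (Suc (Suc n)) * \<eta>" by (simp add: \<rho>_def algebra_simps)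
  moreover have "vge \<eta> ((z + e)$j - 1)" for j
    using vge_add[OF z[of j] vge_mono[OF e rho, of j]] by (simp add: algebra_simps)
  ultimately show ?case by (intro exI[of _ "z + e"]) auto
qed

text \<open>A first-order expansion on the polydisc of radius \<eta> around 1, for a function close
  to 1 there. The gradient \<open>w\<close> is the one at 1, not at \<open>z\<close>: the difference
  is absorbed by the error \<rho> + \<eta>. This form is stable under products, which reduces
  monomials to coordinates.\<close>

definition unit_linear :: "real \<Rightarrow> ('a^'n::finite \<Rightarrow> 'a) \<Rightarrow> ('n \<Rightarrow> nat) \<Rightarrow> bool" where
  "unit_linear \<eta> h w \<longleftrightarrow> (\<forall>z e \<rho>. (\<forall>j. vge \<eta> (z$j - 1)) \<and> \<eta> \<le> \<rho> \<and> (\<forall>j. vge \<rho> (e$j)) \<longrightarrow>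
     vge \<eta> (h z - 1) \<and> vge (\<rho> + \<eta>) (h (z + e) - h z - (\<Sum>j\<in>UNIV. of_nat (w j) * e$j)))"

lemma unit_linear_mult:
  fixes h h' :: "'a^'n::finite \<Rightarrow> 'a"
  assumes eta: "\<eta> > 0" and h: "unit_linear \<eta> h w" and h': "unit_linear \<eta> h' w'"
  shows "unit_linear \<eta> (\<lambda>z. h z * h' z) (\<lambda>j. w j + w' j)"
  unfolding unit_linear_def
proof (intro allI impI)
  fix z e :: "'a^'n" and \<rho>
  assume asm: "(\<forall>j. vge \<eta> (z$j - 1)) \<and> \<eta> \<le> \<rho> \<and> (\<forall>j. vge \<rho> (e$j))"
  have ze: "\<forall>j. vge \<eta> ((z + e)$j - 1)"
  proof
    fix j show "vge \<eta> ((z + e)$j - 1)"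
      using vge_add[of \<eta> "z$j - 1" "e$j"] vge_mono[of \<rho> "e$j" \<eta>] asm by (simp add: algebra_simps)
  qed
  define L where "L w = (\<Sum>j\<in>UNIV. of_nat (w j) * e$j)" for w :: "'n \<Rightarrow> nat"
  have L: "vge \<rho> (L w)" for w unfolding L_def
    using asm vge_mult[OF vge_of_nat] by (intro vge_sum) fastforce
  have a: "vge \<eta> (h z - 1)" "vge \<eta> (h' z - 1)" "vge \<eta> (h' (z + e) - 1)"
    and b: "vge (\<rho> + \<eta>) (h (z + e) - h z - L w)" "vge (\<rho> + \<eta>) (h' (z + e) - h' z - L w')"
    using h h' asm ze unfolding unit_linear_def L_def by blast+
  have up: "vge \<rho> x \<Longrightarrow> vge \<eta> y \<Longrightarrow> vge (\<rho> + \<eta>) (x * y)" for x y by (rule vge_mult)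
  have low: "vge (\<rho> + \<eta>) x \<Longrightarrow> vge \<eta> y \<Longrightarrow> vge (\<rho> + \<eta>) (x * y)" for x y
    using vge_mult[of "\<rho> + \<eta>" x \<eta> y] vge_mono[of "\<rho> + \<eta> + \<eta>" "x * y" "\<rho> + \<eta>"] eta by simp
  \<comment> \<open>Product rule with all errors displayed: each summand is one of the two
    linearisation errors, possibly times a factor minus 1, or a linear part times a factor minus
    1.\<close>
  have "h (z + e) * h' (z + e) - h z * h' z - (L w + L w') =
      (h (z + e) - h z - L w) + (h (z + e) - h z - L w) * (h' (z + e) - 1) + L w * (h' (z + e) - 1)
      + (h' (z + e) - h' z - L w') + (h' (z + e) - h' z - L w') * (h z - 1) + L w' * (h z - 1)"
    by (simp add: algebra_simps)
  moreover have "vge (\<rho> + \<eta>) \<dots>"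
    by (intro vge_add b up low L a)
  ultimately have "vge (\<rho> + \<eta>) (h (z + e) * h' (z + e) - h z * h' z - (L w + L w'))"
    by (simp only:)
  moreover have "L (\<lambda>j. w j + w' j) = L w + L w'"
    by (simp add: L_def algebra_simps sum.distrib)
  moreover have "vge \<eta> (h z * h' z - 1)"
  proof -
    have "vge \<eta> ((h z - 1) * (h' z - 1))"
      using vge_mono[OF vge_mult[OF a(1,2)], of \<eta>] eta by simp
    then have "vge \<eta> ((h z - 1) * (h' z - 1) + (h z - 1) + (h' z - 1))" by (intro vge_add a)
    then show ?thesis by (simp add: algebra_simps)
  qed
  ultimately show "vge \<eta> (h z * h' z - 1) \<and> vge (\<rho> + \<eta>) (h (z + e) * h' (z + e) - h z * h' z -
      (\<Sum>j\<in>UNIV. of_nat (w j + w' j) * e$j))"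
    unfolding L_def by simp
qed

lemma unit_linear_1: "unit_linear \<eta> (\<lambda>z. 1) (\<lambda>j. 0)"
  by (simp add: unit_linear_def)

lemma unit_linear_component: "unit_linear \<eta> (\<lambda>z. z$i) (\<lambda>j. if j = i then 1 else 0)"
  by (simp add: unit_linear_def if_distrib[of of_nat] if_distrib[of "\<lambda>x. x * _"] cong: if_cong)

lemma unit_linear_power:
  assumes "\<eta> > 0"
  shows "unit_linear \<eta> (\<lambda>z. z$i ^ n) (\<lambda>j. if j = i then n else 0)"
proof (induction n)
  case 0
  show ?case using unit_linear_1 by simp
next
  case (Suc n)
  have "(\<lambda>j. (if j = i then 1 else 0) + (if j = i then n else 0)) = (\<lambda>j. if j = i then Suc n else 0)"
    by auto
  then show ?case using unit_linear_mult[OF assms unit_linear_component[of \<eta> i] Suc] by simp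
qed

lemma unit_linear_prod:
  assumes "\<eta> > 0" "finite I"
  shows "unit_linear \<eta> (\<lambda>z. \<Prod>i\<in>I. z$i ^ w i) (\<lambda>j. if j \<in> I then w j else 0)"
  using assms(2)
proof (induction I rule: finite_induct)
  case empty
  show ?case using unit_linear_1 by simp
next
  case (insert i I)
  have "(\<lambda>j. (if j = i then w i else 0) + (if j \<in> I then w j else 0)) = (\<lambda>j. if j \<in> insert i I then w j else 0)"
    using insert by auto
  then show ?case using unit_linear_mult[OF assms(1) unit_linear_power[OF assms(1), of i "w i"] insert.IH] insert
    by simp
qed

lemma unit_linear_monom: "\<eta> > 0 \<Longrightarrow> unit_linear \<eta> (monom_eval w) (\<lambda>j. w$j)"
  using unit_linear_prod[of \<eta> UNIV "\<lambda>i. w$i"] by (simp add: monom_eval_def[abs_def])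

end


section \<open>Integer matrices and systems with two leading terms per equation\<close>

lemma common_denominator:
  fixes S :: "rat set"
  assumes "finite S"
  shows "\<exists>N::int. N > 0 \<and> (\<forall>g\<in>S. \<exists>b::int. of_int N * g = of_int b)"
  using assms
proof (induction S rule: finite_induct)
  case empty
  show ?case by (intro exI[of _ 1]) auto
next
  case (insert g S)
  then obtain N :: int where N: "N > 0" "\<And>g. g \<in> S \<Longrightarrow> \<exists>b::int. of_int N * g = of_int b" by blast
  obtain a d where q: "quotient_of g = (a, d)" by fastforce
  then have d: "d > 0" "g = of_int a / of_int d"
    by (auto intro: quotient_of_denom_pos quotient_of_div)
  have "of_int (N * d) * g = of_int (N * a)" using d by simp
  moreover have "\<exists>b::int. of_int (N * d) * h = of_int b" if "h \<in> S" for h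
  proof -
    obtain b :: int where "of_int N * h = of_int b" using N(2)[OF \<open>h \<in> S\<close>] by blast
    then have "of_int (N * d) * h = of_int (d * b)" by (simp add: algebra_simps)
    then show ?thesis by blast
  qed
  moreover have "N * d > 0" using N d by simp
  ultimately show ?case by (intro exI[of _ "N * d"]) blast
qed

text \<open>The rational inverse with cleared denominators. Integral entries are wanted because
  \<open>B\<close> will serve as a matrix of exponents, and because division by \<open>N\<close>
  does not change valuations.\<close>

lemma int_matrix_inverse:
  fixes D :: "'n::finite \<Rightarrow> 'n \<Rightarrow> int"
  assumes ker: "\<forall>y::rat^'n. (\<forall>r. (\<Sum>j\<in>UNIV. of_int (D r j) * y$j) = 0) \<longrightarrow> y = 0"
  obtains B :: "'n \<Rightarrow> 'n \<Rightarrow> int" and N :: int where "N > 0"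
    and "\<And>r s. (\<Sum>j\<in>UNIV. D r j * B j s) = (if r = s then N else 0)"
    and "\<And>r s. (\<Sum>j\<in>UNIV. B r j * D j s) = (if r = s then N else 0)"
proof -
  define M :: "rat^'n^'n" where "M = (\<chi> r j. of_int (D r j))"
  have "\<forall>y. M *v y = 0 \<longrightarrow> y = 0"
    using ker by (auto simp: M_def matrix_vector_mult_def vec_eq_iff)
  then obtain G where G: "G ** M = mat 1" using matrix_left_invertible_ker[of M] by auto
  then have G': "M ** G = mat 1" by (rule matrix_left_right_inverse1)
  have "finite ((\<lambda>(i, j). G$i$j) ` UNIV)" by simp
  from common_denominator[OF this] obtain N :: int
    where N: "N > 0" "\<And>i j. \<exists>b::int. of_int N * G$i$j = of_int b" by force
  from N(2) obtain B where B: "\<And>i j. of_int N * G$i$j = of_int (B i j)" by metis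
  have MG: "(of_int (\<Sum>j\<in>UNIV. D r j * B j s) :: rat) = of_int N * (M ** G)$r$s" for r s
    by (simp add: B[symmetric] matrix_matrix_mult_def M_def sum_distrib_left algebra_simps)
  have 1: "(\<Sum>j\<in>UNIV. D r j * B j s) = (if r = s then N else 0)" for r s
  proof -
    have "(of_int (\<Sum>j\<in>UNIV. D r j * B j s) :: rat) = of_int (if r = s then N else 0)"
      unfolding MG by (simp add: G' mat_def)
    then show ?thesis by (simp only: of_int_eq_iff)
  qed
  have GM: "(of_int (\<Sum>j\<in>UNIV. B r j * D j s) :: rat) = of_int N * (G ** M)$r$s" for r s
    by (simp add: B[symmetric] matrix_matrix_mult_def M_def sum_distrib_left algebra_simps)
  have 2: "(\<Sum>j\<in>UNIV. B r j * D j s) = (if r = s then N else 0)" for r s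
  proof -
    have "(of_int (\<Sum>j\<in>UNIV. B r j * D j s) :: rat) = of_int (if r = s then N else 0)"
      unfolding GM by (simp add: G mat_def)
    then show ?thesis by (simp only: of_int_eq_iff)
  qed
  show ?thesis using that[OF N(1) 1 2] .
qed

lemma power_int_prod:
  fixes g :: "'b \<Rightarrow> 'a::field"
  assumes "finite I"
  shows "(\<Prod>s\<in>I. g s) powi n = (\<Prod>s\<in>I. g s powi n)"
  using assms by (induction I rule: finite_induct) (auto simp: power_int_mult_distrib)

lemma prod_power_int_sum:
  fixes g :: "'a::field"
  assumes "finite I" "g \<noteq> 0"
  shows "(\<Prod>s\<in>I. g powi n s) = g powi (\<Sum>s\<in>I. n s)"
  using assms by (induction I rule: finite_induct) (auto simp: power_int_add)

lemma alg_closed_root: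
  fixes a :: "'a::field_char_0"
  assumes "alg_closed_field TYPE('a)" "n > 0"
  shows "\<exists>b. b ^ n = a"
proof -
  have "degree (monom 1 n + [:- a:]) = n"
    using assms(2) by (subst degree_add_eq_left) (auto simp: degree_monom_eq)
  then obtain b where "poly (monom 1 n + [:- a:]) b = 0"
    using assms by (metis alg_closed_field_def)
  then show ?thesis by (auto simp: poly_monom)
qed

lemma monom_eval_scale: "monom_eval w (\<chi> j. x$j * z$j) = monom_eval w x * monom_eval w z"
  by (simp add: monom_eval_def power_mult_distrib prod.distrib)

lemma monom_eval_nonzero: "(\<And>j. x$j \<noteq> 0) \<Longrightarrow> monom_eval w (x::'a::field^4) \<noteq> 0"
  by (simp add: monom_eval_def)

context valued_field
begin

lemma val_monom:
  assumes "\<And>j. x$j \<noteq> 0 \<and> \<nu> (x$j) = - p$j"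
  shows "\<nu> (monom_eval w x) = - pairing p w"
  using assms by (simp add: monom_eval_def val_prod val_power pairing_def sum_negf mult.commute)

text \<open>Written multiplicatively the system is linear with matrix \<open>D\<close>. Taking N-th
  roots \<open>b\<close> of the right-hand sides and raising them to the exponents \<open>B\<close>
  solves it, since D B = N; the valuations of the solution come out of B D = N.\<close>

lemma exact_binomial_solution:
  fixes D :: "4 \<Rightarrow> 4 \<Rightarrow> int" and p :: "real^4" and \<gamma> :: "4 \<Rightarrow> 'a"
  assumes ac: "alg_closed_field TYPE('a)"
    and ker: "\<forall>y::rat^4. (\<forall>r. (\<Sum>j\<in>UNIV. of_int (D r j) * y$j) = 0) \<longrightarrow> y = 0"
    and g0: "\<And>r. \<gamma> r \<noteq> 0"
    and gv: "\<And>r. \<nu> (\<gamma> r) = - (\<Sum>j\<in>UNIV. of_int (D r j) * p$j)"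
  shows "\<exists>x::'a^4. (\<forall>j. x$j \<noteq> 0 \<and> \<nu> (x$j) = - p$j) \<and> (\<forall>r. (\<Prod>j\<in>UNIV. x$j powi D r j) = \<gamma> r)"
proof -
  obtain B N where N: "N > 0"
    and DB: "\<And>r s. (\<Sum>j\<in>UNIV. D r j * B j s) = (if r = s then N else 0)"
    and BD: "\<And>r s. (\<Sum>j\<in>UNIV. B r j * D j s) = (if r = s then N else 0)"
    by (rule int_matrix_inverse[OF ker]) auto
  have "\<forall>r. \<exists>b. b ^ nat N = \<gamma> r" using alg_closed_root[OF ac] N by simp
  then obtain b where b: "\<And>r. b r ^ nat N = \<gamma> r" by metis
  then have b': "\<And>r. b r powi N = \<gamma> r" using N by (simp add: power_int_def)
  have b0: "b r \<noteq> 0" for r using b[of r] g0[of r] N by (auto simp: zero_power)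
  define x :: "'a^4" where "x = (\<chi> j. \<Prod>s\<in>UNIV. b s powi B j s)"
  have x0: "x$j \<noteq> 0" for j using b0 by (simp add: x_def)
  have vb: "N * \<nu> (b r) = \<nu> (\<gamma> r)" for r using val_powi[OF b0, of r N] b' by simp
  have "\<nu> (x$j) = - p$j" for j
  proof -
    have "N * \<nu> (x$j) = (\<Sum>s\<in>UNIV. of_int (B j s) * (N * \<nu> (b s)))"
      using b0 by (simp add: x_def val_prod val_powi sum_distrib_left algebra_simps)
    also have "\<dots> = - (\<Sum>s\<in>UNIV. \<Sum>i\<in>UNIV. of_int (B j s * D s i) * p$i)"
      by (simp add: vb gv sum_negf sum_distrib_left mult.assoc)
    also have "\<dots> = - (\<Sum>i\<in>UNIV. of_int (\<Sum>s\<in>UNIV. B j s * D s i) * p$i)"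
      by (subst sum.swap) (simp add: sum_distrib_right)
    also have "\<dots> = - (N * p$j)" by (simp add: BD if_distrib[of of_int] if_distrib[of "\<lambda>x. x * _"] del: of_int_sum cong: if_cong)
    finally have "N * (\<nu> (x$j) + p$j) = 0" by (simp add: distrib_left)
    then show ?thesis using N by simp
  qed
  moreover have "(\<Prod>j\<in>UNIV. x$j powi D r j) = \<gamma> r" for r
  proof -
    have "(\<Prod>j\<in>UNIV. x$j powi D r j) = (\<Prod>j\<in>UNIV. \<Prod>s\<in>UNIV. b s powi (D r j * B j s))"
      by (simp add: x_def power_int_prod power_int_mult[symmetric] mult.commute)
    also have "\<dots> = (\<Prod>s\<in>UNIV. b s powi (\<Sum>j\<in>UNIV. D r j * B j s))"
      using b0 by (subst prod.swap) (simp add: prod_power_int_sum)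
    also have "\<dots> = (\<Prod>s\<in>UNIV. if s = r then b r powi N else 1)"
      by (intro prod.cong) (auto simp: DB)
    also have "\<dots> = \<gamma> r" by (simp add: b')
    finally show ?thesis .
  qed
  ultimately show ?thesis using x0 by blast
qed

lemma peval_line_poly: "\<exists>H. \<forall>T. poly H T = peval W C (z + T *s axis k 1)"
  for z :: "'a^4"
proof -
  have "poly (\<Prod>i\<in>UNIV. [:z$i, axis k 1 $ i:] ^ (w$i)) T = monom_eval w (z + T *s axis k 1)" for w T
    by (simp add: poly_prod monom_eval_def)
  then have "poly (\<Sum>w\<in>W. [:C w:] * (\<Prod>i\<in>UNIV. [:z$i, axis k 1 $ i:] ^ (w$i))) T = peval W C (z + T *s axis k 1)" for T
    by (simp add: poly_sum peval_def)
  then show ?thesis by blast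
qed

text \<open>Residually every equation reads \<open>z^u = z^v\<close>, so the Jacobian matrix at \<open>z = 1\<close> is the integer
  matrix of exponent differences, a unit because the residue characteristic is zero.\<close>

lemma near_one_solution:
  fixes \<beta> :: "4 \<Rightarrow> nat^4 \<Rightarrow> 'a" and e e' :: "4 \<Rightarrow> nat^4"
  assumes ac: "alg_closed_field TYPE('a)" and W: "finite W" and eta: "\<eta> > 0"
    and eW: "\<And>r. e r \<in> W" "\<And>r. e' r \<in> W"
    and be: "\<And>r. \<beta> r (e r) = 1" "\<And>r. \<beta> r (e' r) = - 1"
    and small: "\<And>r w. w \<in> W \<Longrightarrow> w \<noteq> e r \<Longrightarrow> w \<noteq> e' r \<Longrightarrow> vge \<eta> (\<beta> r w)"
    and ker: "\<forall>y::rat^4. (\<forall>r. (\<Sum>j\<in>UNIV. of_int (int (e r$j) - int (e' r$j)) * y$j) = 0) \<longrightarrow> y = 0"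
  shows "\<exists>z. (\<forall>j. vge \<eta> (z$j - 1)) \<and> (\<forall>r. vge (real (Suc n) * \<eta>) (peval W (\<beta> r) z)) \<and> peval W (\<beta> k) z = 0"
proof -
  define D where "D r j = int (e r$j) - int (e' r$j)" for r j
  have kerD: "\<forall>y::rat^4. (\<forall>r. (\<Sum>j\<in>UNIV. of_int (D r j) * y$j) = 0) \<longrightarrow> y = 0"
    using ker by (simp add: D_def)
  obtain B N where N: "N > 0" and DB: "\<And>r s. (\<Sum>j\<in>UNIV. D r j * B j s) = (if r = s then N else 0)"
    by (rule int_matrix_inverse[OF kerD]) auto
  define E where "E j s = of_int (B j s) / (of_int N :: 'a)" for j s
  have E: "vge 0 (E j s)" for j s
    using N by (cases "B j s = 0") (auto simp: E_def vge_def val_divide val_of_int)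
  have DE: "(\<Sum>j\<in>UNIV. of_int (D r j) * E j s) = (if r = s then 1 else 0)" for r s
  proof -
    have "(\<Sum>j\<in>UNIV. of_int (D r j) * E j s) = of_int (\<Sum>j\<in>UNIV. D r j * B j s) / of_int N"
      by (simp add: E_def sum_divide_distrib)
    then show ?thesis using N by (simp add: DB del: of_int_sum)
  qed
  have ne: "e r \<noteq> e' r" for r
    using be[of r] by (metis neg_equal_0_iff_equal one_neq_neg_one)
  have split: "peval W (\<beta> r) z = monom_eval (e r) z - monom_eval (e' r) z
      + (\<Sum>w\<in>W - {e r, e' r}. \<beta> r w * monom_eval w z)" for r z
  proof -
    have "peval W (\<beta> r) z = (\<Sum>w\<in>W - {e r, e' r}. \<beta> r w * monom_eval w z)
       + (\<Sum>w\<in>{e r, e' r}. \<beta> r w * monom_eval w z)"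
      unfolding peval_def using W eW by (intro sum.subset_diff) auto
    then show ?thesis using ne[of r] by (simp add: be)
  qed
  have ul: "vge \<eta> (monom_eval w z - 1)"
    "vge (\<rho> + \<eta>) (monom_eval w (z + d) - monom_eval w z - (\<Sum>j\<in>UNIV. of_nat (w$j) * d$j))"
    if "\<And>j. vge \<eta> (z$j - 1)" "\<eta> \<le> \<rho>" "\<And>j. vge \<rho> (d$j)" for w z d \<rho>
    using unit_linear_monom[OF eta, of w] that unfolding unit_linear_def by blast+
  have step: "vge (\<rho> + \<eta>) (peval W (\<beta> r) (z + d) - peval W (\<beta> r) z - (\<Sum>j\<in>UNIV. of_int (D r j) * d$j))"
    if zd: "\<And>j. vge \<eta> (z$j - 1)" "\<eta> \<le> \<rho>" "\<And>j. vge \<rho> (d$j)" for r z d \<rho>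
  proof -
    define L where "L w = (\<Sum>j\<in>UNIV. of_nat (w$j) * d$j)" for w :: "nat^4"
    have L: "vge \<rho> (L w)" for w unfolding L_def
      using vge_mult[OF vge_of_nat zd(3)] by (intro vge_sum) simp
    have lin: "vge (\<rho> + \<eta>) (monom_eval w (z + d) - monom_eval w z - L w)" for w
      using ul(2)[OF zd] by (simp add: L_def)
    have diff: "vge \<rho> (monom_eval w (z + d) - monom_eval w z)" for w
      using vge_add[OF vge_mono[OF ul(2)[OF zd] order.strict_implies_order[OF less_add_same_cancel1[THEN iffD2, OF eta]], of w] L[of w]]
      by (simp add: L_def)
    have rest: "vge (\<rho> + \<eta>) (\<Sum>w\<in>W - {e r, e' r}. \<beta> r w * (monom_eval w (z + d) - monom_eval w z))"
      using vge_mult[OF small diff] by (intro vge_sum) (auto simp: add.commute)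
    have "(\<Sum>j\<in>UNIV. of_int (D r j) * d$j) = L (e r) - L (e' r)"
      by (simp add: D_def L_def algebra_simps sum_subtractf)
    then have "peval W (\<beta> r) (z + d) - peval W (\<beta> r) z - (\<Sum>j\<in>UNIV. of_int (D r j) * d$j) =
       (monom_eval (e r) (z + d) - monom_eval (e r) z - L (e r))
       - (monom_eval (e' r) (z + d) - monom_eval (e' r) z - L (e' r))
       + (\<Sum>w\<in>W - {e r, e' r}. \<beta> r w * (monom_eval w (z + d) - monom_eval w z))"
      by (simp add: split algebra_simps sum_subtractf)
    also have "vge (\<rho> + \<eta>) \<dots>"
      by (rule vge_add[OF vge_diff[OF lin lin] rest])
    finally show ?thesis .
  qed
  have m1: "monom_eval w (1::'a^4) = 1" for w by (simp add: monom_eval_def)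
  \<comment> \<open>At z = 1 the two terms with coefficients 1 and -1 cancel, and only the small
    ones are left.\<close>
  have R1: "vge \<eta> (peval W (\<beta> r) 1)" for r
    unfolding split m1 using small[of _ r] by (auto intro!: vge_sum)
  obtain z where z: "\<And>j. vge \<eta> (z$j - 1)" and Rz: "\<And>r. vge (real (Suc n) * \<eta>) (peval W (\<beta> r) z)"
    using newton_approx[of \<eta> E "\<lambda>r j. of_int (D r j)" "\<lambda>r. peval W (\<beta> r)" n, OF eta E DE R1 step] by blast
  show ?thesis
  proof (cases "peval W (\<beta> k) z = 0")
    case True
    then show ?thesis using z Rz by blast
  next
    case False
    \<comment> \<open>Equation \<open>k\<close> depends to first order on some coordinate
      \<open>j\<close>. Restricted to that coordinate line it becomes a univariate polynomial
      \<open>H\<close>, of which an exact root near 0 is sought.\<close>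
    have "\<exists>j. D k j \<noteq> 0"
      using DB[of k k] N by (metis (no_types, lifting) less_irrefl mult_zero_left sum.neutral)
    then obtain j where j: "D k j \<noteq> 0" by blast
    obtain H where H: "\<And>T. poly H T = peval W (\<beta> k) (z + T *s axis j 1)"
      using peval_line_poly by metis
    have H0: "poly H 0 = peval W (\<beta> k) z" by (simp add: H)
    define \<mu> where "\<mu> = \<nu> (poly H 0)"
    have mu: "real (Suc n) * \<eta> \<le> \<mu>" using Rz[of k] False by (simp add: \<mu>_def H0 vge_def)
    then have mu': "\<eta> \<le> \<mu>" using eta by (smt (verit) mult_le_cancel_right1 of_nat_1 of_nat_le_iff le_add1 plus_1_eq_Suc)
    have stepT: "vge (\<mu> + \<eta>) (peval W (\<beta> r) (z + T *s axis j 1) - peval W (\<beta> r) z - of_int (D r j) * T)"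
      if "vge \<mu> T" for T r
      using step[OF z mu', of "T *s axis j 1" r] that
      by (simp add: axis_def if_distrib[of "\<lambda>x. _ * x"] cong: if_cong)
    have "\<exists>\<tau>. poly H \<tau> = 0 \<and> \<mu> \<le> \<nu> \<tau>"
    proof (rule ccontr)
      assume "\<not> ?thesis"
      then have far: "\<And>\<tau>. poly H \<tau> = 0 \<Longrightarrow> \<nu> \<tau> < \<mu>" by force
      \<comment> \<open>One Newton step for \<open>H\<close>. It cancels the linear part and so
        raises the valuation above \<mu>, which is impossible when all roots are far from 0.\<close>
      define T where "T = - poly H 0 / of_int (D k j)"
      have T0: "T \<noteq> 0" and Tv: "\<nu> T = \<mu>"
        using False j by (auto simp: T_def H0 \<mu>_def val_divide val_minus val_of_int)
      have "poly H T \<noteq> 0 \<and> \<nu> (poly H T) = \<mu>"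
        using poly_val_eq_at_0_if_roots_far[OF ac _ far T0] Tv False H0 \<mu>_def by simp
      moreover have "vge (\<mu> + \<eta>) (poly H T)"
        using stepT[of T k] Tv j by (simp add: vge_def H T_def)
      ultimately show False using eta by (simp add: vge_def)
    qed
    then obtain \<tau> where tau: "poly H \<tau> = 0" "\<mu> \<le> \<nu> \<tau>" by blast
    have vt: "vge \<mu> \<tau>" using tau by (simp add: vge_def)
    \<comment> \<open>The exact root moves \<open>z\<close> by at most the precision already
      reached, so the other equations stay solved to that precision.\<close>
    have "vge (real (Suc n) * \<eta>) (peval W (\<beta> r) (z + \<tau> *s axis j 1))" for r
    proof -
      have "vge (real (Suc n) * \<eta>) (of_int (D r j) * \<tau>)"
        using vge_mult[OF vge_of_int vt] mu by (auto intro: vge_mono)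
      moreover have "real (Suc n) * \<eta> \<le> \<mu> + \<eta>" using mu eta by simp
      ultimately have "vge (real (Suc n) * \<eta>) ((peval W (\<beta> r) (z + \<tau> *s axis j 1) - peval W (\<beta> r) z - of_int (D r j) * \<tau>)
        + peval W (\<beta> r) z + of_int (D r j) * \<tau>)"
        using vge_mono[OF stepT[OF vt, of r]] Rz by (intro vge_add) auto
      then show ?thesis by simp
    qed
    moreover have "vge \<eta> ((z + \<tau> *s axis j 1)$i - 1)" for i
      using vge_add[OF z[of i] vge_mono[OF vt mu']] z[of i]
      by (cases "i = j") (auto simp: axis_def algebra_simps)
    ultimately show ?thesis using tau(1) H by (intro exI[of _ "z + \<tau> *s axis j 1"]) auto
  qed
qed

text \<open>Rescaling by an exact solution \<open>x\<close> of the leading binomials and dividing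
  equation \<open>r\<close> by its leading term \<open>A r\<close> makes the leading coefficients 1
  and -1 and gives all others positive valuation, which is the situation near 1.\<close>

lemma binomial_system_solution:
  fixes C :: "4 \<Rightarrow> nat^4 \<Rightarrow> 'a" and e e' :: "4 \<Rightarrow> nat^4" and p :: "real^4" and K :: real
  assumes ac: "alg_closed_field TYPE('a)" and W: "finite W"
    and eW: "\<And>r. e r \<in> W" "\<And>r. e' r \<in> W"
    and Ce: "\<And>r. C r (e r) \<noteq> 0" "\<And>r. C r (e' r) \<noteq> 0"
    and eq: "\<And>r. \<nu> (C r (e r)) - pairing p (e r) = \<nu> (C r (e' r)) - pairing p (e' r)"
    and lt: "\<And>r w. w \<in> W \<Longrightarrow> w \<noteq> e r \<Longrightarrow> w \<noteq> e' r \<Longrightarrow> C r w \<noteq> 0 \<Longrightarrow>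
              \<nu> (C r (e r)) - pairing p (e r) < \<nu> (C r w) - pairing p w"
    and ker: "\<forall>y::rat^4. (\<forall>r. (\<Sum>j\<in>UNIV. of_int (int (e r$j) - int (e' r$j)) * y$j) = 0) \<longrightarrow> y = 0"
  shows "\<exists>x. (\<forall>j. x$j \<noteq> 0 \<and> \<nu> (x$j) = - p$j) \<and> (\<forall>r. vge K (peval W (C r) x)) \<and> peval W (C k) x = 0"
proof -
  define D where "D r j = int (e r$j) - int (e' r$j)" for r j
  define \<gamma> where "\<gamma> r = - C r (e' r) / C r (e r)" for r
  have g0: "\<gamma> r \<noteq> 0" for r using Ce by (simp add: \<gamma>_def)
  have gv: "\<nu> (\<gamma> r) = - (\<Sum>j\<in>UNIV. of_int (D r j) * p$j)" for r
  proof -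
    have "\<nu> (\<gamma> r) = pairing p (e' r) - pairing p (e r)"
      using eq[of r] Ce by (simp add: \<gamma>_def val_divide val_minus)
    then show ?thesis by (simp add: pairing_def D_def sum_negf[symmetric] sum_subtractf[symmetric] algebra_simps)
  qed
  have kerD: "\<forall>y::rat^4. (\<forall>r. (\<Sum>j\<in>UNIV. of_int (D r j) * y$j) = 0) \<longrightarrow> y = 0"
    using ker by (simp add: D_def)
  obtain x :: "'a^4" where x: "\<And>j. x$j \<noteq> 0 \<and> \<nu> (x$j) = - p$j"
    and xD: "\<And>r. (\<Prod>j\<in>UNIV. x$j powi D r j) = \<gamma> r"
    using exact_binomial_solution[OF ac kerD g0 gv] by auto
  have mx: "monom_eval w x \<noteq> 0" for w using x by (intro monom_eval_nonzero) auto
  define A where "A r = C r (e r) * monom_eval (e r) x" for r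
  have A0: "A r \<noteq> 0" for r using Ce mx by (simp add: A_def)
  have vterm: "\<nu> (C r w * monom_eval w x) = \<nu> (C r w) - pairing p w" if "C r w \<noteq> 0" for r w
    using that mx[of w] val_monom[OF x, of w] by (simp add: val_mult)
  define \<beta> where "\<beta> r w = C r w * monom_eval w x / A r" for r w
  have b1: "\<beta> r (e r) = 1" for r using A0 by (simp add: \<beta>_def A_def)
  have b2: "\<beta> r (e' r) = - 1" for r
  proof -
    have "monom_eval (e r) x / monom_eval (e' r) x = (\<Prod>j\<in>UNIV. x$j powi D r j)"
      using x by (simp add: monom_eval_def D_def power_int_diff prod_dividef)
    then have "monom_eval (e r) x = \<gamma> r * monom_eval (e' r) x" using mx xD by (simp add: field_simps)
    then show ?thesis using Ce[of r] mx[of "e' r"] by (simp add: \<beta>_def A_def \<gamma>_def)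
  qed
  have bv: "\<nu> (\<beta> r w) > 0" if "w \<in> W" "w \<noteq> e r" "w \<noteq> e' r" "\<beta> r w \<noteq> 0" for r w
  proof -
    have c: "C r w \<noteq> 0" using that by (auto simp: \<beta>_def)
    then have "\<nu> (\<beta> r w) = \<nu> (C r w * monom_eval w x) - \<nu> (A r)"
      unfolding \<beta>_def using mx A0 by (intro val_divide) auto
    then show ?thesis using lt[OF that(1-3) c] vterm[OF c] vterm[OF Ce(1)] by (simp add: A_def)
  qed
  \<comment> \<open>There are finitely many coefficients, so their positive valuations have a
    positive lower bound; the inserted 1 covers the case where there are none.\<close>
  define V where "V = {\<nu> (\<beta> r w) | r w. w \<in> W \<and> \<nu> (\<beta> r w) > 0}"
  have "V \<subseteq> (\<lambda>(r, w). \<nu> (\<beta> r w)) ` (UNIV \<times> W)" by (auto simp: V_def)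
  then have finV: "finite V" by (rule finite_subset) (use W in auto)
  define \<eta> where "\<eta> = Min (insert 1 V)"
  have eta: "\<eta> > 0" using finV by (auto simp: \<eta>_def V_def)
  have small: "vge \<eta> (\<beta> r w)" if "w \<in> W" "w \<noteq> e r" "w \<noteq> e' r" for r w
  proof (cases "\<beta> r w = 0")
    case False
    then have "\<nu> (\<beta> r w) \<in> V" using bv[OF that] that by (auto simp: V_def)
    then show ?thesis using finV by (auto simp: \<eta>_def vge_def)
  qed simp
  \<comment> \<open>Multiplying back by \<open>A r\<close> shifts the precision by
    \<open>\<nu> (A r)\<close>; the number of Newton steps is chosen to compensate for the worst
    shift \<open>m\<close>.\<close>
  define m where "m = Min (range (\<lambda>r. \<nu> (A r)))"
  have m: "m \<le> \<nu> (A r)" for r by (simp add: m_def)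
  obtain n :: nat where "(K - m) / \<eta> \<le> real n" using real_arch_simple by blast
  then have n: "K - m \<le> real (Suc n) * \<eta>" using eta by (simp add: field_simps)
  obtain z where z: "\<And>j. vge \<eta> (z$j - 1)" and zr: "\<And>r. vge (real (Suc n) * \<eta>) (peval W (\<beta> r) z)"
    and zk: "peval W (\<beta> k) z = 0"
    using near_one_solution[OF ac W eta eW b1 b2 small ker, of n k] by blast
  define X where "X = (\<chi> j. x$j * z$j)"
  have PX: "peval W (C r) X = A r * peval W (\<beta> r) z" for r
    using A0 by (simp add: peval_def X_def monom_eval_scale \<beta>_def sum_distrib_left field_simps)
  have "X$j \<noteq> 0 \<and> \<nu> (X$j) = - p$j" for j
  proof -
    have "z$j \<noteq> 0 \<and> \<nu> (z$j) = 0"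
      using val_add_dominant[of 1 \<eta> "z$j - 1"] z eta by (simp add: val_1)
    then show ?thesis using x by (simp add: X_def val_mult)
  qed
  moreover have "vge K (peval W (C r) X)" for r
  proof -
    have "vge (\<nu> (A r) + real (Suc n) * \<eta>) (peval W (C r) X)"
      unfolding PX by (intro vge_mult zr) (simp add: vge_def)
    then show ?thesis by (rule vge_mono) (use n m[of r] in linarith)
  qed
  moreover have "peval W (C k) X = 0" by (simp add: PX zk)
  ultimately show ?thesis by blast
qed

end

section \<open>Balanced terms of concave piecewise linear functions\<close>


text \<open>Maximising over the pairs \<open>(x, m)\<close> with \<open>m \<le> \<kappa> e + l e \<bullet> x\<close> avoids any discussion of
  the minimum as a function of \<open>x\<close>.\<close>

lemma max_min_affine:
  fixes l :: "'b \<Rightarrow> 'v::euclidean_space" and \<kappa> :: "'b \<Rightarrow> real"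
  assumes ne: "E \<noteq> {}" and fin: "finite E"
    and bd: "bounded {x. \<forall>e\<in>E. 0 \<le> \<kappa> e + l e \<bullet> x}"
    and x0: "\<forall>e\<in>E. 0 < \<kappa> e + l e \<bullet> x0"
  shows "\<exists>x m. m > 0 \<and> (\<forall>e\<in>E. m \<le> \<kappa> e + l e \<bullet> x)
    \<and> (\<forall>y m'. (\<forall>e\<in>E. m' \<le> \<kappa> e + l e \<bullet> y) \<longrightarrow> m' \<le> m)
    \<and> (\<forall>d. \<exists>e\<in>E. \<kappa> e + l e \<bullet> x = m \<and> l e \<bullet> d \<le> 0)"
proof -
  \<comment> \<open>Cutting the hypograph at height 0 makes it compact, and \<open>x0\<close> shows
    that it still reaches a positive height.\<close>
  define T where "T = {z::'v \<times> real. 0 \<le> snd z \<and> (\<forall>e\<in>E. snd z \<le> \<kappa> e + l e \<bullet> fst z)}"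
  have "T = {z. 0 \<le> snd z} \<inter> (\<Inter>e\<in>E. {z. snd z \<le> \<kappa> e + l e \<bullet> fst z})"
    by (auto simp: T_def)
  moreover have "closed \<dots>"
    by (intro closed_Int closed_INT ballI closed_Collect_le continuous_intros)
  ultimately have clT: "closed T" by simp
  obtain e0 where e0: "e0 \<in> E" using ne by blast
  obtain B where B: "\<And>x. (\<forall>e\<in>E. 0 \<le> \<kappa> e + l e \<bullet> x) \<Longrightarrow> norm x \<le> B"
    using bd unfolding bounded_iff by blast
  have "bounded T"
    unfolding bounded_iff
  proof (intro exI ballI)
    fix z assume z: "z \<in> T"
    then have n: "norm (fst z) \<le> B" by (intro B) (fastforce simp: T_def)
    have "snd z \<le> \<kappa> e0 + l e0 \<bullet> fst z" using z e0 by (auto simp: T_def)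
    also have "l e0 \<bullet> fst z \<le> norm (l e0) * norm (fst z)" by (rule norm_cauchy_schwarz)
    also have "\<dots> \<le> norm (l e0) * B" using n by (intro mult_left_mono) auto
    finally have "\<bar>snd z\<bar> \<le> \<kappa> e0 + norm (l e0) * B" using z by (auto simp: T_def)
    moreover have "norm z \<le> norm (fst z) + norm (snd z)" by (metis norm_Pair_le prod.collapse)
    ultimately show "norm z \<le> B + (\<kappa> e0 + norm (l e0) * B)" using n by simp
  qed
  then have "compact T" using clT by (simp add: compact_eq_bounded_closed)
  moreover define m0 where "m0 = Min ((\<lambda>e. \<kappa> e + l e \<bullet> x0) ` E)"
  have m0: "m0 > 0" "\<And>e. e \<in> E \<Longrightarrow> m0 \<le> \<kappa> e + l e \<bullet> x0"
    using fin ne x0 by (auto simp: m0_def)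
  then have "(x0, m0) \<in> T" by (auto simp: T_def)
  moreover have "continuous_on T snd" by (intro continuous_intros)
  ultimately obtain z where z: "z \<in> T" and mx: "\<And>y. y \<in> T \<Longrightarrow> snd y \<le> snd z"
    using continuous_attains_sup[of T snd] by blast
  define x m where "x = fst z" and "m = snd z"
  have m: "m > 0" using mx[OF \<open>(x0, m0) \<in> T\<close>] m0 by (simp add: m_def)
  have le: "m \<le> \<kappa> e + l e \<bullet> x" if "e \<in> E" for e
    using z that by (auto simp: T_def x_def m_def)
  have opt: "m' \<le> m" if "\<And>e. e \<in> E \<Longrightarrow> m' \<le> \<kappa> e + l e \<bullet> y" for y m'
  proof (cases "0 \<le> m'")
    case True
    then show ?thesis using mx[of "(y, m')"] that by (auto simp: T_def m_def)
  qed (use m in simp)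
  \<comment> \<open>If every active term increased along \<open>d\<close>, a short enough step would
    keep the inactive terms above \<open>m\<close> and lift the active ones above it, contradicting
    maximality.\<close>
  have "\<exists>e\<in>E. \<kappa> e + l e \<bullet> x = m \<and> l e \<bullet> d \<le> 0" for d
  proof (rule ccontr)
    assume no: "\<not> ?thesis"
    have "\<exists>\<epsilon>>0. \<forall>t. 0 < t \<and> t \<le> \<epsilon> \<longrightarrow> m < \<kappa> e + l e \<bullet> (x + t *\<^sub>R d)" if "e \<in> E" for e
    proof (cases "\<kappa> e + l e \<bullet> x = m")
      case True
      then have "l e \<bullet> d > 0" using no that by force
      then show ?thesis using True by (intro exI[of _ 1]) (auto simp: inner_add_right)
    next
      case False
      define g where "g = \<kappa> e + l e \<bullet> x - m"
      have g: "g > 0" using False le[OF that] by (simp add: g_def)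
      define \<epsilon> where "\<epsilon> = g / (2 * (\<bar>l e \<bullet> d\<bar> + 1))"
      have "m < \<kappa> e + l e \<bullet> (x + t *\<^sub>R d)" if t: "0 < t" "t \<le> \<epsilon>" for t
      proof -
        have "\<bar>t * (l e \<bullet> d)\<bar> \<le> \<epsilon> * (\<bar>l e \<bullet> d\<bar> + 1)"
          unfolding abs_mult using t by (intro mult_mono) auto
        also have "\<dots> = g / 2" unfolding \<epsilon>_def by (simp add: field_simps)
        finally show ?thesis using g by (simp add: g_def inner_add_right abs_le_iff)
      qed
      moreover have "\<epsilon> > 0" unfolding \<epsilon>_def using g by simp
      ultimately show ?thesis by blast
    qed
    then obtain \<epsilon> where \<epsilon>: "\<And>e. e \<in> E \<Longrightarrow> \<epsilon> e > 0"
      "\<And>e t. e \<in> E \<Longrightarrow> 0 < t \<Longrightarrow> t \<le> \<epsilon> e \<Longrightarrow> m < \<kappa> e + l e \<bullet> (x + t *\<^sub>R d)"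
      by metis
    define t where "t = Min (\<epsilon> ` E)"
    have t: "t > 0" "\<And>e. e \<in> E \<Longrightarrow> t \<le> \<epsilon> e" using fin ne \<epsilon>(1) by (auto simp: t_def)
    define m' where "m' = Min ((\<lambda>e. \<kappa> e + l e \<bullet> (x + t *\<^sub>R d)) ` E)"
    have "m < m'" using fin ne \<epsilon>(2) t by (auto simp: m'_def)
    moreover have "m' \<le> m" by (rule opt[of _ "x + t *\<^sub>R d"]) (use fin in \<open>auto simp: m'_def\<close>)
    ultimately show False by simp
  qed
  then show ?thesis using m le opt by blast
qed

text \<open>A group \<open>X\<close> of terms with only k values costs \<open>card X - k\<close>
  distinct values, whatever happens elsewhere. This turns a lower bound on the number of values into
  an upper bound on the size of such a group.\<close>

lemma card_image_le_coincidence: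
  assumes "finite E" "X \<subseteq> E" "card (f ` X) \<le> k"
  shows "card (f ` E) + card X \<le> card E + k"
proof -
  have fX: "finite X" using assms finite_subset by blast
  have "f ` E = f ` X \<union> f ` (E - X)" using assms(2) by auto
  then have "card (f ` E) \<le> card (f ` X) + card (f ` (E - X))" by (simp add: card_Un_le)
  moreover have "card (f ` (E - X)) \<le> card (E - X)" using assms by (simp add: card_image_le)
  moreover have "card (E - X) = card E - card X" "card X \<le> card E"
    using assms fX by (auto simp: card_Diff_subset card_mono)
  ultimately show ?thesis using assms(3) by linarith
qed

text \<open>At the maximum of the least nonconstant term some active term falls and some active term
  rises. A third active one would make three terms equal, two coincidences where only one is
  allowed. Constant terms are left out of the maximisation; they are positive everywhere.\<close>

lemma transversal_pair_1:
  fixes a :: "'b \<Rightarrow> int" and \<kappa> :: "'b \<Rightarrow> real"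
  defines "L \<equiv> \<lambda>e s. \<kappa> e + of_int (a e) * s"
  assumes fin: "finite E"
    and bd: "bounded {s. \<forall>e\<in>E. 0 \<le> L e s}"
    and s0: "\<And>e. e \<in> E \<Longrightarrow> 0 < L e s0"
    and gen: "\<And>s. (\<And>e. e \<in> E \<Longrightarrow> 0 < L e s) \<Longrightarrow> card E \<le> card ((\<lambda>e. L e s) ` E) + 1"
  obtains s e e' where "\<forall>w\<in>E. 0 < L w s" and "e \<in> E" "e' \<in> E" "a e \<noteq> a e'" "a e \<noteq> 0" "a e' \<noteq> 0"
    and "L e s = L e' s" and "\<forall>w\<in>E - {e, e'}. a w \<noteq> 0 \<longrightarrow> L e s < L w s"
proof -
  define E1 where "E1 = {e\<in>E. a e \<noteq> 0}"
  have const: "L e s = L e s0" if "e \<in> E" "e \<notin> E1" for e s using that by (auto simp: L_def E1_def)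
  have reg: "{s. \<forall>e\<in>E1. 0 \<le> \<kappa> e + of_int (a e) \<bullet> s} = {s. \<forall>e\<in>E. 0 \<le> L e s}"
    using const s0 by (force simp: L_def E1_def)
  have ne: "E1 \<noteq> {}"
  proof
    assume "E1 = {}"
    then have "{s. \<forall>e\<in>E. 0 \<le> L e s} = UNIV" using reg by auto
    then show False using bd not_bounded_UNIV by metis
  qed
  have fin1: "finite E1" using fin by (simp add: E1_def)
  have bd1: "bounded {s::real. \<forall>e\<in>E1. 0 \<le> \<kappa> e + of_int (a e) \<bullet> s}" unfolding reg by (rule bd)
  have s1: "\<forall>e\<in>E1. 0 < \<kappa> e + of_int (a e) \<bullet> s0" using s0 by (auto simp: E1_def L_def)
  from max_min_affine[OF ne fin1 bd1 s1] obtain s m :: real where m: "m > 0" and ge': "\<forall>e\<in>E1. m \<le> \<kappa> e + of_int (a e) \<bullet> s"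
    and dir': "\<forall>d::real. \<exists>e\<in>E1. \<kappa> e + of_int (a e) \<bullet> s = m \<and> of_int (a e) \<bullet> d \<le> 0"
    by blast
  have ge: "\<And>e. e \<in> E1 \<Longrightarrow> m \<le> L e s" using ge' by (simp add: L_def)
  have dir: "\<And>d::real. \<exists>e\<in>E1. L e s = m \<and> of_int (a e) * d \<le> 0" using dir' by (simp add: L_def)
  have pos: "0 < L w s" if "w \<in> E" for w
    using ge[of w] m const[OF that, of s] s0[OF that] by (cases "w \<in> E1") auto
  obtain e where e: "e \<in> E1" "L e s = m" "a e < 0" using dir[of 1] by (force simp: E1_def)
  obtain e' where e': "e' \<in> E1" "L e' s = m" "a e' > 0" using dir[of "-1"] by (force simp: E1_def)
  have "L e s < L w s" if w: "w \<in> E" "w \<noteq> e" "w \<noteq> e'" "a w \<noteq> 0" for w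
  proof (rule ccontr)
    assume "\<not> ?thesis"
    then have "L w s = m" using ge[of w] w e by (auto simp: E1_def)
    then have "(\<lambda>e. L e s) ` {e, e', w} = {m}" using e e' by auto
    then have "card ((\<lambda>e. L e s) ` E) + card {e, e', w} \<le> card E + 1"
      using fin e e' w by (intro card_image_le_coincidence) (auto simp: E1_def)
    moreover have "card {e, e', w} = 3" using w e e' by (auto simp: card_insert_if)
    ultimately show False using gen[OF pos] by simp
  qed
  then show ?thesis using that[of s e e'] pos e e' by (auto simp: E1_def)
qed

text \<open>Each of the functionals \<open>(p, q)\<close> and \<open>(p', q')\<close> sees exactly two minimal terms. If two of the
  minimal terms at the maximum are antiparallel, one moves along the line on which both stay minimal;
  otherwise three minimal terms surround the origin.\<close>

lemma transversal_pairs_2: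
  fixes a b :: "'b \<Rightarrow> int" and \<kappa> :: "'b \<Rightarrow> real"
  defines "L \<equiv> \<lambda>e z. \<kappa> e + (of_int (a e), of_int (b e)) \<bullet> (z :: real \<times> real)"
  assumes fin: "finite E"
    and bd: "bounded {z. \<forall>e\<in>E. 0 \<le> L e z}"
    and z0: "\<And>e. e \<in> E \<Longrightarrow> 0 < L e z0"
    and gen: "\<And>z. (\<And>e. e \<in> E \<Longrightarrow> 0 < L e z) \<Longrightarrow> card E \<le> card ((\<lambda>e. L e z) ` E) + 2"
  obtains z and p q p' q' :: int and e e' f f'
    where "\<forall>w\<in>E. 0 < L w z" and "e \<in> E" "e' \<in> E" "f \<in> E" "f' \<in> E"
      and "p * a e + q * b e \<noteq> 0" "p * a e' + q * b e' \<noteq> 0"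
      and "p' * a f + q' * b f \<noteq> 0" "p' * a f' + q' * b f' \<noteq> 0"
      and "L e z = L e' z"
      and "\<forall>w\<in>E - {e, e'}. p * a w + q * b w \<noteq> 0 \<longrightarrow> L e z < L w z"
      and "L f z = L f' z"
      and "\<forall>w\<in>E - {f, f'}. p' * a w + q' * b w \<noteq> 0 \<longrightarrow> L f z < L w z"
      and "p * q' - q * p' \<noteq> 0"
      and "(a e - a e') * (b f - b f') - (b e - b e') * (a f - a f') \<noteq> 0"
proof -
  note witness = that
  define l :: "'b \<Rightarrow> real \<times> real" where "l e = (of_int (a e), of_int (b e))" for e
  have L: "L e z = \<kappa> e + l e \<bullet> z" for e z by (simp add: L_def l_def)
  \<comment> \<open>Terms with zero gradient are constant and positive, so they neither bound the
    region nor take part in the maximisation.\<close>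
  define E1 where "E1 = {e\<in>E. a e \<noteq> 0 \<or> b e \<noteq> 0}"
  have const: "L e z = L e z0" if "e \<in> E" "e \<notin> E1" for e z using that by (auto simp: L_def E1_def inner_prod_def)
  have reg: "{z. \<forall>e\<in>E1. 0 \<le> \<kappa> e + l e \<bullet> z} = {z. \<forall>e\<in>E. 0 \<le> L e z}"
    (is "?A = ?B")
  proof (intro set_eqI iffI)
    fix z assume z: "z \<in> ?A"
    have "0 \<le> L e z" if "e \<in> E" for e
      using z const[OF that, of z] z0[OF that] by (cases "e \<in> E1") (auto simp: L)
    then show "z \<in> ?B" by simp
  next
    fix z assume "z \<in> ?B" then show "z \<in> ?A" by (auto simp: L E1_def)
  qed
  have "E1 \<noteq> {}"
  proof
    assume "E1 = {}"
    then have "{z. \<forall>e\<in>E. 0 \<le> L e z} = UNIV" using reg by auto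
    then show False using bd not_bounded_UNIV by metis
  qed
  moreover have "finite E1" using fin by (simp add: E1_def)
  moreover have "bounded {z. \<forall>e\<in>E1. 0 \<le> \<kappa> e + l e \<bullet> z}" unfolding reg by (rule bd)
  moreover have "\<forall>e\<in>E1. 0 < \<kappa> e + l e \<bullet> z0" using z0 by (auto simp: E1_def L)
  ultimately obtain x m where m: "m > 0" and ge': "\<forall>e\<in>E1. m \<le> \<kappa> e + l e \<bullet> x"
    and dir': "\<forall>d. \<exists>e\<in>E1. \<kappa> e + l e \<bullet> x = m \<and> l e \<bullet> d \<le> 0"
    using max_min_affine[of E1 \<kappa> l z0] by blast
  have ge: "m \<le> L e x" if "e \<in> E1" for e using ge' that by (simp add: L)
  have dir: "\<exists>e\<in>E1. L e x = m \<and> l e \<bullet> d \<le> 0" for d using dir'[rule_format, of d] by (simp add: L)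
  have pos: "0 < L w x" if "w \<in> E" for w
    using ge[of w] m const[OF that, of x] z0[OF that] by (cases "w \<in> E1") auto
  have few: "card X \<le> k + 2"
    if X: "X \<subseteq> E" "card ((\<lambda>e. L e z) ` X) \<le> k" and p: "\<And>w. w \<in> E \<Longrightarrow> 0 < L w z" for X k z
    using card_image_le_coincidence[OF fin X] gen[of z] p by fastforce
  show ?thesis
  proof (cases "\<exists>e\<in>E1. \<exists>e'\<in>E1. L e x = m \<and> L e' x = m \<and> a e * b e' - b e * a e' = 0 \<and> a e * a e' + b e * b e' < 0")
    case True
    then obtain e e' where e: "e \<in> E1" "L e x = m" and e': "e' \<in> E1" "L e' x = m"
      and par: "a e * b e' - b e * a e' = 0" and anti: "a e * a e' + b e * b e' < 0" by blast
    \<comment> \<open>The direction \<open>d\<close> is orthogonal to the common line of the two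
      antiparallel gradients, so both terms keep the value \<open>m\<close> along
      \<open>x + t d\<close>. Maximising the remaining terms on this line produces the second
      pair.\<close>
    define P Q where "P = - b e" and "Q = a e"
    define d :: "real \<times> real" where "d = (of_int P, of_int Q)"
    have ld: "l w \<bullet> d = of_int (P * a w + Q * b w)" for w by (simp add: l_def d_def)
    define E2 where "E2 = {w\<in>E1. P * a w + Q * b w \<noteq> 0}"
    have cst: "L w (x + t *\<^sub>R d) = L w x" if "w \<in> E" "w \<notin> E2" for w t
    proof -
      have "P * a w + Q * b w = 0" using that by (auto simp: E2_def E1_def)
      then show ?thesis by (simp add: L inner_add_right ld)
    qed
    have Lt: "L w (x + t *\<^sub>R d) = L w x + (l w \<bullet> d) * t" for w t by (simp add: L inner_add_right)
    have dn: "d \<noteq> 0" using e by (auto simp: d_def P_def Q_def E1_def zero_prod_def)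
    have reg2: "(\<forall>w\<in>E. 0 \<le> L w (x + t *\<^sub>R d))" if "\<forall>w\<in>E2. 0 \<le> L w x + (l w \<bullet> d) * t" for t
      using that cst pos Lt by (metis less_imp_le)
    obtain B where B: "\<And>z. (\<forall>w\<in>E. 0 \<le> L w z) \<Longrightarrow> norm z \<le> B" using bd unfolding bounded_iff by blast
    have bd2: "bounded {t. \<forall>w\<in>E2. 0 \<le> L w x + (l w \<bullet> d) \<bullet> t}"
      unfolding bounded_iff
    proof (intro exI ballI)
      fix t :: real assume "t \<in> {t. \<forall>w\<in>E2. 0 \<le> L w x + (l w \<bullet> d) \<bullet> t}"
      then have "norm (x + t *\<^sub>R d) \<le> B" using reg2[of t] B by (simp add: inner_real_def)
      moreover have "\<bar>t\<bar> * norm d \<le> norm (x + t *\<^sub>R d) + norm x"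
        using norm_triangle_ineq4[of "x + t *\<^sub>R d" x] by simp
      ultimately show "norm t \<le> (B + norm x) / norm d" using dn by (simp add: field_simps)
    qed
    have "E2 \<noteq> {}"
    proof
      assume "E2 = {}"
      then have "{t. \<forall>w\<in>E2. 0 \<le> L w x + (l w \<bullet> d) \<bullet> t} = (UNIV::real set)" by auto
      then show False using bd2 not_bounded_UNIV by metis
    qed
    moreover have "finite E2" using fin by (simp add: E1_def E2_def)
    moreover have "\<forall>w\<in>E2. 0 < L w x + (l w \<bullet> d) \<bullet> 0" using pos by (auto simp: E2_def E1_def)
    ultimately obtain t m2 where m2': "\<forall>w\<in>E2. m2 \<le> L w x + (l w \<bullet> d) \<bullet> t"
      and opt': "\<forall>y m'. (\<forall>w\<in>E2. m' \<le> L w x + (l w \<bullet> d) \<bullet> y) \<longrightarrow> m' \<le> m2"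
      and dir2': "\<forall>r. \<exists>w\<in>E2. L w x + (l w \<bullet> d) \<bullet> t = m2 \<and> (l w \<bullet> d) \<bullet> r \<le> 0"
      using max_min_affine[of E2 "\<lambda>w. L w x" "\<lambda>w. l w \<bullet> d" 0] bd2 by blast
    have m2: "m2 \<le> L w x + (l w \<bullet> d) * t" if "w \<in> E2" for w using m2' that by simp
    have dir2: "\<exists>w\<in>E2. L w x + (l w \<bullet> d) * t = m2 \<and> (l w \<bullet> d) * r \<le> 0" for r using dir2' by simp
    define y where "y = x + t *\<^sub>R d"
    have Ly: "L w y = L w x + (l w \<bullet> d) * t" for w by (simp add: y_def Lt)
    \<comment> \<open>The parameter 0, that is the point \<open>x\<close> itself, competes in the
      second maximisation.\<close>
    have le: "m \<le> m2" by (rule opt'[rule_format, of _ 0]) (use ge in \<open>auto simp: E2_def\<close>)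
    obtain f where f0: "f \<in> E2" "L f x + (l f \<bullet> d) * t = m2" "l f \<bullet> d \<le> 0" using dir2[of 1] by auto
    then have "of_int (P * a f + Q * b f) \<le> (0::real)" by (simp only: ld)
    then have "P * a f + Q * b f \<le> 0" by (simp only: of_int_le_0_iff)
    then have f: "f \<in> E2" "L f y = m2" "P * a f + Q * b f < 0" using f0 by (auto simp: E2_def Ly)
    obtain f' where f0': "f' \<in> E2" "L f' x + (l f' \<bullet> d) * t = m2" "0 \<le> l f' \<bullet> d" using dir2[of "-1"] by auto
    then have "(0::real) \<le> of_int (P * a f' + Q * b f')" by (simp only: ld)
    then have "0 \<le> P * a f' + Q * b f'" by (simp only: of_int_0_le_iff)
    then have f': "f' \<in> E2" "L f' y = m2" "P * a f' + Q * b f' > 0" using f0' by (auto simp: E2_def Ly)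
    have posy: "0 < L w y" if "w \<in> E" for w
    proof (cases "w \<in> E2")
      case True
      then show ?thesis using m2[of w] le m by (simp add: Ly)
    next
      case False
      then show ?thesis using cst[OF that, of t] pos[OF that] by (simp add: y_def)
    qed
    have eP: "P * a e + Q * b e = 0" "P * a e' + Q * b e' = 0"
      using par by (auto simp: P_def Q_def algebra_simps)
    have ey: "L e y = m" "L e' y = m" using e e' eP by (simp_all add: Ly ld del: of_int_add of_int_mult)
    have inE: "e \<in> E" "e' \<in> E" "f \<in> E" "f' \<in> E" using e e' f f' by (auto simp: E1_def E2_def)
    have ee': "e \<noteq> e'"
    proof
      assume "e = e'"
      then have "a e * a e + b e * b e < 0" using anti by simp
      then show False by (smt (verit) zero_le_square)
    qed
    have dis: "card {e, e', f, f'} = 4"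
      using ee' f f' eP by (auto simp: card_insert_if)
    \<comment> \<open>Otherwise four terms would agree at \<open>y\<close>, while genericity allows
      at most three with one common value.\<close>
    have mm: "m < m2"
    proof (rule ccontr)
      assume "\<not> m < m2"
      then have "(\<lambda>w. L w y) ` {e, e', f, f'} = {m}" using le ey f f' by auto
      then have "card {e, e', f, f'} \<le> 1 + 2" using inE by (intro few[OF _ _ posy]) auto
      then show False using dis by simp
    qed
    \<comment> \<open>The two pairs already use up both permitted coincidences, so no fifth term can
      share either value.\<close>
    have five: False if "w \<in> E" "w \<notin> {e, e', f, f'}" "L w y = m \<or> L w y = m2" for w
    proof -
      have "(\<lambda>w. L w y) ` {w, e, e', f, f'} \<subseteq> {m, m2}" using that ey f f' by auto
      then have "card ((\<lambda>w. L w y) ` {w, e, e', f, f'}) \<le> card {m, m2}" by (intro card_mono) auto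
      then have "card ((\<lambda>w. L w y) ` {w, e, e', f, f'}) \<le> 2" using mm by simp
      then have "card {w, e, e', f, f'} \<le> 2 + 2" using inE that by (intro few[OF _ _ posy]) auto
      moreover have "card {w, e, e', f, f'} = Suc (card {e, e', f, f'})"
        using that by (intro card_insert_disjoint) auto
      ultimately show False using dis by simp
    qed
    have F: "L f y < L w y" if w: "w \<in> E" "w \<noteq> f" "w \<noteq> f'" "P * a w + Q * b w \<noteq> 0" for w
    proof -
      have "w \<in> E2" using w by (auto simp: E2_def E1_def)
      then have "m2 \<le> L w y" using m2 by (simp add: Ly)
      moreover have "L w y \<noteq> m2" using five[of w] w eP by auto
      ultimately show ?thesis using f by simp
    qed
    \<comment> \<open>The functional for the first pair is the gradient of \<open>e\<close>; it is
      nonzero on \<open>e\<close> and on the antiparallel \<open>e'\<close>. The terms varying along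
      \<open>d\<close> lie at height \<open>m2\<close> or more, so only terms constant along
      \<open>d\<close> have to be excluded by \<open>five\<close>.\<close>
    have G: "L e y < L w y" if w: "w \<in> E" "w \<noteq> e" "w \<noteq> e'" "a e * a w + b e * b w \<noteq> 0" for w
    proof (cases "w \<in> E2")
      case True
      then have "m2 \<le> L w y" using m2 by (simp add: Ly)
      then show ?thesis using mm ey by simp
    next
      case False
      have "w \<in> E1" using w by (auto simp: E1_def)
      then have "m \<le> L w y" using cst[OF w(1) False, of t] ge by (simp add: y_def)
      moreover have "L w y \<noteq> m" using five[of w] w False f f' by auto
      ultimately show ?thesis using ey by simp
    qed
    have e1: "a e * a e + b e * b e \<noteq> 0" using e by (auto simp: E1_def sum_squares_eq_zero_iff)
    have e2: "a e * a e' + b e * b e' \<noteq> 0" using anti by simp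
    have "a e * Q - b e * P \<noteq> 0" using e1 by (simp add: P_def Q_def)
    \<comment> \<open>The difference of two antiparallel vectors is a nonzero multiple of the
      gradient of \<open>e\<close>. A vanishing determinant would make \<open>f\<close> and
      \<open>f'\<close> agree along \<open>d\<close>, but their slopes there have opposite
      signs.\<close>
    moreover have "(a e - a e') * (b f - b f') - (b e - b e') * (a f - a f') \<noteq> 0"
    proof
      assume z: "(a e - a e') * (b f - b f') - (b e - b e') * (a f - a f') = 0"
      define N M where "N = a e * a e + b e * b e" and "M = a e * a e' + b e * b e'"
      have "N * a e' = M * a e - b e * (a e * b e' - b e * a e')"
        "N * b e' = M * b e + a e * (a e * b e' - b e * a e')"
        by (auto simp: N_def M_def algebra_simps)
      then have "N * a e' = M * a e" "N * b e' = M * b e" using par by auto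
      then have "N * ((a e - a e') * (b f - b f') - (b e - b e') * (a f - a f'))
         = (N - M) * (a e * (b f - b f') - b e * (a f - a f'))"
        by (smt (verit) left_diff_distrib mult.assoc right_diff_distrib)
      moreover have "N > 0" using e1 unfolding N_def by (smt (verit) zero_le_square)
      moreover have "M < 0" using anti by (simp add: M_def)
      ultimately have "a e * (b f - b f') - b e * (a f - a f') = 0" using z by simp
      then have "P * a f + Q * b f = P * a f' + Q * b f'" by (simp add: P_def Q_def algebra_simps)
      then show False using f f' by simp
    qed
    ultimately show ?thesis
      using that[of y e e' f f' "a e" "b e" P Q] posy inE e1 e2 f f' ey F G by simp
  next
    case False
    have na: "a e * a e' + b e * b e' > 0"
      if "e \<in> E1" "L e x = m" "e' \<in> E1" "L e' x = m" "a e * b e' - b e * a e' = 0" for e e'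
    proof -
      have "a e * a e' + b e * b e' \<ge> 0" using False that by force
      \<comment> \<open>Lagrange's identity: if scalar and cross product both vanish, so does one of
        the gradients.\<close>
      moreover have "a e * a e' + b e * b e' \<noteq> 0"
      proof
        assume z: "a e * a e' + b e * b e' = 0"
        have "(a e * a e' + b e * b e')\<^sup>2 + (a e * b e' - b e * a e')\<^sup>2
            = ((a e)\<^sup>2 + (b e)\<^sup>2) * ((a e')\<^sup>2 + (b e')\<^sup>2)"
          by (simp add: power2_eq_square algebra_simps)
        then have "((a e)\<^sup>2 + (b e)\<^sup>2) * ((a e')\<^sup>2 + (b e')\<^sup>2) = 0" using z that by simp
        then show False using that by (auto simp: E1_def sum_power2_eq_zero_iff)
      qed
      ultimately show ?thesis by simp
    qed
    define D where "D e e' = a e * b e' - b e * a e'" for e e'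
    have anti_D: "D e e' = - D e' e" for e e' by (simp add: D_def)
    have dirD: "\<exists>e3\<in>E1. L e3 x = m \<and> r * D e1 e3 + s * D e2 e3 \<le> 0" for e1 e2 r s
    proof -
      \<comment> \<open>The test direction is the quarter turn of the combination of the gradients
        of \<open>e1\<close> and \<open>e2\<close> with coefficients \<open>r\<close> and
        \<open>s\<close>; scalar products with it are the corresponding combinations of cross
        products.\<close>
      obtain e3 where e3: "e3 \<in> E1" "L e3 x = m"
        "l e3 \<bullet> (of_int (- s * b e2 - r * b e1), of_int (s * a e2 + r * a e1)) \<le> 0"
        using dir by blast
      have "l e3 \<bullet> (of_int (- s * b e2 - r * b e1), of_int (s * a e2 + r * a e1))
        = of_int (r * D e1 e3 + s * D e2 e3)"
        by (simp add: l_def D_def algebra_simps)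
      then have "r * D e1 e3 + s * D e2 e3 \<le> 0" using e3(3) by (simp only: of_int_le_0_iff)
      then show ?thesis using e3 by blast
    qed
    have main: thesis if e12: "e1 \<in> E1" "e2 \<in> E1" "L e1 x = m" "L e2 x = m" "D e1 e2 > 0" for e1 e2
    proof -
      \<comment> \<open>This inequality fails for both \<open>e1\<close> and \<open>e2\<close>, so
        the term found is a third active one; by genericity there is no fourth.\<close>
      obtain e3 where e3: "e3 \<in> E1" "L e3 x = m" "D e1 e3 \<le> D e2 e3"
        using dirD[where ?e1.0 = e1 and ?e2.0 = e2 and r = 1 and s = "-1"] by auto
      have self: "D e e = 0" for e by (simp add: D_def)
      have inE: "e1 \<in> E" "e2 \<in> E" "e3 \<in> E" using e12 e3 by (auto simp: E1_def)
      have ne: "e1 \<noteq> e2" "e1 \<noteq> e3" "e2 \<noteq> e3"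
        using e12 e3 self anti_D[of e2 e1] by auto
      have only: "w \<in> {e1, e2, e3}" if "w \<in> E" "L w x = m" for w
      proof (rule ccontr)
        assume w: "w \<notin> {e1, e2, e3}"
        have "(\<lambda>v. L v x) ` {w, e1, e2, e3} = {m}" using that e12 e3 by auto
        then have "card {w, e1, e2, e3} \<le> 1 + 2" using that inE by (intro few[OF _ _ pos]) auto
        moreover have "card {w, e1, e2, e3} = 4" using w ne by (auto simp: card_insert_if)
        ultimately show False by simp
      qed
      \<comment> \<open>For r > 0 > s the test direction raises \<open>e1\<close> and
        \<open>e2\<close>, so the nonincreasing active term is \<open>e3\<close>. Making one of the
        coefficients large then fixes the signs of \<open>D e1 e3\<close> and
        \<open>D e2 e3\<close>: the three gradients wind around the origin.\<close>
      have nodir: "r * D e1 e3 + s * D e2 e3 \<le> 0" if "r > 0" "s < 0" for r s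
      proof -
        obtain w where w: "w \<in> E1" "L w x = m" "r * D e1 w + s * D e2 w \<le> 0" using dirD by blast
        have "s * D e2 e1 > 0" using e12 that anti_D[of e2 e1] by (intro mult_neg_neg) auto
        then have "w \<noteq> e1" using w self by auto
        moreover have "r * D e1 e2 > 0" using e12 that by simp
        then have "w \<noteq> e2" using w self by auto
        ultimately have "w = e3" using only[of w] w by (auto simp: E1_def)
        then show ?thesis using w by simp
      qed
      have D23: "D e2 e3 \<ge> 0"
      proof (rule ccontr)
        assume "\<not> D e2 e3 \<ge> 0"
        then have "(\<bar>D e1 e3\<bar> + 1) * 1 \<le> (\<bar>D e1 e3\<bar> + 1) * (- D e2 e3)" by (intro mult_left_mono) auto
        moreover have "1 * D e1 e3 + (- (\<bar>D e1 e3\<bar> + 1)) * D e2 e3 \<le> 0" by (rule nodir) auto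
        ultimately show False by (simp add: algebra_simps)
      qed
      have D13: "D e1 e3 \<le> 0"
      proof (rule ccontr)
        assume "\<not> D e1 e3 \<le> 0"
        then have "(\<bar>D e2 e3\<bar> + 1) * 1 \<le> (\<bar>D e2 e3\<bar> + 1) * D e1 e3" by (intro mult_left_mono) auto
        moreover have "(\<bar>D e2 e3\<bar> + 1) * D e1 e3 + (- 1) * D e2 e3 \<le> 0" by (rule nodir) auto
        ultimately show False by (simp add: algebra_simps)
      qed
      \<comment> \<open>If the gradients of \<open>e2\<close> and \<open>e3\<close> were parallel,
        \<open>na\<close> would make them point the same way, and \<open>D e1 e3\<close> would
        inherit the positive sign of \<open>D e1 e2\<close>. The identity expresses this without
        dividing.\<close>
      have D23': "D e2 e3 \<noteq> 0"
      proof
        assume z: "D e2 e3 = 0"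
        have i: "(a e2 * a e2 + b e2 * b e2) * D e1 e3
           = (a e2 * a e3 + b e2 * b e3) * D e1 e2 + (a e1 * a e2 + b e1 * b e2) * D e2 e3"
          by (simp add: D_def algebra_simps)
        have "0 < (a e2 * a e3 + b e2 * b e3) * D e1 e2"
          using na[OF e12(2,4) e3(1,2)] z e12 by (auto simp: D_def)
        moreover have "(a e2 * a e2 + b e2 * b e2) * D e1 e3 \<le> 0"
          using D13 by (intro mult_nonneg_nonpos) auto
        ultimately show False using i z by simp
      qed
      have D13': "D e1 e3 \<noteq> 0"
      proof
        assume z: "D e1 e3 = 0"
        have i: "(a e1 * a e1 + b e1 * b e1) * D e2 e3
           = - ((a e1 * a e3 + b e1 * b e3) * D e1 e2) + (a e1 * a e2 + b e1 * b e2) * D e1 e3"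
          by (simp add: D_def algebra_simps)
        have "0 < (a e1 * a e3 + b e1 * b e3) * D e1 e2"
          using na[OF e12(1,3) e3(1,2)] z e12 by (auto simp: D_def)
        moreover have "(a e1 * a e1 + b e1 * b e1) * D e2 e3 \<ge> 0"
          using D23 by (intro mult_nonneg_nonneg) auto
        ultimately show False using i z by simp
      qed
      have Dl: "- b e * a w + a e * b w = D e w" for e w by (simp add: D_def)
      have act: "L e1 x < L w x" if "w \<in> E" "w \<noteq> e1" "w \<noteq> e2" "w \<noteq> e3" "w \<in> E1" for w
        using only[of w] ge[of w] that e12 by force
      have inE1: "w \<in> E1" if "w \<in> E" "D e w \<noteq> 0" for w e using that by (auto simp: E1_def D_def)
      \<comment> \<open>The functional \<open>D e3\<close> vanishes on \<open>e3\<close> and so sees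
        only \<open>e1\<close> and \<open>e2\<close> among the active terms; likewise
        \<open>D e2\<close> sees only \<open>e1\<close> and \<open>e3\<close>.\<close>
      have A1: "\<forall>w\<in>E - {e1, e2}. D e3 w \<noteq> 0 \<longrightarrow> L e1 x < L w x"
        using act inE1[of _ e3] self by fastforce
      have A2: "\<forall>w\<in>E - {e1, e3}. D e2 w \<noteq> 0 \<longrightarrow> L e1 x < L w x"
        using act inE1[of _ e2] self by fastforce
      have pos': "\<forall>w\<in>E. 0 < L w x" using pos by blast
      have det1: "- b e3 * a e2 - a e3 * (- b e2) \<noteq> 0" using D23' by (simp add: D_def algebra_simps)
      \<comment> \<open>The determinant is twice the signed area of the triangle of the three
        gradients, positive because the origin lies inside it.\<close>
      have "(a e1 - a e2) * (b e1 - b e3) - (b e1 - b e2) * (a e1 - a e3) = D e1 e2 + D e2 e3 - D e1 e3"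
        by (simp add: D_def algebra_simps)
      then have det2: "(a e1 - a e2) * (b e1 - b e3) - (b e1 - b e2) * (a e1 - a e3) \<noteq> 0"
        using e12 D23 D13 by simp
      have nz: "D e3 e1 \<noteq> 0" "D e3 e2 \<noteq> 0" "D e2 e1 \<noteq> 0" "D e2 e3 \<noteq> 0"
        using anti_D[of e3 e1] anti_D[of e3 e2] anti_D[of e2 e1] D13' D23' e12 by auto
      have eq: "L e1 x = L e2 x" "L e1 x = L e3 x" using e12 e3 by auto
      show thesis
        by (rule witness[of x e1 e2 e1 e3 "- b e3" "a e3" "- b e2" "a e2", unfolded Dl,
              OF pos' inE(1,2,1,3) nz eq(1) A1 eq(2) A2 det1 det2])
    qed
    obtain e1 where e1: "e1 \<in> E1" "L e1 x = m" using dir[of 0] by blast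
    \<comment> \<open>Testing in the direction of the gradient of \<open>e1\<close> gives an active
      term at a right or obtuse angle to it, which cannot be parallel by \<open>na\<close>. The sign
      of the cross product only decides the order of the two.\<close>
    obtain e2 where e2: "e2 \<in> E1" "L e2 x = m" and le: "l e2 \<bullet> l e1 \<le> 0" using dir[of "l e1"] by blast
    have "real_of_int (a e1 * a e2 + b e1 * b e2) \<le> 0" using le by (simp add: l_def algebra_simps)
    then have "a e1 * a e2 + b e1 * b e2 \<le> 0" by (simp only: of_int_le_0_iff)
    then have "D e1 e2 \<noteq> 0" using na[OF e1 e2] by (auto simp: D_def)
    then show thesis using main[OF e1(1) e2(1) e1(2) e2(2)] main[OF e2(1) e1(1) e2(2) e1(2)] anti_D[of e2 e1] by linarith
  qed
qed

section \<open>Tangents over a two-dimensional cell\<close>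


text \<open>Keeps the exponent vectors \<open>axis i 1\<close> from being rewritten with
  \<open>Suc 0\<close>.\<close>

declare One_nat_def [simp del]

lemma pairing_add: "pairing (p + q) w = pairing p w + pairing q w"
  by (simp add: pairing_def sum.distrib algebra_simps)

lemma pairing_diff: "pairing (p - q) w = pairing p w - pairing q w"
  by (simp add: pairing_def sum_subtractf algebra_simps)

lemma pairing_scaleR: "pairing (r *\<^sub>R p) w = r * pairing p w"
  by (simp add: pairing_def sum_distrib_left algebra_simps)

lemma pairing_axis: "pairing (axis i 1) w = real (w$i)"
  by (simp add: pairing_def axis_def if_distrib[of "\<lambda>x. x * _"] cong: if_cong)

lemma pairing_axis_exp: "pairing p (axis i 1) = p$i"
  by (simp add: pairing_def axis_def if_distrib[of "\<lambda>x. _ * x"] if_distrib[of real] cong: if_cong)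

lemma pairing_0: "pairing p 0 = 0"
  by (simp add: pairing_def)

lemma pairing_add_exp: "pairing p (u + w) = pairing p u + pairing p w"
  by (simp add: pairing_def sum.distrib algebra_simps)

lemma monom_eval_add: "monom_eval (u + w) x = monom_eval u x * monom_eval w x"
  by (simp add: monom_eval_def power_add prod.distrib)

lemma monom_eval_axis: "monom_eval (axis i 1) x = x$i"
proof -
  have "monom_eval (axis i 1) x = (\<Prod>j\<in>UNIV. if j = i then x$i else 1)"
    unfolding monom_eval_def by (intro prod.cong) (auto simp: axis_def)
  then show ?thesis by simp
qed

text \<open>The factor \<open>x$i\<close> restores the exponent lowered in the derivative. Where
  natural subtraction truncates, the coefficient is zero.\<close>

lemma times_pderiv_eval:
  "x$i * pderiv_eval A c i x = (\<Sum>w\<in>A. of_nat (w$i) * (c w * monom_eval w x))"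
proof -
  have "of_nat (w$i) * (x$i * (\<Prod>j\<in>UNIV. x$j ^ (if j = i then w$j - 1 else w$j)))
      = of_nat (w$i) * monom_eval w x" for w :: "nat^4"
  proof (cases "w$i = 0")
    case False
    have "(\<Prod>j\<in>UNIV. x$j ^ (if j = i then w$j - 1 else w$j)) = x$i ^ (w$i - 1) * (\<Prod>j\<in>UNIV - {i}. x$j ^ (w$j))"
      by (subst prod.remove[of _ i]) auto
    moreover have "monom_eval w x = x$i ^ (w$i) * (\<Prod>j\<in>UNIV - {i}. x$j ^ (w$j))"
      unfolding monom_eval_def by (subst prod.remove[of _ i]) auto
    moreover have "x$i ^ (w$i) = x$i * x$i ^ (w$i - 1)"
      using False by (metis not_gr_zero power_minus_mult mult.commute)
    ultimately show ?thesis by simp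
  qed simp
  then show ?thesis unfolding pderiv_eval_def sum_distrib_left
    by (intro sum.cong) (auto simp: algebra_simps)
qed

lemma (in valued_field) val_sum_greater:
  assumes "\<And>i. i \<in> I \<Longrightarrow> g i = 0 \<or> m < \<nu> (g i)"
  shows "sum g I = 0 \<or> m < \<nu> (sum g I)"
  using assms
proof (induction I rule: infinite_finite_induct)
  case (insert i I)
  then have "g i = 0 \<or> m < \<nu> (g i)" "sum g I = 0 \<or> m < \<nu> (sum g I)" by auto
  then show ?case using insert(1,2) val_add[of "g i" "sum g I"]
    by (cases "g i = 0"; cases "sum g I = 0"; cases "g i + sum g I = 0") auto
qed auto

locale tropical_edge = valued_field \<nu> for \<nu> :: "'a::field_char_0 \<Rightarrow> real" +
  fixes A :: "(nat^4) set" and c :: "nat^4 \<Rightarrow> 'a" and d :: nat and u v :: "nat^4"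
  assumes ac: "alg_closed_field TYPE('a)"
    and finA: "finite A" and c0: "\<And>w. w \<in> A \<Longrightarrow> c w \<noteq> 0"
    and hom: "homogeneous_of_degree A d"
    and uA: "u \<in> A" and vA: "v \<in> A" and uv: "u \<noteq> v"
begin

definition J :: "4 set" where "J = {i. u$i = v$i}"

text \<open>Valuation of the term of \<open>w\<close> relative to the term of \<open>u\<close>, at a
  point of valuation -p. This normalisation makes the conditions on a cell affine in
  \<open>p\<close>.\<close>

definition ell :: "nat^4 \<Rightarrow> real^4 \<Rightarrow> real" where
  "ell w p = \<nu> (c w) - pairing p w - (\<nu> (c u) - pairing p u)"

definition cell :: "(real^4) set" where
  "cell = {p. ell v p = 0 \<and> (\<forall>w\<in>A - {u, v}. 0 < ell w p)}"

lemma Amin_eq_iff: "Amin \<nu> c A p = {u, v} \<longleftrightarrow> p \<in> cell"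
proof
  assume A: "Amin \<nu> c A p = {u, v}"
  then have u: "\<nu> (c u) - pairing p u \<le> \<nu> (c w) - pairing p w"
    and v: "\<nu> (c v) - pairing p v \<le> \<nu> (c w) - pairing p w" if "w \<in> A" for w
    using that by (auto simp: Amin_def)
  have "0 < ell w p" if "w \<in> A - {u, v}" for w
  proof (rule ccontr)
    assume "\<not> 0 < ell w p"
    then have "\<nu> (c w) - pairing p w \<le> \<nu> (c u) - pairing p u" by (simp add: ell_def)
    then have "w \<in> Amin \<nu> c A p" using that u unfolding Amin_def by fastforce
    then show False using A that by auto
  qed
  then show "p \<in> cell" using u[OF vA] v[OF uA] by (auto simp: cell_def ell_def)
next
  assume p: "p \<in> cell"
  have ge: "ell w p \<ge> 0" if "w \<in> A" for w
    using p that by (cases "w = u \<or> w = v") (auto simp: cell_def ell_def intro: less_imp_le)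
  have u: "ell u p = 0" by (simp add: ell_def)
  have iff: "w \<in> {u, v} \<longleftrightarrow> w \<in> A \<and> ell w p \<le> 0" for w
  proof (cases "w \<in> {u, v}")
    case True
    then show ?thesis using p uA vA u by (auto simp: cell_def)
  next
    case False
    then show ?thesis using p by (auto simp: cell_def not_le)
  qed
  have "Amin \<nu> c A p = {w\<in>A. \<forall>w'\<in>A. ell w p \<le> ell w' p}"
    by (auto simp: Amin_def ell_def)
  also have "\<dots> = {u, v}"
  proof (intro set_eqI iffI)
    fix w assume "w \<in> {w\<in>A. \<forall>w'\<in>A. ell w p \<le> ell w' p}"
    then show "w \<in> {u, v}" using uA u by (subst iff) auto
  next
    fix w assume "w \<in> {u, v}"
    then have "w \<in> A \<and> ell w p \<le> 0" by (subst (asm) iff)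
    then show "w \<in> {w\<in>A. \<forall>w'\<in>A. ell w p \<le> ell w' p}" using ge by (auto intro: order_trans)
  qed
  finally show "Amin \<nu> c A p = {u, v}" .
qed

lemma tangent_coordinate_val:
  assumes x: "\<And>j. x$j \<noteq> 0 \<and> \<nu> (x$j) = - p$j" and f: "peval A c x = 0" and p: "p \<in> cell"
  shows "i \<notin> J \<Longrightarrow> pderiv_eval A c i x \<noteq> 0 \<and> \<nu> (pderiv_eval A c i x) = \<nu> (c u) - pairing p u + p$i"
    and "i \<in> J \<Longrightarrow> pderiv_eval A c i x \<noteq> 0 \<Longrightarrow> \<nu> (c u) - pairing p u + p$i < \<nu> (pderiv_eval A c i x)"
    and "x$i * pderiv_eval A c i x = (\<Sum>w\<in>A. of_int (int (w$i) - int (u$i)) * (c w * monom_eval w x))"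
proof -
  define T where "T w = c w * monom_eval w x" for w
  define m where "m = \<nu> (c u) - pairing p u"
  have mx: "monom_eval w x \<noteq> 0" for w using x by (intro monom_eval_nonzero) auto
  have T: "T w \<noteq> 0" "\<nu> (T w) = m + ell w p" if "w \<in> A" for w
    using c0[OF that] mx[of w] val_monom[OF x, of w] by (auto simp: T_def val_mult m_def ell_def)
  have "x$i * pderiv_eval A c i x = (\<Sum>w\<in>A. of_nat (w$i) * T w) - of_nat (u$i) * (\<Sum>w\<in>A. T w)"
    using f by (simp add: times_pderiv_eval T_def peval_def)
  also have "\<dots> = (\<Sum>w\<in>A. of_int (int (w$i) - int (u$i)) * T w)"
    by (simp add: sum_distrib_left sum_distrib_right sum_subtractf algebra_simps)
  finally have eq: "x$i * pderiv_eval A c i x = (\<Sum>w\<in>A. of_int (int (w$i) - int (u$i)) * T w)" .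
  then show "x$i * pderiv_eval A c i x = (\<Sum>w\<in>A. of_int (int (w$i) - int (u$i)) * (c w * monom_eval w x))"
    by (simp add: T_def)
  define rest where "rest = (\<Sum>w\<in>A - {u, v}. of_int (int (w$i) - int (u$i)) * T w)"
  have "(\<Sum>w\<in>A. of_int (int (w$i) - int (u$i)) * T w) = rest + (\<Sum>w\<in>{u, v}. of_int (int (w$i) - int (u$i)) * T w)"
    unfolding rest_def using finA uA vA by (intro sum.subset_diff) auto
  then have split: "x$i * pderiv_eval A c i x = of_int (int (v$i) - int (u$i)) * T v + rest"
    using uv by (simp add: eq)
  have rest: "rest = 0 \<or> m < \<nu> rest"
    unfolding rest_def
  proof (rule val_sum_greater)
    fix w assume w: "w \<in> A - {u, v}"
    then have "0 < ell w p" using p by (auto simp: cell_def)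
    then show "of_int (int (w$i) - int (u$i)) * T w = 0 \<or> m < \<nu> (of_int (int (w$i) - int (u$i)) * T w)"
      using T[of w] w by (cases "int (w$i) - int (u$i) = 0") (auto simp: val_mult val_of_int simp del: of_int_diff)
  qed
  have v0: "ell v p = 0" using p by (simp add: cell_def)
  have xi: "x$i \<noteq> 0" "\<nu> (x$i) = - p$i" using x by auto
  show "pderiv_eval A c i x \<noteq> 0 \<and> \<nu> (pderiv_eval A c i x) = \<nu> (c u) - pairing p u + p$i" if "i \<notin> J"
  proof -
    have n: "int (v$i) - int (u$i) \<noteq> 0" using that by (auto simp: J_def)
    define a where "a = of_int (int (v$i) - int (u$i)) * T v"
    have a: "a \<noteq> 0" "\<nu> a = m"
      using n T[OF vA] v0 by (auto simp: a_def val_mult val_of_int simp del: of_int_diff)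
    have "a + rest \<noteq> 0 \<and> \<nu> (a + rest) = m"
    proof (cases "rest = 0")
      case False
      then show ?thesis using rest a val_add_dominant[of a "\<nu> rest" rest] by (auto simp: vge_def)
    qed (use a in simp)
    \<comment> \<open>After the term of \<open>u\<close> has been subtracted, the term of
      \<open>v\<close> is the only one of valuation \<open>m\<close>, so nothing can cancel
      it.\<close>
    then have "x$i * pderiv_eval A c i x \<noteq> 0 \<and> \<nu> (x$i * pderiv_eval A c i x) = m"
      unfolding split a_def .
    then show ?thesis using xi by (auto simp: val_mult m_def)
  qed
  show "\<nu> (c u) - pairing p u + p$i < \<nu> (pderiv_eval A c i x)" if "i \<in> J" "pderiv_eval A c i x \<noteq> 0"
  proof -
    have "x$i * pderiv_eval A c i x = rest" using split that by (simp add: J_def)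
    then show ?thesis using rest that xi by (auto simp: val_mult m_def)
  qed
qed

text \<open>The exponents of the monomials \<open>x_i x^u\<close>, \<open>i \<in> J\<close>, which carry the prescribed tangent direction:
  \<open>x_i \<partial>f/\<partial>x_i\<close> is to agree with a multiple of \<open>x_i x^u\<close> up to terms of high valuation.\<close>

definition Y :: "(nat^4) set" where "Y = (\<lambda>i. u + axis i 1) ` J"

text \<open>Extends \<open>ell\<close> to the monomial b_i x_i x^u with
  \<open>\<nu> (b i) = q$i\<close>, where it equals \<open>q$i - p$i\<close>. The dependence on
  \<open>p\<close> has the same gradient u - w in both branches, so all terms can be maximised
  together.\<close>

definition ellx :: "real^4 \<Rightarrow> nat^4 \<Rightarrow> real^4 \<Rightarrow> real" where
  "ellx q w p = (if w \<in> A then ell w p else pairing q w - pairing q u - (pairing p w - pairing p u))"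

text \<open>The exponents \<open>u\<close> and \<open>v\<close> are removed because they agree on
  \<open>J\<close> and so drop out of every critical equation.\<close>

definition extA :: "(nat^4) set" where "extA = (A - {u, v}) \<union> Y"

text \<open>The new monomials have degree d + 1, so they never collide with monomials of f.\<close>

lemma u_axis_notin: "u + axis i 1 \<notin> A"
proof
  assume "u + axis i 1 \<in> A"
  then have "(\<Sum>j\<in>UNIV. (u + axis i 1)$j) = d" "(\<Sum>j\<in>UNIV. u$j) = d"
    using hom uA by (auto simp: homogeneous_of_degree_def)
  then show False by (simp add: sum.distrib axis_def)
qed

lemma ellx_Y: "ellx q (u + axis i 1) p = q$i - p$i"
  by (simp add: ellx_def u_axis_notin pairing_add_exp pairing_axis_exp)

lemma finite_extA: "finite extA"
  using finA by (simp add: extA_def Y_def)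

lemma inj_u_axis: "inj (\<lambda>i. u + axis i (1::nat))"
  by (auto simp: inj_def axis_eq_axis)

text \<open>Integer factor of the monomial \<open>w\<close> in the r-th combination of the critical
  equations x_i df/dx_i - u_i f = b_i x_i c_u x^u.\<close>

definition Lam :: "(4 \<Rightarrow> 4 \<Rightarrow> int) \<Rightarrow> 4 \<Rightarrow> nat^4 \<Rightarrow> int" where
  "Lam lam r w = (\<Sum>i\<in>J. lam r i * (int (w$i) - int (u$i)))"

lemma Lam_u: "Lam lam r u = 0" and Lam_v: "Lam lam r v = 0"
  by (auto simp: Lam_def J_def)

lemma Lam_Y: "i \<in> J \<Longrightarrow> Lam lam r (u + axis i 1) = lam r i"
proof -
  assume i: "i \<in> J"
  have "Lam lam r (u + axis i 1) = (\<Sum>j\<in>J. if j = i then lam r i else 0)"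
    unfolding Lam_def by (intro sum.cong) (auto simp: axis_def)
  then show ?thesis using i by simp
qed

text \<open>The two kernel hypotheses have different purposes: \<open>kere\<close> makes the system
  solvable, \<open>kerl\<close> allows the single critical equations to be recovered from their
  combinations.\<close>

lemma tangent_from_balanced_terms:
  fixes q p :: "real^4" and e e' :: "4 \<Rightarrow> nat^4" and lam :: "4 \<Rightarrow> 4 \<Rightarrow> int"
  assumes k: "k \<notin> J" and q: "\<And>i. i \<noteq> k \<Longrightarrow> \<exists>b. b \<noteq> 0 \<and> \<nu> b = q$i"
    and p: "p \<in> cell" and pq: "\<And>i. i \<notin> J \<Longrightarrow> p$i = q$i"
    and eE: "\<And>r. r \<in> J \<Longrightarrow> e r \<in> extA" "\<And>r. r \<in> J \<Longrightarrow> e' r \<in> extA"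
    and Le: "\<And>r. r \<in> J \<Longrightarrow> Lam lam r (e r) \<noteq> 0" "\<And>r. r \<in> J \<Longrightarrow> Lam lam r (e' r) \<noteq> 0"
    and eq: "\<And>r. r \<in> J \<Longrightarrow> ellx q (e r) p = ellx q (e' r) p"
    and lt: "\<And>r w. r \<in> J \<Longrightarrow> w \<in> extA \<Longrightarrow> w \<noteq> e r \<Longrightarrow> w \<noteq> e' r \<Longrightarrow> Lam lam r w \<noteq> 0 \<Longrightarrow> ellx q (e r) p < ellx q w p"
    and kere: "\<And>y::rat^4. (\<And>j. j \<notin> J \<Longrightarrow> y$j = 0) \<Longrightarrow>
      (\<And>r. r \<in> J \<Longrightarrow> (\<Sum>j\<in>J. of_int (int (e r$j) - int (e' r$j)) * y$j) = 0) \<Longrightarrow> y = 0"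
    and kerl: "\<And>y::rat^4. (\<And>j. j \<notin> J \<Longrightarrow> y$j = 0) \<Longrightarrow>
      (\<And>r. r \<in> J \<Longrightarrow> (\<Sum>j\<in>J. of_int (lam r j) * y$j) = 0) \<Longrightarrow> y = 0"
  shows "trop_coords (- q) \<in> tropical_tangents \<nu> A c (trop_coords p)"
proof -
  obtain b where b: "\<And>i. i \<noteq> k \<Longrightarrow> b i \<noteq> 0 \<and> \<nu> (b i) = q$i" using q by metis
  have bJ: "b i \<noteq> 0" "\<nu> (b i) = q$i" if "i \<in> J" for i using b[of i] k that by auto
  define m where "m = \<nu> (c u) - pairing p u"
  \<comment> \<open>The description operator reads off the index \<open>i\<close> from the exponent
    u + axis i 1; it is unique by \<open>inj_u_axis\<close>.\<close>
  define cx where "cx w = (if w \<in> A then c w else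
      of_int (- 1) * b (THE i. w = u + axis i 1) * c u)" for w
  have cxY: "cx (u + axis i 1) = - b i * c u" for i
  proof -
    have "(THE j. u + axis i (1::nat) = u + axis j 1) = i"
      using inj_u_axis by (intro the_equality) (auto simp: inj_def)
    then show ?thesis by (simp add: cx_def u_axis_notin)
  qed
  have cx0: "cx w \<noteq> 0" if "w \<in> extA" for w
    using that c0 uA bJ by (auto simp: extA_def Y_def cxY) (auto simp: cx_def)
  have cxv: "\<nu> (cx w) - pairing p w = m + ellx q w p" if wE: "w \<in> extA" for w
  proof (cases "w \<in> A")
    case True
    then show ?thesis by (simp add: cx_def ellx_def ell_def m_def)
  next
    case False
    then obtain i where i: "i \<in> J" "w = u + axis i 1" using wE by (auto simp: extA_def Y_def)
    have "\<nu> (cx w) = q$i + \<nu> (c u)"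
      using bJ[OF i(1)] c0[OF uA] by (simp add: i cxY val_mult val_minus)
    then show ?thesis by (simp add: i ellx_Y m_def pairing_add_exp pairing_axis_exp)
  qed
  define t where "t i = inverse (b i)" for i
  have t: "t i \<noteq> 0 \<and> \<nu> (t i) = - q$i" if "i \<noteq> k" for i using b[OF that] by (simp add: t_def val_inverse)
  \<comment> \<open>Four equations in four unknowns: row \<open>k\<close> is f, to be solved
    exactly; the rows in \<open>J\<close> are the combined critical equations; every other row is
    x_r = t_r and pins that coordinate to valuation -q_r.\<close>
  define C where "C r w = (if r = k then (if w \<in> A then c w else 0)
      else if r \<in> J then (if w \<in> extA then of_int (Lam lam r w) * cx w else 0)
      else if w = axis r 1 then 1 else if w = 0 then - t r else 0)" for r w
  define e1 where "e1 r = (if r = k then u else if r \<in> J then e r else axis r 1)" for r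
  define e2 where "e2 r = (if r = k then v else if r \<in> J then e' r else 0)" for r
  define W where "W = A \<union> extA \<union> {0} \<union> range (\<lambda>r. axis r (1::nat))"
  have finW: "finite W" using finA finite_extA by (simp add: W_def)
  have axis0: "axis r (1::nat) \<noteq> 0" for r :: 4 by (simp add: axis_eq_0_iff)
  have kJ: "r \<in> J \<Longrightarrow> r \<noteq> k" for r using k by auto
  have CJ: "C r w = of_int (Lam lam r w) * cx w" "\<nu> (C r w) = \<nu> (cx w)" "C r w \<noteq> 0"
    if "r \<in> J" "w \<in> extA" "Lam lam r w \<noteq> 0" for r w
    using that kJ cx0[of w] by (auto simp: C_def val_mult val_of_int)
  \<comment> \<open>Larger than the valuation of every target term \<open>h i\<close> defined below,
    so that an error of valuation \<open>K\<close> does not affect it.\<close>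
  define K where "K = 1 + Max (range (\<lambda>i. m + q$i - p$i))"
  have K: "m + q$i - p$i < K" for i
  proof -
    have "m + q$i - p$i \<le> Max (range (\<lambda>i. m + q$i - p$i))" by (intro Max_ge) auto
    then show ?thesis unfolding K_def by linarith
  qed
  have "\<exists>x. (\<forall>j. x$j \<noteq> 0 \<and> \<nu> (x$j) = - p$j) \<and> (\<forall>r. vge K (peval W (C r) x)) \<and> peval W (C k) x = 0"
  proof (rule binomial_system_solution[OF ac finW, of e1 e2])
    fix r :: 4
    consider "r = k" | "r \<in> J" "r \<noteq> k" | "r \<noteq> k" "r \<notin> J" by blast
    note cases = this
    show "e1 r \<in> W" "e2 r \<in> W" using uA vA eE[of r] by (auto simp: W_def e1_def e2_def)
    show "C r (e1 r) \<noteq> 0" "C r (e2 r) \<noteq> 0"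
      using cases by (cases; use CJ(3)[of r] eE[of r] Le[of r] t[of r] axis0[of r] uA vA c0 in \<open>force simp: e1_def e2_def C_def\<close>)+
    show "\<nu> (C r (e1 r)) - pairing p (e1 r) = \<nu> (C r (e2 r)) - pairing p (e2 r)"
      using cases
    proof cases
      case 1
      then show ?thesis using p uA vA by (simp add: e1_def e2_def C_def cell_def ell_def)
    next
      case 2
      then show ?thesis
        using CJ(2)[of r] cxv eE[of r] eq[of r] Le[of r] by (simp add: e1_def e2_def)
    next
      case 3
      then show ?thesis using t[of r] pq[of r] axis0[of r]
        by (auto simp: e1_def e2_def C_def val_1 val_minus pairing_axis_exp pairing_0)
    qed
    fix w assume w: "w \<in> W" "w \<noteq> e1 r" "w \<noteq> e2 r" "C r w \<noteq> 0"
    show "\<nu> (C r (e1 r)) - pairing p (e1 r) < \<nu> (C r w) - pairing p w"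
      using cases
    proof cases
      case 1
      then have "w \<in> A - {u, v}" using w by (auto simp: e1_def e2_def C_def split: if_splits)
      then have "0 < ell w p" using p by (auto simp: cell_def)
      then show ?thesis using 1 uA \<open>w \<in> A - {u, v}\<close> by (simp add: e1_def C_def ell_def)
    next
      case 2
      then have "w \<in> extA" "Lam lam r w \<noteq> 0" using w(4) by (auto simp: C_def split: if_splits)
      then show ?thesis using 2 CJ(2)[of r] cxv eE[of r] Le[of r] lt[of r w] w by (simp add: e1_def e2_def)
    next
      case 3
      then show ?thesis using w by (auto simp: e1_def e2_def C_def split: if_splits)
    qed
  next
    show "\<forall>y::rat^4. (\<forall>r. (\<Sum>j\<in>UNIV. of_int (int (e1 r$j) - int (e2 r$j)) * y$j) = 0) \<longrightarrow> y = 0"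
    proof (intro allI impI)
      fix y :: "rat^4"
      assume y: "\<forall>r. (\<Sum>j\<in>UNIV. of_int (int (e1 r$j) - int (e2 r$j)) * y$j) = 0"
      \<comment> \<open>The matrix is block triangular: the pinning rows kill their coordinates, row
        \<open>k\<close> then leaves only u_k - v_k because u and v agree on \<open>J\<close>, and
        \<open>kere\<close> treats the block of \<open>J\<close>.\<close>
      have yl: "y$l = 0" if "l \<noteq> k" "l \<notin> J" for l
      proof -
        have "(\<Sum>j\<in>UNIV. of_int (int (e1 l$j) - int (e2 l$j)) * y$j) = (\<Sum>j\<in>UNIV. if j = l then y$l else 0)"
          using that by (intro sum.cong) (auto simp: e1_def e2_def axis_def)
        then show ?thesis using y by simp
      qed
      have "(\<Sum>j\<in>UNIV. of_int (int (e1 k$j) - int (e2 k$j)) * y$j)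
          = (\<Sum>j\<in>UNIV. if j = k then of_int (int (u$k) - int (v$k)) * y$k else 0)"
        using yl by (intro sum.cong) (auto simp: e1_def e2_def J_def)
      then have "of_int (int (u$k) - int (v$k)) * y$k = 0" using y by simp
      moreover have "int (u$k) - int (v$k) \<noteq> 0" using k by (auto simp: J_def)
      ultimately have yk: "y$k = 0" by (simp del: of_int_diff)
      have out: "y$j = 0" if "j \<notin> J" for j using yl[of j] yk that by (cases "j = k") auto
      show "y = 0"
      proof (rule kere[OF out])
        fix r assume r: "r \<in> J"
        have "(\<Sum>j\<in>J. of_int (int (e r$j) - int (e' r$j)) * y$j) = (\<Sum>j\<in>UNIV. of_int (int (e r$j) - int (e' r$j)) * y$j)"
          using out by (intro sum.mono_neutral_left) auto
        then show "(\<Sum>j\<in>J. of_int (int (e r$j) - int (e' r$j)) * y$j) = 0"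
          using y[rule_format, of r] r kJ[OF r] by (simp add: e1_def e2_def)
      qed
    qed
  qed
  then obtain x where x: "\<And>j. x$j \<noteq> 0 \<and> \<nu> (x$j) = - p$j"
    and big: "\<And>r. vge K (peval W (C r) x)" and Ck: "peval W (C k) x = 0" by blast
  have "peval W (C k) x = peval A c x"
    unfolding peval_def using finW by (intro sum.mono_neutral_cong_right) (auto simp: W_def C_def)
  then have f: "peval A c x = 0" using Ck by simp
  define g where "g i = x$i * pderiv_eval A c i x" for i
  define h where "h i = b i * (c u * monom_eval u x * x$i)" for i
  have g: "g i = (\<Sum>w\<in>A. of_int (int (w$i) - int (u$i)) * (c w * monom_eval w x))" for i
    unfolding g_def by (rule tangent_coordinate_val(3)[OF x f p])
  have Pr: "peval W (C r) x = (\<Sum>i\<in>J. of_int (lam r i) * (g i - h i))" if r: "r \<in> J" for r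
  proof -
    have "peval W (C r) x = (\<Sum>w\<in>extA. of_int (Lam lam r w) * cx w * monom_eval w x)"
      unfolding peval_def using finW r kJ[OF r]
      by (intro sum.mono_neutral_cong_right) (auto simp: W_def C_def)
    also have "\<dots> = (\<Sum>w\<in>A - {u, v}. of_int (Lam lam r w) * cx w * monom_eval w x)
       + (\<Sum>w\<in>Y. of_int (Lam lam r w) * cx w * monom_eval w x)"
      unfolding extA_def using finA u_axis_notin by (intro sum.union_disjoint) (auto simp: Y_def)
    also have "(\<Sum>w\<in>A - {u, v}. of_int (Lam lam r w) * cx w * monom_eval w x)
       = (\<Sum>w\<in>A. of_int (Lam lam r w) * (c w * monom_eval w x))"
      using finA by (intro sum.mono_neutral_cong_left) (auto simp: Lam_u Lam_v cx_def)
    also have "\<dots> = (\<Sum>w\<in>A. \<Sum>i\<in>J. of_int (lam r i) * (of_int (int (w$i) - int (u$i)) * (c w * monom_eval w x)))"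
      by (simp add: Lam_def sum_distrib_right mult.assoc)
    also have "\<dots> = (\<Sum>i\<in>J. of_int (lam r i) * g i)"
      by (subst sum.swap) (simp add: g sum_distrib_left)
    also have "(\<Sum>w\<in>Y. of_int (Lam lam r w) * cx w * monom_eval w x)
       = (\<Sum>i\<in>J. of_int (Lam lam r (u + axis i 1)) * cx (u + axis i 1) * monom_eval (u + axis i 1) x)"
      unfolding Y_def by (subst sum.reindex) (auto intro: inj_on_subset[OF inj_u_axis])
    also have "\<dots> = (\<Sum>i\<in>J. - (of_int (lam r i) * h i))"
      by (intro sum.cong) (auto simp: Lam_Y cxY h_def monom_eval_add monom_eval_axis algebra_simps)
    finally show ?thesis by (simp add: sum_negf sum_subtractf algebra_simps)
  qed
  \<comment> \<open>The matrix \<open>lam\<close> completed by the identity outside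
    \<open>J\<close>. Its inverse up to the unit \<open>N\<close> turns small combinations into
    small single errors.\<close>
  define M where "M r j = (if r \<in> J then (if j \<in> J then lam r j else 0) else if j = r then 1 else 0)" for r j
  have kerM: "\<forall>y::rat^4. (\<forall>r. (\<Sum>j\<in>UNIV. of_int (M r j) * y$j) = 0) \<longrightarrow> y = 0"
  proof (intro allI impI)
    fix y :: "rat^4"
    assume y: "\<forall>r. (\<Sum>j\<in>UNIV. of_int (M r j) * y$j) = 0"
    show "y = 0"
    proof (rule kerl)
      fix l assume "l \<notin> J"
      then have "(\<Sum>j\<in>UNIV. of_int (M l j) * y$j) = (\<Sum>j\<in>UNIV. if j = l then y$l else 0)"
        by (intro sum.cong) (auto simp: M_def)
      then show "y$l = 0" using y by simp
    next
      fix r assume "r \<in> J"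
      then have "(\<Sum>j\<in>J. of_int (lam r j) * y$j) = (\<Sum>j\<in>UNIV. of_int (M r j) * y$j)"
        by (intro sum.mono_neutral_cong_left) (auto simp: M_def)
      then show "(\<Sum>j\<in>J. of_int (lam r j) * y$j) = 0" using y by simp
    qed
  qed
  obtain B N where N: "N > 0" and BM: "\<And>r s. (\<Sum>j\<in>UNIV. B r j * M j s) = (if r = s then N else 0)"
    by (rule int_matrix_inverse[OF kerM]) auto
  have G: "vge K (g i - h i)" if i: "i \<in> J" for i
  proof -
    define z where "z j = (if j \<in> J then g j - h j else 0)" for j
    have Mz: "vge K (\<Sum>j\<in>UNIV. of_int (M r j) * z j)" for r
    proof (cases "r \<in> J")
      case True
      then have "(\<Sum>j\<in>UNIV. of_int (M r j) * z j) = (\<Sum>j\<in>J. of_int (lam r j) * (g j - h j))"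
        by (intro sum.mono_neutral_cong_right) (auto simp: M_def z_def)
      then show ?thesis using big[of r] Pr[OF True] by simp
    next
      case False
      then have "(\<Sum>j\<in>UNIV. of_int (M r j) * z j) = 0"
        by (intro sum.neutral) (auto simp: M_def z_def)
      then show ?thesis by simp
    qed
    have "(\<Sum>r\<in>UNIV. of_int (B i r) * (\<Sum>j\<in>UNIV. of_int (M r j) * z j))
        = (\<Sum>r\<in>UNIV. \<Sum>j\<in>UNIV. of_int (B i r * M r j) * z j)"
      by (simp add: sum_distrib_left mult.assoc)
    also have "\<dots> = (\<Sum>j\<in>UNIV. of_int (\<Sum>r\<in>UNIV. B i r * M r j) * z j)"
      by (subst sum.swap) (simp add: sum_distrib_right)
    also have "\<dots> = (\<Sum>j\<in>UNIV. if j = i then of_int N * z i else 0)"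
      unfolding BM by (intro sum.cong) auto
    also have "\<dots> = of_int N * z i" by simp
    finally have "of_int N * z i = (\<Sum>r\<in>UNIV. of_int (B i r) * (\<Sum>j\<in>UNIV. of_int (M r j) * z j))" ..
    moreover have "vge K \<dots>" using vge_mult[OF vge_of_int Mz] by (intro vge_sum) simp
    ultimately have "vge K (of_int N * z i)" by simp
    then have "vge K (z i)" using N by (cases "z i = 0") (auto simp: vge_def val_mult val_of_int)
    then show ?thesis using i by (simp add: z_def)
  qed
  have mx: "monom_eval u x \<noteq> 0" using x by (intro monom_eval_nonzero) auto
  \<comment> \<open>All partial derivatives have valuation m + q_i; the common shift
    \<open>m\<close> disappears in the tropical coordinates.\<close>
  have D: "pderiv_eval A c i x \<noteq> 0 \<and> \<nu> (pderiv_eval A c i x) = m + q$i" for i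
  proof (cases "i \<in> J")
    case True
    have h: "h i \<noteq> 0" "\<nu> (h i) = m + q$i - p$i"
      using bJ[OF True] mx x c0[OF uA] val_monom[OF x, of u] by (auto simp: h_def val_mult m_def)
    then have "h i + (g i - h i) \<noteq> 0" "\<nu> (h i + (g i - h i)) = \<nu> (h i)"
      using val_add_dominant[OF h(1) G[OF True]] K[of i] by auto
    then show ?thesis using h x by (auto simp: g_def val_mult)
  next
    case False
    then show ?thesis using tangent_coordinate_val(1)[OF x f p False] pq[OF False] by (simp add: m_def)
  qed
  have "trop_pt \<nu> x = trop_coords p"
    using x by (simp add: trop_pt_def trop_coords_def)
  moreover have "trop_coords (- q) = trop_pt \<nu> (\<chi> i. pderiv_eval A c i x)"
    using D by (simp add: trop_pt_def trop_coords_def)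
  ultimately show ?thesis using x f D unfolding tropical_tangents_def by blast
qed

end


lemma rat_2x2_kernel:
  fixes y z :: rat and a b c d :: int
  assumes "of_int a * y + of_int b * z = 0" "of_int c * y + of_int d * z = 0" "a * d - b * c \<noteq> 0"
  shows "y = 0" "z = 0"
proof -
  have "of_int (a * d - b * c) * y = of_int d * (of_int a * y + of_int b * z) - of_int b * (of_int c * y + of_int d * z)"
    by (simp add: algebra_simps)
  then have "of_int (a * d - b * c) * y = 0" using assms by simp
  then show "y = 0" using assms(3) by (simp del: of_int_diff of_int_mult)
  have "of_int (a * d - b * c) * z = of_int a * (of_int c * y + of_int d * z) - of_int c * (of_int a * y + of_int b * z)"
    by (simp add: algebra_simps)
  then have "of_int (a * d - b * c) * z = 0" using assms by simp
  then show "z = 0" using assms(3) by (simp del: of_int_diff of_int_mult)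
qed

section \<open>Choosing the point of the cell under a prescribed tangent\<close>

context tropical_edge
begin

text \<open>Two different exponents of the same degree cannot differ in a single coordinate.\<close>

lemma card_J: "card J \<le> 2"
proof -
  obtain k where k: "u$k \<noteq> v$k" using uv by (auto simp: vec_eq_iff)
  have "(\<Sum>i\<in>UNIV. u$i) = (\<Sum>i\<in>UNIV. v$i)"
    using hom uA vA by (auto simp: homogeneous_of_degree_def)
  then have "u$k + (\<Sum>i\<in>UNIV - {k}. u$i) = v$k + (\<Sum>i\<in>UNIV - {k}. v$i)"
    by (simp add: sum.remove[of UNIV k])
  then have "(\<Sum>i\<in>UNIV - {k}. u$i) \<noteq> (\<Sum>i\<in>UNIV - {k}. v$i)" using k by linarith
  then obtain l where l: "l \<noteq> k" "u$l \<noteq> v$l" by (metis (no_types, lifting) DiffE insertI1 sum.cong)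
  have "J \<subseteq> UNIV - {k, l}" using k l by (auto simp: J_def)
  then have "card J \<le> card (UNIV - {k, l})" by (intro card_mono) auto
  also have "\<dots> = 2" using l by (simp add: card_Diff_subset)
  finally show ?thesis .
qed

lemma ell_shift: "ell w (q + a) = ell w q - (pairing a w - pairing a u)"
  by (simp add: ell_def pairing_add)

lemma ellx_shift: "ellx q w (q - a) = ellx q w q + (pairing a w - pairing a u)"
  by (simp add: ellx_def ell_def pairing_diff)

lemma pairing_J_uv:
  assumes "\<And>i. i \<notin> J \<Longrightarrow> a$i = 0"
  shows "pairing a v = pairing a u"
  unfolding pairing_def
proof (rule sum.cong)
  fix i show "a$i * real (v$i) = a$i * real (u$i)"
    using assms[of i] by (cases "i \<in> J") (auto simp: J_def)
qed simp

lemma ball_extA: "(\<forall>w\<in>extA. P (ellx q w p)) \<longleftrightarrow> (\<forall>i\<in>J. P (q$i - p$i)) \<and> (\<forall>w\<in>A - {u, v}. P (ell w p))"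
proof -
  have "ellx q w p = ell w p" if "w \<in> A" for w using that by (simp add: ellx_def)
  then have "(\<forall>w\<in>A - {u, v}. P (ellx q w p)) \<longleftrightarrow> (\<forall>w\<in>A - {u, v}. P (ell w p))" by simp
  moreover have "(\<forall>w\<in>Y. P (ellx q w p)) \<longleftrightarrow> (\<forall>i\<in>J. P (q$i - p$i))" by (simp add: Y_def ellx_Y)
  ultimately show ?thesis unfolding extA_def ball_Un by blast
qed

text \<open>Vectors supported on \<open>J\<close> do not change \<open>ell v\<close>, so q - a never
  leaves the plane of the cell and positivity of the extended terms is the only condition.\<close>

lemma cell_shift_iff:
  assumes "ell v q = 0" and a: "\<And>i. i \<notin> J \<Longrightarrow> a$i = 0"
  shows "(\<forall>w\<in>extA. 0 < ellx q w (q - a)) \<longleftrightarrow> (\<forall>i\<in>J. 0 < a$i) \<and> q - a \<in> cell"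
proof -
  have "ell v (q - a) = 0" using assms(1) pairing_J_uv[OF a] by (simp add: ell_def pairing_diff)
  then show ?thesis by (simp add: ball_extA cell_def)
qed

text \<open>The unknown is the slack a = q - p, supported on \<open>J\<close>. The region
  \<open>?R\<close> is where all extended terms are nonnegative, \<open>a0\<close> is a strictly
  positive point of it, and the size of \<open>J\<close> decides which of the two transversality
  lemmas applies.\<close>

lemma tangent_exists:
  assumes k: "k \<notin> J" and q: "\<And>i. i \<noteq> k \<Longrightarrow> \<exists>b. b \<noteq> 0 \<and> \<nu> b = q$i"
    and qH: "ell v q = 0"
    and a0: "q - a0 \<in> cell" "\<And>i. i \<in> J \<Longrightarrow> 0 < a0$i" "\<And>i. i \<notin> J \<Longrightarrow> a0$i = 0"
    and bd: "bounded {a. (\<forall>i. i \<notin> J \<longrightarrow> a$i = 0) \<and> (\<forall>i\<in>J. 0 \<le> a$i) \<and> (\<forall>w\<in>A - {u, v}. 0 \<le> ell w (q - a))}"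
      (is "bounded ?R")
    and gen: "\<And>p. p \<in> cell \<Longrightarrow> (\<And>i. i \<notin> J \<Longrightarrow> p$i = q$i) \<Longrightarrow>
        card extA \<le> card ((\<lambda>w. ellx q w p) ` extA) + card J"
  shows "\<exists>p\<in>cell. trop_coords (- q) \<in> tropical_tangents \<nu> A c (trop_coords p)"
proof -
  have R: "a \<in> ?R" if "\<And>i. i \<notin> J \<Longrightarrow> a$i = 0" "\<And>w. w \<in> extA \<Longrightarrow> 0 \<le> ellx q w (q - a)" for a
    using that ball_extA[of "\<lambda>x. 0 \<le> x" q "q - a"] by simp
  have a0': "0 < ellx q w (q - a0)" if "w \<in> extA" for w
    using cell_shift_iff[OF qH a0(3)] a0 that by blast
  have genJ: "card extA \<le> card ((\<lambda>w. ellx q w (q - a)) ` extA) + card J"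
    if "\<And>i. i \<notin> J \<Longrightarrow> a$i = 0" "\<And>w. w \<in> extA \<Longrightarrow> 0 < ellx q w (q - a)" for a
    using cell_shift_iff[OF qH that(1)] that by (intro gen) auto
  consider "card J = 0" | "card J = 1" | "card J = 2" using card_J by linarith
  then show ?thesis
  proof cases
    case 1
    then have J0: "J = {}" by simp
    then have "a0 = 0" using a0(3) by (simp add: vec_eq_iff)
    then have "q \<in> cell" using a0(1) by simp
    moreover have "trop_coords (- q) \<in> tropical_tangents \<nu> A c (trop_coords q)"
      by (rule tangent_from_balanced_terms[OF k q \<open>q \<in> cell\<close>]) (auto simp: J0 vec_eq_iff)
    ultimately show ?thesis by blast
  next
    case 2
    then obtain i where Ji: "J = {i}" using card_1_singletonE by blast
    \<comment> \<open>The slope of the term of \<open>w\<close> along q - s e_i. With a single index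
      the one critical equation needs no combination, hence \<open>lam\<close> is constantly
      1.\<close>
    define a where "a w = int (w$i) - int (u$i)" for w :: "nat^4"
    define L where "L w s = ellx q w q + of_int (a w) * s" for w s
    have L: "L w s = ellx q w (q - s *\<^sub>R axis i 1)" for w s
      by (simp add: L_def a_def ellx_shift pairing_scaleR pairing_axis algebra_simps)
    have sup: "(s *\<^sub>R axis i 1)$j = 0" if "j \<notin> J" for s :: real and j
      using that by (auto simp: Ji axis_def)
    have a0s: "a0 = (a0$i) *\<^sub>R axis i 1" using a0(3) by (auto simp: vec_eq_iff Ji axis_def)
    obtain B where B: "\<And>a. a \<in> ?R \<Longrightarrow> norm a \<le> B" using bd unfolding bounded_iff by blast
    have bdL: "bounded {s. \<forall>e\<in>extA. 0 \<le> L e s}"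
      unfolding bounded_iff
    proof (intro exI ballI)
      fix s assume s: "s \<in> {s. \<forall>e\<in>extA. 0 \<le> L e s}"
      have "s *\<^sub>R axis i 1 \<in> ?R" using R[OF sup] s by (simp add: L)
      then have "norm (s *\<^sub>R axis i (1::real) :: real^4) \<le> B" by (rule B)
      then show "norm s \<le> B" by (simp add: norm_axis_1)
    qed
    have posL: "0 < L e (a0$i)" if "e \<in> extA" for e using a0'[OF that] a0s by (simp add: L)
    have genL: "card extA \<le> card ((\<lambda>e. L e s) ` extA) + 1" if "\<And>e. e \<in> extA \<Longrightarrow> 0 < L e s" for s
      using genJ[OF sup, of s] that by (simp add: L Ji)
    obtain s e e' where pos: "\<forall>w\<in>extA. 0 < L w s" and e: "e \<in> extA" "e' \<in> extA"
      and ne: "a e \<noteq> a e'" "a e \<noteq> 0" "a e' \<noteq> 0" and eq: "L e s = L e' s"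
      and lt: "\<forall>w\<in>extA - {e, e'}. a w \<noteq> 0 \<longrightarrow> L e s < L w s"
      using transversal_pair_1[of extA "\<lambda>w. ellx q w q" a "a0$i", folded L_def, OF finite_extA bdL posL genL]
      by blast
    define p where "p = q - s *\<^sub>R axis i 1"
    have p: "p \<in> cell" using cell_shift_iff[OF qH sup] pos by (auto simp: p_def L)
    have Lam1: "Lam (\<lambda>r j. 1) r w = a w" for r w by (simp add: Lam_def Ji a_def)
    have "trop_coords (- q) \<in> tropical_tangents \<nu> A c (trop_coords p)"
    proof (rule tangent_from_balanced_terms[OF k q p, where e = "\<lambda>r. e" and e' = "\<lambda>r. e'" and lam = "\<lambda>r j. 1"])
      show "p$j = q$j" if "j \<notin> J" for j using sup[OF that] by (simp add: p_def)
      show "ellx q e p = ellx q e' p" using eq by (simp add: L p_def)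
      show "ellx q e p < ellx q w p" if "w \<in> extA" "w \<noteq> e" "w \<noteq> e'" "Lam (\<lambda>r j. 1) r w \<noteq> 0" for r w
        using lt that by (simp add: L p_def Lam1)
      fix y :: "rat^4" assume out: "\<And>j. j \<notin> J \<Longrightarrow> y$j = 0"
      have y: "y = 0" if "y$i = 0"
        unfolding vec_eq_iff
      proof
        fix l show "y$l = 0$l" using that out[of l] by (cases "l \<in> J") (auto simp: Ji)
      qed
      show "y = 0" if "\<And>r. r \<in> J \<Longrightarrow> (\<Sum>j\<in>J. of_int (int (e$j) - int (e'$j)) * y$j) = 0"
      proof -
        have "of_int (int (e$i) - int (e'$i)) * y$i = 0" using that[of i] by (simp add: Ji)
        then have "y$i = 0" using ne(1) by (simp add: a_def del: of_int_diff)
        then show ?thesis by (rule y)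
      qed
      show "y = 0" if "\<And>r. r \<in> J \<Longrightarrow> (\<Sum>j\<in>J. of_int 1 * y$j) = 0"
        using that[of i] by (intro y) (simp add: Ji)
    qed (use e ne in \<open>auto simp: Lam1\<close>)
    then show ?thesis using p by blast
  next
    case 3
    then obtain i j where Jij: "J = {i, j}" and ij: "i \<noteq> j" by (auto simp: card_2_iff)
    define a where "a w = int (w$i) - int (u$i)" for w :: "nat^4"
    define b where "b w = int (w$j) - int (u$j)" for w :: "nat^4"
    define L where "L w z = ellx q w q + (of_int (a w), of_int (b w)) \<bullet> z" for w and z :: "real \<times> real"
    define V :: "real \<times> real \<Rightarrow> real^4" where "V z = fst z *\<^sub>R axis i 1 + snd z *\<^sub>R axis j 1" for z
    have L: "L w z = ellx q w (q - V z)" for w z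
      by (simp add: L_def a_def b_def V_def ellx_shift pairing_add pairing_scaleR pairing_axis inner_prod_def algebra_simps)
    have sup: "V z$l = 0" if "l \<notin> J" for z l
      using that by (auto simp: Jij V_def axis_def)
    have Vij: "V z$i = fst z" "V z$j = snd z" for z using ij by (auto simp: V_def axis_def)
    have a0s: "a0 = V (a0$i, a0$j)"
      unfolding vec_eq_iff
    proof
      fix l show "a0$l = V (a0$i, a0$j)$l"
        using a0(3)[of l] sup[of l] Vij by (cases "l \<in> J") (auto simp: Jij)
    qed
    obtain B where B: "\<And>a. a \<in> ?R \<Longrightarrow> norm a \<le> B" using bd unfolding bounded_iff by blast
    have bdL: "bounded {z. \<forall>e\<in>extA. 0 \<le> L e z}"
      unfolding bounded_iff
    proof (intro exI ballI)
      fix z assume z: "z \<in> {z. \<forall>e\<in>extA. 0 \<le> L e z}"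
      have "V z \<in> ?R" using R[OF sup] z by (simp add: L)
      then have "norm (V z) \<le> B" by (rule B)
      then have "\<bar>fst z\<bar> \<le> B" "\<bar>snd z\<bar> \<le> B"
        using component_le_norm_cart[of "V z" i] component_le_norm_cart[of "V z" j] by (auto simp: Vij)
      moreover have "norm z \<le> norm (fst z) + norm (snd z)" by (metis norm_Pair_le prod.collapse)
      ultimately show "norm z \<le> B + B" by simp
    qed
    have posL: "0 < L e (a0$i, a0$j)" if "e \<in> extA" for e using a0'[OF that] a0s by (simp add: L)
    have genL: "card extA \<le> card ((\<lambda>e. L e z) ` extA) + 2" if "\<And>e. e \<in> extA \<Longrightarrow> 0 < L e z" for z
      using genJ[OF sup, of z] that 3 by (simp add: L)
    obtain z and p1 q1 p2 q2 :: int and e e' f f'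
      where pos: "\<forall>w\<in>extA. 0 < L w z" and e: "e \<in> extA" "e' \<in> extA" "f \<in> extA" "f' \<in> extA"
      and ne: "p1 * a e + q1 * b e \<noteq> 0" "p1 * a e' + q1 * b e' \<noteq> 0"
        "p2 * a f + q2 * b f \<noteq> 0" "p2 * a f' + q2 * b f' \<noteq> 0"
      and eq1: "L e z = L e' z"
      and lt1: "\<forall>w\<in>extA - {e, e'}. p1 * a w + q1 * b w \<noteq> 0 \<longrightarrow> L e z < L w z"
      and eq2: "L f z = L f' z"
      and lt2: "\<forall>w\<in>extA - {f, f'}. p2 * a w + q2 * b w \<noteq> 0 \<longrightarrow> L f z < L w z"
      and det1: "p1 * q2 - q1 * p2 \<noteq> 0"
      and det2: "(a e - a e') * (b f - b f') - (b e - b e') * (a f - a f') \<noteq> 0"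
      by (rule transversal_pairs_2[of extA "\<lambda>w. ellx q w q" a b "(a0$i, a0$j)", folded L_def, OF finite_extA bdL posL genL])
        (assumption | rule that)+
    define p where "p = q - V z"
    have p: "p \<in> cell" using cell_shift_iff[OF qH sup] pos by (auto simp: p_def L)
    \<comment> \<open>Row \<open>i\<close> combines the two critical equations by the first
      functional, row \<open>j\<close> by the second; \<open>det1\<close> and \<open>det2\<close>
      yield the two kernel conditions.\<close>
    define lam where "lam r l = (if r = i then (if l = i then p1 else q1) else (if l = i then p2 else q2))" for r l
    have Lam2: "Lam lam i w = p1 * a w + q1 * b w" "Lam lam j w = p2 * a w + q2 * b w" for w
      using ij by (auto simp: Lam_def Jij a_def b_def lam_def)
    define ee where "ee r = (if r = i then e else f)" for r
    define ee' where "ee' r = (if r = i then e' else f')" for r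
    have "trop_coords (- q) \<in> tropical_tangents \<nu> A c (trop_coords p)"
    proof (rule tangent_from_balanced_terms[OF k q p, where e = ee and e' = ee' and lam = lam])
      show "p$l = q$l" if "l \<notin> J" for l using sup[OF that] by (simp add: p_def)
      fix r assume r: "r \<in> J"
      show "ee r \<in> extA" "ee' r \<in> extA" using e by (auto simp: ee_def ee'_def)
      show "Lam lam r (ee r) \<noteq> 0" "Lam lam r (ee' r) \<noteq> 0"
        using r ne ij by (auto simp: ee_def ee'_def Jij Lam2)
      show "ellx q (ee r) p = ellx q (ee' r) p"
        using eq1 eq2 by (simp add: ee_def ee'_def L p_def)
      show "ellx q (ee r) p < ellx q w p"
        if "w \<in> extA" "w \<noteq> ee r" "w \<noteq> ee' r" "Lam lam r w \<noteq> 0" for w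
        using lt1 lt2 that r ij by (auto simp: ee_def ee'_def L p_def Jij Lam2 split: if_splits)
    next
      fix y :: "rat^4" assume out: "\<And>j. j \<notin> J \<Longrightarrow> y$j = 0"
      have y: "y = 0" if "y$i = 0" "y$j = 0"
        unfolding vec_eq_iff
      proof
        fix l show "y$l = 0$l" using that out[of l] by (cases "l \<in> J") (auto simp: Jij)
      qed
      show "y = 0" if h: "\<And>r. r \<in> J \<Longrightarrow> (\<Sum>j\<in>J. of_int (int (ee r$j) - int (ee' r$j)) * y$j) = 0"
      proof (rule y)
        have "of_int (a e - a e') * y$i + of_int (b e - b e') * y$j = 0"
          "of_int (a f - a f') * y$i + of_int (b f - b f') * y$j = 0"
          using h[of i] h[of j] ij by (auto simp: Jij ee_def ee'_def a_def b_def)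
        then show "y$i = 0" "y$j = 0" using rat_2x2_kernel det2 by blast+
      qed
      show "y = 0" if h: "\<And>r. r \<in> J \<Longrightarrow> (\<Sum>j\<in>J. of_int (lam r j) * y$j) = 0"
      proof (rule y)
        have "of_int p1 * y$i + of_int q1 * y$j = 0" "of_int p2 * y$i + of_int q2 * y$j = 0"
          using h[of i] h[of j] ij by (auto simp: Jij lam_def)
        then show "y$i = 0" "y$j = 0" using rat_2x2_kernel det1 by blast+
      qed
    qed
    then show ?thesis using p by blast
  qed
qed

end

section \<open>Genericity\<close>


lemma affine_span_thin:
  fixes x0 :: "real^4"
  assumes "finite X" "card X \<le> 3"
  shows "closed ((+) x0 ` span X)" "interior ((+) x0 ` span X) = {}"
proof -
  show "closed ((+) x0 ` span X)" by (intro closed_translation closed_subspace subspace_span)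
  have "dim (span X) \<le> card X" using assms(1) by (simp add: dim_le_card')
  then have "dim (span X) < DIM(real^4)" using assms(2) by simp
  then have "interior (span X) = {}" by (rule empty_interior_lowdim)
  then show "interior ((+) x0 ` span X) = {}" by (simp add: interior_translation)
qed

lemma finite_Union_thin:
  fixes F :: "('v::euclidean_space) set set"
  assumes "finite F" "\<And>S. S \<in> F \<Longrightarrow> closed S \<and> interior S = {}"
  shows "closed (\<Union>F) \<and> interior (\<Union>F) = {}"
  using assms
proof (induction F rule: finite_induct)
  case (insert S F)
  then show ?case using interior_closed_Un_empty_interior[of S "\<Union>F"] by auto
qed simp

text \<open>Stating the bound as a sum avoids natural subtraction; for n > d only the empty
  alternative remains.\<close>

lemma low_aff_dim_in_translated_span:
  fixes t :: "('v::euclidean_space) set"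
  assumes "aff_dim t \<le> int d - int n"
  shows "\<exists>p0 B. finite B \<and> card B + n \<le> d \<and> t \<subseteq> (+) p0 ` span B \<or> t = {}"
proof (cases "t = {}")
  case False
  then obtain p0 where p0: "p0 \<in> t" by blast
  define S where "S = (+) (- p0) ` t"
  have dim: "aff_dim t = int (dim S)"
    unfolding S_def by (rule aff_dim_eq_dim) (use p0 in \<open>simp add: hull_inc\<close>)
  obtain B where B: "B \<subseteq> S" "independent B" "S \<subseteq> span B" "card B = dim S"
    using basis_exists by blast
  have "t \<subseteq> (+) p0 ` span B"
  proof
    fix x assume "x \<in> t"
    then have "- p0 + x \<in> span B" using B(3) by (auto simp: S_def)
    then have "p0 + (- p0 + x) \<in> (+) p0 ` span B" by blast
    then show "x \<in> (+) p0 ` span B" by simp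
  qed
  moreover have "finite B" using B(2) by (rule independent_imp_finite)
  moreover have "card B + n \<le> d" using dim B(4) assms by linarith
  ultimately show ?thesis by blast
qed simp

context tropical_edge
begin

abbreviation bvec :: "4 \<Rightarrow> real^4" where "bvec i \<equiv> axis i 1"

text \<open>Recovers q from \<open>p\<close> when each slack q_i - p_i, i in \<open>J\<close>, is
  known to be a value of \<open>ell\<close>: \<sigma> records which exponent gives it. Slacks marked
  \<open>None\<close> are added separately.\<close>

definition lift :: "(4 \<Rightarrow> (nat^4) option) \<Rightarrow> real^4 \<Rightarrow> real^4" where
  "lift \<sigma> p = p + (\<Sum>i\<in>J. (case \<sigma> i of None \<Rightarrow> 0 | Some w \<Rightarrow> ell w p) *\<^sub>R bvec i)"

definition lift_linear :: "(4 \<Rightarrow> (nat^4) option) \<Rightarrow> real^4 \<Rightarrow> real^4" where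
  "lift_linear \<sigma> y = y + (\<Sum>i\<in>J. (case \<sigma> i of None \<Rightarrow> 0 | Some w \<Rightarrow> pairing y u - pairing y w) *\<^sub>R bvec i)"

lemma lift_shift: "lift \<sigma> (p + y) = lift \<sigma> p + lift_linear \<sigma> y"
proof -
  have "(case \<sigma> i of None \<Rightarrow> 0 | Some w \<Rightarrow> ell w (p + y))
      = (case \<sigma> i of None \<Rightarrow> 0 | Some w \<Rightarrow> ell w p)
        + (case \<sigma> i of None \<Rightarrow> 0 | Some w \<Rightarrow> pairing y u - pairing y w)" for i
    by (cases "\<sigma> i") (auto simp: ell_shift)
  then show ?thesis by (simp add: lift_def lift_linear_def scaleR_left_distrib sum.distrib)
qed

lemma linear_lift_linear: "linear (lift_linear \<sigma>)"
proof (rule linearI)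
  define h where "h y i = (case \<sigma> i of None \<Rightarrow> 0 | Some w \<Rightarrow> pairing y u - pairing y w)" for y i
  have h: "h (x + y) i = h x i + h y i" "h (r *\<^sub>R x) i = r * h x i" for x y r i
    by (cases "\<sigma> i"; simp add: h_def pairing_add pairing_scaleR right_diff_distrib)+
  show "lift_linear \<sigma> (x + y) = lift_linear \<sigma> x + lift_linear \<sigma> y" for x y
    by (simp add: lift_linear_def h_def[symmetric] h(1) scaleR_left_distrib sum.distrib)
  show "lift_linear \<sigma> (r *\<^sub>R x) = r *\<^sub>R lift_linear \<sigma> x" for r x
    by (simp add: lift_linear_def h_def[symmetric] h(2) scaleR_right_distrib scaleR_sum_right)
qed

text \<open>A coincidence among \<open>N\<close> of the values lowers the dimension of the locus of \<open>p\<close> by \<open>N\<close>, while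
  the free values \<open>q$i - p$i\<close> only give back as many dimensions as they are distinct.\<close>

lemma few_values_thin:
  assumes gen: "generic_valuations \<nu> c A"
  shows "\<exists>Z. closed Z \<and> interior Z = {} \<and> (\<forall>q p s. p \<in> cell \<and> (\<forall>i. i \<notin> J \<longrightarrow> p$i = q$i) \<and>
     card ((\<lambda>w. ellx q w p) ` extA) + card J < card extA \<longrightarrow> q + s *\<^sub>R bvec k \<in> Z)"
proof -
  \<comment> \<open>Here \<open>n\<close> counts the distinct slacks that are not values of
    \<open>ell\<close>. They do not reduce the coincidences required among the terms of f, so n + 2
    values are lost there and \<open>p\<close> is confined to dimension 2 - n.\<close>
  define S where "S n = {p. card (Amin \<nu> c A p) > 1 \<and>
     int (card ((\<lambda>w. \<nu> (c w) - pairing p w) ` A)) \<le> int (card A) - int (n + 2)}" for n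
  have "\<exists>T. finite T \<and> S n \<subseteq> \<Union>T \<and> (\<forall>t\<in>T. aff_dim t \<le> int 2 - int n)" for n
    using gen[unfolded generic_valuations_def, rule_format, of "n + 2"]
    unfolding dim_at_most_def S_def by (simp add: algebra_simps)
  then obtain T where T: "\<And>n. finite (T n)" "\<And>n. S n \<subseteq> \<Union>(T n)"
    and dimT: "\<And>n t. t \<in> T n \<Longrightarrow> aff_dim t \<le> int 2 - int n" by metis
  have "\<forall>n. \<forall>t\<in>T n. \<exists>p0 B. finite B \<and> card B + n \<le> 2 \<and> t \<subseteq> (+) p0 ` span B \<or> t = {}"
    using low_aff_dim_in_translated_span[OF dimT] by blast
  then obtain p0 B where pB: "\<And>n t. t \<in> T n \<Longrightarrow> t \<noteq> {} \<Longrightarrow>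
      finite (B n t) \<and> card (B n t) + n \<le> 2 \<and> t \<subseteq> (+) (p0 n t) ` span (B n t)"
    by metis
  \<comment> \<open>Coordinates that share one free slack move together, so each free value
    contributes a single direction, a sum of unit vectors.\<close>
  define Vs :: "(real^4) set set" where "Vs = Pow (range (\<lambda>C. \<Sum>i\<in>C. bvec i))"
  define Sig where "Sig = PiE (UNIV::4 set) (\<lambda>_. insert None (Some ` A))"
  \<comment> \<open>At most 2 - n directions for \<open>p\<close>, \<open>n\<close> for the free
    slacks and one for \<open>bvec k\<close>: at most three in dimension four.\<close>
  define X where "X n t \<sigma> V = lift_linear \<sigma> ` B n t \<union> insert (bvec k) V" for n t \<sigma> V
  define F where "F = {(+) (lift \<sigma> (p0 n t)) ` span (X n t \<sigma> V) | n t \<sigma> V.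
     n \<in> {..2} \<and> t \<in> T n \<and> t \<noteq> {} \<and> \<sigma> \<in> Sig \<and> V \<in> Vs \<and> card V \<le> n}"
  have finSig: "finite Sig" unfolding Sig_def using finA by (intro finite_PiE) auto
  have finV: "finite V" if "V \<in> Vs" for V using that finite_subset[of V] by (auto simp: Vs_def)
  have "F \<subseteq> (\<lambda>(n, t, \<sigma>, V). (+) (lift \<sigma> (p0 n t)) ` span (X n t \<sigma> V)) ` (SIGMA n:{..2}. T n \<times> Sig \<times> Vs)"
    unfolding F_def by force
  moreover have "finite (SIGMA n:{..2}. T n \<times> Sig \<times> Vs)"
    using T(1) finSig by (intro finite_SigmaI finite_cartesian_product) (auto simp: Vs_def)
  ultimately have finF: "finite F" using finite_surj by blast
  have thin: "closed Z \<and> interior Z = {}" if Z: "Z \<in> F" for Z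
  proof -
    obtain n t \<sigma> V where Zeq: "Z = (+) (lift \<sigma> (p0 n t)) ` span (X n t \<sigma> V)"
      and *: "t \<in> T n" "t \<noteq> {}" "V \<in> Vs" "card V \<le> n" using Z unfolding F_def by blast
    have b: "finite (B n t)" "card (B n t) + n \<le> 2" using pB[OF *(1,2)] by auto
    have "card (X n t \<sigma> V) \<le> card (lift_linear \<sigma> ` B n t) + card (insert (bvec k) V)"
      unfolding X_def by (rule card_Un_le)
    also have "\<dots> \<le> card (B n t) + Suc (card V)"
      using b finV[OF *(3)] by (intro add_mono card_image_le) (auto simp: card_insert_if)
    also have "\<dots> \<le> 3" using b *(4) by linarith
    finally show ?thesis unfolding Zeq using b finV[OF *(3)]
      by (intro conjI affine_span_thin) (auto simp: X_def)
  qed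
  \<comment> \<open>Such a q lies on the hyperplane \<open>ell v q = 0\<close> anyway. Excluding
    whole lines in direction \<open>k\<close> lets q be chosen later by moving freely in an open set
    of the full space and projecting along \<open>k\<close>.\<close>
  have "q + s *\<^sub>R bvec k \<in> \<Union>F"
    if p: "p \<in> cell" and pq: "\<forall>i. i \<notin> J \<longrightarrow> p$i = q$i"
      and few: "card ((\<lambda>w. ellx q w p) ` extA) + card J < card extA" for q p s
  proof -
    define a where "a i = q$i - p$i" for i
    define N where "N = a ` J - (\<lambda>w. ell w p) ` A"
    define n where "n = card N"
    have finN: "finite N" by (simp add: N_def)
    have "n \<le> card (a ` J)" unfolding n_def N_def by (intro card_mono) auto
    also have "\<dots> \<le> 2" using card_image_le[of J a] card_J by simp
    finally have n2: "n \<in> {..2}" by simp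
    define P where "P = (\<lambda>w. ell w p) ` (A - {u, v})"
    have v0: "ell u p = 0" "ell v p = 0" using p by (auto simp: cell_def ell_def)
    have "(\<lambda>w. ell w p) ` A = insert 0 P"
      unfolding P_def using uA vA v0 by force
    moreover have "0 \<notin> P" using p by (force simp: P_def cell_def)
    moreover have finP: "finite P" using finA by (simp add: P_def)
    ultimately have cA: "card ((\<lambda>w. ell w p) ` A) = Suc (card P)" by simp
    have "(\<lambda>w. ellx q w p) ` extA = P \<union> a ` J"
      unfolding extA_def Y_def image_Un P_def
      by (simp add: image_image ellx_Y a_def) (auto simp: ellx_def)
    moreover have "N \<inter> P = {}" by (auto simp: N_def P_def)
    then have "card (P \<union> N) = card P + n" using finP finN by (simp add: card_Un_disjoint n_def Int_commute)
    moreover have "card (P \<union> N) \<le> card (P \<union> a ` J)" using finP by (intro card_mono) (auto simp: N_def)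
    ultimately have 1: "card P + n \<le> card ((\<lambda>w. ellx q w p) ` extA)" by simp
    have "card Y = card J" unfolding Y_def by (intro card_image inj_on_subset[OF inj_u_axis]) auto
    moreover have "card (A - {u, v}) + 2 = card A"
      using finA uA vA uv card_mono[of A "{u, v}"] by (simp add: card_Diff_subset)
    moreover have "card extA = card (A - {u, v}) + card Y"
      unfolding extA_def using finA u_axis_notin by (intro card_Un_disjoint) (auto simp: Y_def)
    \<comment> \<open>The terms of \<open>u\<close> and \<open>v\<close> share the value 0, which
      accounts for one more value and two more exponents than in \<open>extA\<close>.\<close>
    ultimately have "card ((\<lambda>w. ell w p) ` A) + (n + 2) \<le> card A" using 1 few cA by linarith
    moreover have "card ((\<lambda>w. \<nu> (c w) - pairing p w) ` A) = card ((\<lambda>w. ell w p) ` A)"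
    proof -
      have "(\<lambda>w. ell w p) ` A = (\<lambda>x. x - (\<nu> (c u) - pairing p u)) ` ((\<lambda>w. \<nu> (c w) - pairing p w) ` A)"
        by (simp add: image_image ell_def)
      then show ?thesis by (simp add: card_image inj_on_def)
    qed
    moreover have "card (Amin \<nu> c A p) > 1" using p uv by (simp add: Amin_eq_iff[THEN iffD2])
    ultimately have "p \<in> S n" by (simp add: S_def)
    then obtain t where t: "t \<in> T n" "p \<in> t" using T(2) by blast
    then have tne: "t \<noteq> {}" by blast
    obtain y where y: "y \<in> span (B n t)" "p = p0 n t + y" using pB[OF t(1) tne] t(2) by blast
    have "\<forall>i. \<exists>z\<in>insert None (Some ` A). if i \<in> J \<and> a i \<notin> N then (\<exists>w. z = Some w \<and> ell w p = a i) else z = None"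
      by (auto simp: N_def)
    then obtain \<sigma> where sig: "\<And>i. \<sigma> i \<in> insert None (Some ` A)"
      and sig1: "\<And>i. if i \<in> J \<and> a i \<notin> N then (\<exists>w. \<sigma> i = Some w \<and> ell w p = a i) else \<sigma> i = None"
      by metis
    define V where "V = (\<lambda>x. \<Sum>i | i \<in> J \<and> a i = x. bvec i) ` N"
    have V: "V \<in> Vs" "card V \<le> n" using finN by (auto simp: V_def Vs_def n_def card_image_le)
    have "(\<Sum>x\<in>N. x *\<^sub>R (\<Sum>i | i \<in> J \<and> a i = x. bvec i)) = (\<Sum>x\<in>N. \<Sum>i | i \<in> J \<and> a i = x. a i *\<^sub>R bvec i)"
      by (simp add: scaleR_sum_right)
    also have "\<dots> = (\<Sum>i | i \<in> J \<and> a i \<in> N. a i *\<^sub>R bvec i)"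
    proof -
      have "{i \<in> {i. i \<in> J \<and> a i \<in> N}. a i = x} = {i. i \<in> J \<and> a i = x}" if "x \<in> N" for x using that by auto
      then show ?thesis using sum.group[of "{i. i \<in> J \<and> a i \<in> N}" N a "\<lambda>i. a i *\<^sub>R bvec i"] finN
        by (auto simp: image_subset_iff)
    qed
    also have "\<dots> = (\<Sum>i\<in>J. if a i \<in> N then a i *\<^sub>R bvec i else 0)"
      by (subst sum.inter_filter[symmetric]) auto
    finally have sN: "(\<Sum>x\<in>N. x *\<^sub>R (\<Sum>i | i \<in> J \<and> a i = x. bvec i))
        = (\<Sum>i\<in>J. if a i \<in> N then a i *\<^sub>R bvec i else 0)" .
    have "(\<Sum>i\<in>J. a i *\<^sub>R bvec i) = (\<Sum>i\<in>J. (case \<sigma> i of None \<Rightarrow> 0 | Some w \<Rightarrow> ell w p) *\<^sub>R bvec i)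
        + (\<Sum>i\<in>J. if a i \<in> N then a i *\<^sub>R bvec i else 0)"
      unfolding sum.distrib[symmetric]
    proof (rule sum.cong)
      fix i assume "i \<in> J"
      then show "a i *\<^sub>R bvec i = (case \<sigma> i of None \<Rightarrow> 0 | Some w \<Rightarrow> ell w p) *\<^sub>R bvec i
          + (if a i \<in> N then a i *\<^sub>R bvec i else 0)"
        using sig1[of i] by (auto split: if_splits)
    qed simp
    moreover have "q = p + (\<Sum>i\<in>J. a i *\<^sub>R bvec i)"
      unfolding vec_eq_iff
    proof
      fix l
      have "(\<Sum>i\<in>J. a i *\<^sub>R bvec i)$l = (\<Sum>i\<in>J. if i = l then a l else 0)"
        unfolding sum_component by (intro sum.cong) (auto simp: axis_def)
      also have "\<dots> = (if l \<in> J then a l else 0)" by simp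
      finally show "q$l = (p + (\<Sum>i\<in>J. a i *\<^sub>R bvec i))$l"
        unfolding vector_add_component using pq by (auto simp: a_def)
    qed
    ultimately have q: "q = lift \<sigma> p + (\<Sum>x\<in>N. x *\<^sub>R (\<Sum>i | i \<in> J \<and> a i = x. bvec i))"
      by (simp add: lift_def sN)
    have "(\<Sum>x\<in>N. x *\<^sub>R (\<Sum>i | i \<in> J \<and> a i = x. bvec i)) \<in> span V"
      by (intro span_sum span_scale span_base) (auto simp: V_def)
    then have 3: "(\<Sum>x\<in>N. x *\<^sub>R (\<Sum>i | i \<in> J \<and> a i = x. bvec i)) \<in> span (X n t \<sigma> V)"
      using span_mono[of V "X n t \<sigma> V"] by (auto simp: X_def)
    have "lift_linear \<sigma> y \<in> span (lift_linear \<sigma> ` B n t)"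
      using y(1) linear_span_image[OF linear_lift_linear] by blast
    then have 4: "lift_linear \<sigma> y \<in> span (X n t \<sigma> V)"
      using span_mono[of "lift_linear \<sigma> ` B n t" "X n t \<sigma> V"] by (auto simp: X_def)
    have 5: "s *\<^sub>R bvec k \<in> span (X n t \<sigma> V)" by (intro span_scale span_base) (simp add: X_def)
    have "q + s *\<^sub>R bvec k = lift \<sigma> (p0 n t) + (lift_linear \<sigma> y
        + (\<Sum>x\<in>N. x *\<^sub>R (\<Sum>i | i \<in> J \<and> a i = x. bvec i)) + s *\<^sub>R bvec k)"
      by (simp add: q y(2) lift_shift)
    then have "q + s *\<^sub>R bvec k \<in> (+) (lift \<sigma> (p0 n t)) ` span (X n t \<sigma> V)"
      by (rule image_eqI) (intro span_add 3 4 5)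
    moreover have "\<sigma> \<in> Sig" using sig unfolding Sig_def PiE_UNIV_domain by blast
    then have "(+) (lift \<sigma> (p0 n t)) ` span (X n t \<sigma> V) \<in> F"
      unfolding F_def using n2 t(1) tne V by blast
    ultimately show ?thesis by blast
  qed
  then show ?thesis using finite_Union_thin[OF finF thin] by blast
qed

end

section \<open>Recession cones and tropical coordinates\<close>


text \<open>Normalising an unbounded sequence of such \<open>a\<close> gives a unit vector
  \<open>l\<close> in \<open>K\<close>. As the sums x + T a stay bounded, -T l is a recession
  direction of \<open>F\<close>, which forces l = 0.\<close>

lemma bounded_of_recession:
  fixes T :: "'a::euclidean_space \<Rightarrow> 'b::euclidean_space"
  assumes T: "linear T" and F: "closed F" "convex F"
    and K: "closed K" "\<And>a t. a \<in> K \<Longrightarrow> 0 \<le> t \<Longrightarrow> t *\<^sub>R a \<in> K"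
    and rec: "\<And>a. a \<in> K \<Longrightarrow> (\<And>x t. x \<in> F \<Longrightarrow> 0 \<le> t \<Longrightarrow> x - t *\<^sub>R T a \<in> F) \<Longrightarrow> a = 0"
  shows "bounded {a\<in>K. \<exists>x\<in>F. norm (x + T a) \<le> M}"
proof (rule ccontr)
  assume unb: "\<not> bounded {a\<in>K. \<exists>x\<in>F. norm (x + T a) \<le> M}"
  have "\<forall>n. \<exists>a x. a \<in> K \<and> x \<in> F \<and> norm (x + T a) \<le> M \<and> real n < norm a"
  proof
    fix n
    have "\<not> (\<forall>a\<in>{a\<in>K. \<exists>x\<in>F. norm (x + T a) \<le> M}. norm a \<le> real n)"
      using unb unfolding bounded_iff by blast
    then show "\<exists>a x. a \<in> K \<and> x \<in> F \<and> norm (x + T a) \<le> M \<and> real n < norm a"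
      by (auto simp: not_le)
  qed
  from choice[OF this] obtain a where "\<forall>n. \<exists>x. a n \<in> K \<and> x \<in> F \<and> norm (x + T (a n)) \<le> M \<and> real n < norm (a n)"
    by blast
  from choice[OF this] obtain x where a: "\<And>n. a n \<in> K" and x: "\<And>n. x n \<in> F"
    and M: "\<And>n. norm (x n + T (a n)) \<le> M" and big: "\<And>n. real n < norm (a n)" by blast
  define b where "b n = (1 / norm (a n)) *\<^sub>R a n" for n
  have pos: "norm (a n) > 0" for n using big[of n] by linarith
  have "b n \<in> sphere 0 1" for n using pos[of n] by (simp add: b_def)
  then obtain l r where l: "l \<in> sphere 0 1" and r: "strict_mono (r::nat \<Rightarrow> nat)" and lim: "(b \<circ> r) \<longlonglongrightarrow> l"
    using compact_sphere[of "0::'a" 1] unfolding compact_def by metis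
  have "l \<in> K"
    by (rule closed_sequentially[OF K(1) _ lim]) (use K(2)[OF a] in \<open>auto simp: b_def\<close>)
  have inv: "(\<lambda>n. 1 / norm (a n)) \<longlonglongrightarrow> 0"
  proof (rule tendsto_sandwich[OF _ _ tendsto_const lim_1_over_n])
    show "\<forall>\<^sub>F n in sequentially. 0 \<le> 1 / norm (a n)" by simp
    show "\<forall>\<^sub>F n in sequentially. 1 / norm (a n) \<le> 1 / of_nat n"
      using eventually_gt_at_top[of 0]
    proof eventually_elim
      fix n :: nat assume "0 < n"
      then show "1 / norm (a n) \<le> 1 / of_nat n" using big[of n] by (intro frac_le) auto
    qed
  qed
  have inv': "(\<lambda>n. 1 / norm (a (r n))) \<longlonglongrightarrow> 0"
    using LIMSEQ_subseq_LIMSEQ[OF inv r] by (simp add: o_def)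
  have "(\<lambda>n. (1 / norm (a (r n))) *\<^sub>R (x (r n) + T (a (r n)))) \<longlonglongrightarrow> 0"
  proof (rule Lim_null_comparison)
    show "\<forall>\<^sub>F n in sequentially. norm ((1 / norm (a (r n))) *\<^sub>R (x (r n) + T (a (r n)))) \<le> (1 / norm (a (r n))) * M"
      by (intro always_eventually allI) (use M in \<open>auto intro!: divide_right_mono\<close>)
    show "(\<lambda>n. (1 / norm (a (r n))) * M) \<longlonglongrightarrow> 0"
      using tendsto_mult_right[OF inv', of M] by simp
  qed
  moreover have "(\<lambda>n. T (b (r n))) \<longlonglongrightarrow> T l"
    using linear_continuous_at[OF linear_conv_bounded_linear[THEN iffD1, OF T]] lim
    by (auto simp: o_def intro: isCont_tendsto_compose)
  ultimately have "(\<lambda>n. (1 / norm (a (r n))) *\<^sub>R (x (r n) + T (a (r n))) - T (b (r n))) \<longlonglongrightarrow> 0 - T l"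
    by (rule tendsto_diff)
  then have xl: "(\<lambda>n. (1 / norm (a (r n))) *\<^sub>R x (r n)) \<longlonglongrightarrow> - T l"
    by (simp add: b_def linear_scale[OF T] algebra_simps)
  have "l = 0"
  proof (rule rec[OF \<open>l \<in> K\<close>])
    fix y t assume y: "y \<in> F" and t: "0 \<le> (t::real)"
    \<comment> \<open>Convex combinations of \<open>y\<close> and far points of \<open>F\<close>,
      converging to y - t T l.\<close>
    define w where "w n = (1 - t * (1 / norm (a (r n)))) *\<^sub>R y + t *\<^sub>R ((1 / norm (a (r n))) *\<^sub>R x (r n))" for n
    have "w \<longlonglongrightarrow> (1 - t * 0) *\<^sub>R y + t *\<^sub>R (- T l)"
      unfolding w_def by (intro tendsto_intros inv' xl)
    then have w: "w \<longlonglongrightarrow> y - t *\<^sub>R T l" by simp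
    have "\<forall>\<^sub>F n in sequentially. t * (1 / norm (a (r n))) < 1"
      using tendsto_mult_left[OF inv', of t] by (rule order_tendstoD) simp
    then have "\<forall>\<^sub>F n in sequentially. w n \<in> F"
    proof eventually_elim
      fix n assume n: "t * (1 / norm (a (r n))) < 1"
      define s where "s = t * (1 / norm (a (r n)))"
      have "0 \<le> s" "s \<le> 1" using n t by (auto simp: s_def)
      then have "(1 - s) *\<^sub>R y + s *\<^sub>R x (r n) \<in> F" using F(2) y x by (auto intro: convexD_alt)
      then show "w n \<in> F" by (simp add: w_def s_def)
    qed
    then show "y - t *\<^sub>R T l \<in> F" using Lim_in_closed_set[OF F(1) _ _ w] by simp
  qed
  then show False using l by simp
qed

text \<open>In a convergent sequence of sums the components in \<open>K\<close> are bounded by the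
  previous lemma, so a subsequence of them converges and the components in \<open>F\<close>
  follow.\<close>

lemma closed_sum_of_recession:
  fixes T :: "'a::euclidean_space \<Rightarrow> 'b::euclidean_space"
  assumes T: "linear T" and F: "closed F" "convex F"
    and K: "closed K" "\<And>a t. a \<in> K \<Longrightarrow> 0 \<le> t \<Longrightarrow> t *\<^sub>R a \<in> K"
    and rec: "\<And>a. a \<in> K \<Longrightarrow> (\<And>x t. x \<in> F \<Longrightarrow> 0 \<le> t \<Longrightarrow> x - t *\<^sub>R T a \<in> F) \<Longrightarrow> a = 0"
  shows "closed {x + T a | x a. x \<in> F \<and> a \<in> K}"
  unfolding closed_sequential_limits
proof (intro allI impI)
  fix w l assume asm: "(\<forall>n. w n \<in> {x + T a | x a. x \<in> F \<and> a \<in> K}) \<and> w \<longlonglongrightarrow> l"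
  then have "\<forall>n. \<exists>x a. w n = x + T a \<and> x \<in> F \<and> a \<in> K" by blast
  then obtain x a where w: "\<And>n. w n = x n + T (a n)" and x: "\<And>n. x n \<in> F" and a: "\<And>n. a n \<in> K" by metis
  have "bounded (range w)" using asm convergent_imp_bounded by blast
  then obtain M where M: "\<And>n. norm (w n) \<le> M" unfolding bounded_iff by blast
  have "a n \<in> {a\<in>K. \<exists>x\<in>F. norm (x + T a) \<le> M}" for n using x a M[of n] w by auto
  moreover have "bounded {a\<in>K. \<exists>x\<in>F. norm (x + T a) \<le> M}" by (rule bounded_of_recession[OF T F K rec])
  ultimately have "bounded (range a)" by (meson bounded_subset image_subsetI)
  then obtain b r where r: "strict_mono (r::nat \<Rightarrow> nat)" and lim: "(a \<circ> r) \<longlonglongrightarrow> b"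
    using bounded_imp_convergent_subsequence by blast
  have b: "b \<in> K" by (rule closed_sequentially[OF K(1) _ lim]) (use a in auto)
  have "(\<lambda>n. T (a (r n))) \<longlonglongrightarrow> T b"
    using linear_continuous_at[OF linear_conv_bounded_linear[THEN iffD1, OF T]] lim
    by (auto simp: o_def intro: isCont_tendsto_compose)
  moreover have "(\<lambda>n. w (r n)) \<longlonglongrightarrow> l" using LIMSEQ_subseq_LIMSEQ[OF conjunct2[OF asm] r] by (simp add: o_def)
  ultimately have "(\<lambda>n. w (r n) - T (a (r n))) \<longlonglongrightarrow> l - T b" by (intro tendsto_diff)
  then have "l - T b \<in> F" by (rule closed_sequentially[OF F(1), rotated]) (use x in \<open>simp add: w\<close>)
  then show "l \<in> {x + T a | x a. x \<in> F \<and> a \<in> K}" using b by (intro CollectI exI[of _ "l - T b"] exI[of _ b]) simp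
qed

text \<open>A high root of an element of nonzero value has a tiny nonzero value, and the integer
  multiples of that value come close to every real number.\<close>

lemma (in valued_field) values_dense:
  assumes ac: "alg_closed_field TYPE('a)" and e: "0 < (\<epsilon>::real)"
  shows "\<exists>b. b \<noteq> 0 \<and> \<bar>\<nu> b - r\<bar> < \<epsilon>"
proof -
  obtain a where a: "a \<noteq> 0" "\<nu> a \<noteq> 0" using nonarch by (auto simp: nonarch_valuation_def)
  obtain n :: nat where n: "\<bar>\<nu> a\<bar> / \<epsilon> < real n" using reals_Archimedean2 by blast
  have n0: "n > 0"
  proof (rule ccontr)
    assume "\<not> n > 0"
    then show False using n e by (simp add: divide_less_0_iff)
  qed
  then obtain b where b: "b ^ n = a" using alg_closed_root[OF ac] by blast
  then have b0: "b \<noteq> 0" using a n0 by (auto simp: zero_power)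
  have nb: "\<nu> a = real n * \<nu> b" using val_power[OF b0, of n] b by simp
  then have vb: "\<nu> b \<noteq> 0" using a by auto
  have "\<bar>\<nu> b\<bar> < \<epsilon>" using n n0 e nb by (simp add: abs_mult field_simps)
  define k where "k = \<lfloor>r / \<nu> b\<rfloor>"
  have "\<bar>r / \<nu> b - of_int k\<bar> < 1" unfolding k_def by linarith
  then have "\<bar>r / \<nu> b - of_int k\<bar> * \<bar>\<nu> b\<bar> < 1 * \<bar>\<nu> b\<bar>" using vb by (intro mult_strict_right_mono) auto
  moreover have "\<bar>r / \<nu> b - of_int k\<bar> * \<bar>\<nu> b\<bar> = \<bar>r - of_int k * \<nu> b\<bar>"
    using vb by (simp add: abs_mult[symmetric] left_diff_distrib)
  moreover have "\<bar>\<nu> (b powi k) - r\<bar> = \<bar>r - of_int k * \<nu> b\<bar>"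
    by (simp add: val_powi[OF b0] abs_minus_commute)
  ultimately have "\<bar>\<nu> (b powi k) - r\<bar> < \<epsilon>" using \<open>\<bar>\<nu> b\<bar> < \<epsilon>\<close> by linarith
  then show ?thesis using b0 by (intro exI[of _ "b powi k"]) auto
qed

section \<open>Tropical coordinates and the cone of J\<close>

lemma linear_trop_coords: "linear trop_coords"
  by (rule linearI) (auto simp: trop_coords_def vec_eq_iff forall_3 algebra_simps)

text \<open>\<open>forall_4\<close> and \<open>sum_4\<close> enumerate the index type as 1, 2, 3, 4,
  where 4 is the homogeneous index 0.\<close>

lemma four_eq_zero: "(4::4) = 0"
  by simp

lemma trop_coords_eq_iff: "trop_coords p = trop_coords q \<longleftrightarrow> (\<forall>i. p$i - q$i = p$0 - q$0)"
  by (auto simp: trop_coords_def vec_eq_iff forall_3 forall_4 four_eq_zero)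

definition exp_diff :: "nat^4 \<Rightarrow> nat^4 \<Rightarrow> real^3" where
  "exp_diff w u = vector [real (w$1) - real (u$1), real (w$2) - real (u$2), real (w$3) - real (u$3)]"

text \<open>A difference of exponents of equal degree has coordinate sum zero, so pairing with it
  only depends on \<open>p\<close> modulo constant vectors.\<close>

lemma pairing_diff_eq_inner:
  assumes "(\<Sum>i\<in>UNIV. w$i) = (\<Sum>i\<in>UNIV. u$i)"
  shows "pairing p w - pairing p u = exp_diff w u \<bullet> trop_coords p"
proof -
  have "real (w$1) + real (w$2) + real (w$3) + real (w$0) = real (u$1) + real (u$2) + real (u$3) + real (u$0)"
    using assms unfolding sum_4 four_eq_zero by linarith
  then have "p$0 * (real (w$1) + real (w$2) + real (w$3) + real (w$0))
      = p$0 * (real (u$1) + real (u$2) + real (u$3) + real (u$0))" by simp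
  then show ?thesis
    unfolding pairing_def sum_4 four_eq_zero exp_diff_def trop_coords_def inner_vec_def sum_3
    by (simp add: algebra_simps)
qed

lemma trop_coords_axis: "i \<in> {0..3} \<Longrightarrow> trop_coords (axis (of_nat i) 1) = std_e i"
proof -
  assume "i \<in> {0..3}"
  then have "i = 0 \<or> i = 1 \<or> i = 2 \<or> i = 3" by auto
  then show ?thesis
    by (auto simp: trop_coords_def std_e_def axis_def vec_eq_iff forall_3)
qed

lemma trop_coords_expand: "trop_coords a = (\<Sum>i\<in>{0..3}. a$(of_nat i) *\<^sub>R std_e i)"
proof -
  have "{0..3::nat} = {0, 1, 2, 3}" by auto
  then show ?thesis
    by (simp add: trop_coords_def std_e_def vec_eq_iff forall_3)
qed

lemma nonneg_cone_eq:
  fixes J :: "4 set"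
  shows "nonneg_cone std_e {i\<in>{0..3}. of_nat i \<in> J} =
    trop_coords ` {a. (\<forall>i\<in>J. 0 \<le> a$i) \<and> (\<forall>i. i \<notin> J \<longrightarrow> a$i = 0)}" (is "?L = ?R")
proof (intro equalityI subsetI)
  fix x assume "x \<in> ?L"
  then obtain \<alpha> where x: "x = (\<Sum>i\<in>{i\<in>{0..3}. of_nat i \<in> J}. \<alpha> i *\<^sub>R std_e i)"
    and nn: "\<And>i. i \<in> {0..3} \<Longrightarrow> of_nat i \<in> J \<Longrightarrow> 0 \<le> \<alpha> i"
    unfolding nonneg_cone_def by blast
  \<comment> \<open>The inverse of \<open>of_nat\<close> on 0..3, translating between the two index
    types.\<close>
  define idx :: "4 \<Rightarrow> nat" where "idx j = (if j = 0 then 0 else if j = 1 then 1 else if j = 2 then 2 else 3)" for j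
  have idx: "idx (of_nat i) = i" if "i \<in> {0..3}" for i
  proof -
    have "i = 0 \<or> i = 1 \<or> i = 2 \<or> i = 3" using that by auto
    then show ?thesis by (auto simp: idx_def)
  qed
  have idx': "idx j \<in> {0..3}" "of_nat (idx j) = j" for j
    using exhaust_4[of j] by (auto simp: idx_def)
  define a :: "real^4" where "a = (\<chi> j. if j \<in> J then \<alpha> (idx j) else 0)"
  have "trop_coords a = x"
    unfolding trop_coords_expand x by (intro sum.mono_neutral_cong_right) (auto simp: a_def idx)
  moreover have "a \<in> {a. (\<forall>i\<in>J. 0 \<le> a$i) \<and> (\<forall>i. i \<notin> J \<longrightarrow> a$i = 0)}"
    using nn[OF idx'(1)] idx'(2) by (auto simp: a_def)
  ultimately show "x \<in> ?R" by blast
next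
  fix x assume "x \<in> ?R"
  then obtain a where x: "x = trop_coords a" and a: "\<forall>i\<in>J. 0 \<le> a$i" "\<forall>i. i \<notin> J \<longrightarrow> a$i = 0" by blast
  have "x = (\<Sum>i\<in>{i\<in>{0..3}. of_nat i \<in> J}. a$(of_nat i) *\<^sub>R std_e i)"
    unfolding x trop_coords_expand using a(2) by (intro sum.mono_neutral_right) auto
  then show "x \<in> ?L" unfolding nonneg_cone_def
    using a(1) by (intro CollectI exI[of _ "\<lambda>i. a$(of_nat i)"]) simp
qed

section \<open>The dual cell\<close>


context tropical_edge
begin

lemma sum_exp_eq: "w \<in> A \<Longrightarrow> w' \<in> A \<Longrightarrow> (\<Sum>i\<in>UNIV. w$i) = (\<Sum>i\<in>UNIV. w'$i)"
  using hom by (simp add: homogeneous_of_degree_def)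

lemma ell_eq_inner:
  "w \<in> A \<Longrightarrow> ell w p = \<nu> (c w) - \<nu> (c u) - exp_diff w u \<bullet> trop_coords p"
  using pairing_diff_eq_inner[OF sum_exp_eq[OF _ uA], of w p] by (simp add: ell_def)

lemma cell_trop_coords:
  assumes "p \<in> cell" "trop_coords p = trop_coords p'"
  shows "p' \<in> cell"
  using assms ell_eq_inner[of _ p] ell_eq_inner[of _ p'] vA by (auto simp: cell_def)

lemma ell_affine: "ell w ((1 - t) *\<^sub>R p + t *\<^sub>R q) = (1 - t) * ell w p + t * ell w q"
  unfolding ell_def pairing_add pairing_scaleR by (simp add: algebra_simps)

lemma continuous_on_pairing [continuous_intros]: "continuous_on S f \<Longrightarrow> continuous_on S (\<lambda>x. pairing (f x) w)"
  unfolding pairing_def by (intro continuous_intros)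

lemma continuous_on_ell [continuous_intros]: "continuous_on S f \<Longrightarrow> continuous_on S (\<lambda>x. ell w (f x))"
  unfolding ell_def by (intro continuous_intros)

lemma convex_cell: "convex cell"
proof (rule convexI)
  fix x y and s t :: real assume xy: "x \<in> cell" "y \<in> cell" and st: "0 \<le> s" "0 \<le> t" "s + t = 1"
  then have s: "s = 1 - t" by simp
  have "0 < (1 - t) * a + t * b" if "0 < a" "0 < b" for a b
    using that st s by (cases "t = 0") (auto intro: add_nonneg_pos mult_nonneg_nonneg mult_pos_pos)
  then show "s *\<^sub>R x + t *\<^sub>R y \<in> cell"
    using xy unfolding s by (auto simp: cell_def ell_affine)
qed

lemma open_conditions: "open {p. \<forall>w\<in>A - {u, v}. 0 < ell w (h p)}" if "continuous_on UNIV h" for h :: "real^4 \<Rightarrow> real^4"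
proof -
  have "{p. \<forall>w\<in>A - {u, v}. 0 < ell w (h p)} = (\<Inter>w\<in>A - {u, v}. {p. 0 < ell w (h p)})" by auto
  moreover have "open \<dots>"
    using finA by (intro open_INT ballI open_Collect_less continuous_on_ell[OF that] continuous_intros) auto
  ultimately show ?thesis by simp
qed

lemma rel_interior_cell: "rel_interior cell = cell"
proof (rule rel_interior_openin)
  have "affine {p. ell v p = 0}"
    unfolding affine_alt by (simp add: ell_affine)
  then have "affine hull cell \<subseteq> {p. ell v p = 0}" by (intro hull_minimal) (auto simp: cell_def)
  then have eq: "affine hull cell \<inter> {p. \<forall>w\<in>A - {u, v}. 0 < ell w p} = cell"
    using hull_subset[of cell affine] by (auto simp: cell_def)
  have "openin (top_of_set (affine hull cell)) (affine hull cell \<inter> {p. \<forall>w\<in>A - {u, v}. 0 < ell w p})"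
    using open_conditions[OF continuous_on_id] by (rule openin_open_Int)
  then show "openin (top_of_set (affine hull cell)) cell" by (simp only: eq)
qed

text \<open>A small move towards a point of the cell makes all weak inequalities strict.\<close>

lemma closed_cell_subset:
  assumes ne: "cell \<noteq> {}" and p: "ell v p = 0" "\<And>w. w \<in> A - {u, v} \<Longrightarrow> 0 \<le> ell w p"
  shows "p \<in> closure cell"
proof -
  obtain p0 where p0: "p0 \<in> cell" using ne by blast
  define f where "f n = (1 - 1 / real (Suc n)) *\<^sub>R p + (1 / real (Suc n)) *\<^sub>R p0" for n
  have "f n \<in> cell" for n
  proof -
    have "0 < ell w (f n)" if w: "w \<in> A - {u, v}" for w
    proof -
      have "0 \<le> (1 - 1 / real (Suc n)) * ell w p"
        using p(2)[OF w] by (intro mult_nonneg_nonneg) auto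
      moreover have "0 < 1 / real (Suc n) * ell w p0"
        using p0 w by (intro mult_pos_pos) (auto simp: cell_def)
      ultimately show ?thesis unfolding f_def ell_affine by linarith
    qed
    then show ?thesis using p p0 by (auto simp: cell_def f_def ell_affine)
  qed
  moreover have "f \<longlonglongrightarrow> (1 - 0) *\<^sub>R p + 0 *\<^sub>R p0"
    unfolding f_def using LIMSEQ_inverse_real_of_nat by (intro tendsto_intros) (simp_all add: inverse_eq_divide)
  ultimately show ?thesis unfolding closure_sequential by auto
qed

definition K :: "(real^4) set" where "K = {a. (\<forall>i\<in>J. 0 \<le> a$i) \<and> (\<forall>i. i \<notin> J \<longrightarrow> a$i = 0)}"

lemma closed_K: "closed K"
proof -
  have "K = (\<Inter>i\<in>J. {a. 0 \<le> a$i}) \<inter> (\<Inter>i\<in>-J. {a. a$i = 0})" by (auto simp: K_def)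
  moreover have "closed \<dots>"
    by (intro closed_Int closed_INT ballI closed_Collect_le closed_Collect_eq continuous_intros)
  ultimately show ?thesis by simp
qed

lemma scale_K: "a \<in> K \<Longrightarrow> 0 \<le> t \<Longrightarrow> t *\<^sub>R a \<in> K"
  by (simp add: K_def)

lemma obtain_not_in_J: obtains k where "k \<notin> J"
  using uv by (auto simp: J_def vec_eq_iff)

text \<open>The kernel of the coordinate map consists of constant vectors, and elements of
  \<open>K\<close> vanish at an index outside \<open>J\<close>.\<close>

lemma trop_coords_K_zero: "a \<in> K \<Longrightarrow> trop_coords a = 0 \<Longrightarrow> a = 0"
proof -
  assume a: "a \<in> K" "trop_coords a = 0"
  have "trop_coords 0 = 0" by (rule linear_0[OF linear_trop_coords])
  then have "a$i = a$0" for i using a(2) trop_coords_eq_iff[of a 0] by simp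
  moreover obtain k where "k \<notin> J" by (rule obtain_not_in_J)
  then have "a$k = 0" using a by (simp add: K_def)
  ultimately show "a = 0" by (metis vec_eq_iff zero_index)
qed

lemma tropical_tangent_form:
  assumes "p \<in> cell" "y \<in> tropical_tangents \<nu> A c (trop_coords p)"
  shows "\<exists>a\<in>K. y = - trop_coords p - trop_coords a"
proof -
  obtain x where x: "\<And>i. x$i \<noteq> 0" "peval A c x = 0" "\<And>i. pderiv_eval A c i x \<noteq> 0" "trop_pt \<nu> x = trop_coords p"
    and y: "y = trop_pt \<nu> (\<chi> i. pderiv_eval A c i x)"
    using assms(2) unfolding tropical_tangents_def by blast
  \<comment> \<open>The representative determined by \<open>x\<close> itself; it agrees with
    \<open>p\<close> only modulo constant vectors.\<close>
  define p' :: "real^4" where "p' = (\<chi> i. - \<nu> (x$i))"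
  have tp: "trop_coords p' = trop_coords p" using x(4) by (simp add: p'_def trop_pt_def)
  then have p': "p' \<in> cell" using cell_trop_coords[OF assms(1)] by simp
  have xp: "x$j \<noteq> 0 \<and> \<nu> (x$j) = - p'$j" for j using x(1) by (simp add: p'_def)
  define m where "m = \<nu> (c u) - pairing p' u"
  define a :: "real^4" where "a = (\<chi> i. \<nu> (pderiv_eval A c i x) - (m + p'$i))"
  have "a \<in> K"
    using tangent_coordinate_val(1,2)[OF xp x(2) p'] x(3) by (auto simp: K_def a_def m_def less_imp_le)
  moreover have "y = - trop_coords p' - trop_coords a"
    by (simp add: y trop_pt_def trop_coords_def a_def vec_eq_iff forall_3)
  ultimately show ?thesis using tp by auto
qed

text \<open>Moves p + a to a nearby q that avoids the thin set and whose coordinates other than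
  \<open>k\<close> are values. The slack \<open>a\<close> itself remains a strictly feasible
  starting point for the maximisation at q.\<close>

lemma tangents_approximate:
  assumes gen: "generic_valuations \<nu> c A"
    and bd: "\<And>M. bounded {a\<in>K. \<exists>x\<in>closure (trop_coords ` cell). norm (x + trop_coords a) \<le> M}"
    and p: "p \<in> cell" and a: "\<And>i. i \<in> J \<Longrightarrow> 0 < a$i" "\<And>i. i \<notin> J \<Longrightarrow> a$i = 0" and e: "0 < (\<epsilon>::real)"
  shows "\<exists>q. dist (trop_coords (- q)) (- trop_coords p - trop_coords a) < \<epsilon> \<and>
    (\<exists>p'\<in>cell. trop_coords (- q) \<in> tropical_tangents \<nu> A c (trop_coords p'))"
proof -
  obtain k where k: "k \<notin> J" by (rule obtain_not_in_J)
  define \<delta> where "\<delta> = real (v$k) - real (u$k)"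
  have d0: "\<delta> \<noteq> 0" using k by (simp add: \<delta>_def J_def)
  define s where "s y = ell v y / \<delta>" for y
  \<comment> \<open>Projection along coordinate \<open>k\<close> onto the hyperplane
    \<open>ell v = 0\<close>; the slope \<delta> is nonzero because \<open>k\<close> is not in
    \<open>J\<close>.\<close>
  define \<pi> where "\<pi> y = y + s y *\<^sub>R axis k 1" for y
  have pv: "ell v (\<pi> y) = 0" for y
  proof -
    have "ell v (\<pi> y) = ell v y - s y * \<delta>"
      by (simp add: \<pi>_def ell_shift pairing_scaleR pairing_axis \<delta>_def algebra_simps)
    then show ?thesis using d0 by (simp add: s_def)
  qed
  have \<pi>k: "\<pi> y$i = y$i" if "i \<noteq> k" for y i using that by (simp add: \<pi>_def axis_def)
  have cont: "continuous_on S \<pi>" for S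
    unfolding \<pi>_def s_def using d0 by (intro continuous_intros) auto
  have contT: "continuous_on S (\<lambda>y. trop_coords (h y))" if "continuous_on S h" for S and h :: "real^4 \<Rightarrow> real^4"
    using linear_continuous_on_compose[OF that linear_trop_coords] by simp
  define q1 where "q1 = p + a"
  have q1v: "ell v q1 = 0"
    using p pairing_J_uv[OF a(2)] by (simp add: q1_def ell_shift cell_def)
  then have \<pi>q1: "\<pi> q1 = q1" by (simp add: \<pi>_def s_def)
  define U where "U = {y. \<forall>w\<in>A - {u, v}. 0 < ell w (\<pi> y - a)} \<inter> {y. dist (trop_coords (- \<pi> y)) (trop_coords (- q1)) < \<epsilon>}"
  have "open U"
    unfolding U_def by (intro open_Int open_conditions open_Collect_less continuous_intros contT cont)
  have "q1 - a = p" by (simp add: q1_def)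
  then have "q1 \<in> U" using p e by (simp add: U_def \<pi>q1 cell_def)
  obtain Z where Z: "closed Z" "interior Z = {}"
    and few: "\<And>q p s. p \<in> cell \<Longrightarrow> (\<forall>i. i \<notin> J \<longrightarrow> p$i = q$i) \<Longrightarrow>
      card ((\<lambda>w. ellx q w p) ` extA) + card J < card extA \<Longrightarrow> q + s *\<^sub>R axis k 1 \<in> Z"
    using few_values_thin[OF gen, of k] by blast
  have "\<not> U \<subseteq> Z" using interior_maximal[OF _ \<open>open U\<close>, of Z] Z(2) \<open>q1 \<in> U\<close> by blast
  then obtain y0 where y0: "y0 \<in> U - Z" by blast
  moreover have "open (U - Z)" using \<open>open U\<close> Z(1) by (rule open_Diff)
  ultimately obtain \<eta> where \<eta>: "\<eta> > 0" "ball y0 \<eta> \<subseteq> U - Z" using open_contains_ball by metis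
  \<comment> \<open>Four coordinate errors below \<eta> / 4 give a norm below \<eta>.\<close>
  have "\<forall>i. \<exists>b. b \<noteq> 0 \<and> \<bar>\<nu> b - y0$i\<bar> < \<eta> / 4" using values_dense[OF ac, of "\<eta> / 4"] \<eta>(1) by simp
  then obtain b where b: "\<And>i. b i \<noteq> 0" "\<And>i. \<bar>\<nu> (b i) - y0$i\<bar> < \<eta> / 4" by metis
  define y :: "real^4" where "y = (\<chi> i. \<nu> (b i))"
  have "norm (y0 - y) \<le> (\<Sum>i\<in>UNIV. \<bar>(y0 - y)$i\<bar>)" by (rule norm_le_l1_cart)
  also have "\<dots> < (\<Sum>i\<in>(UNIV::4 set). \<eta> / 4)"
    using b(2) by (intro sum_strict_mono) (auto simp: y_def abs_minus_commute)
  also have "\<dots> = \<eta>" by simp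
  finally have "y \<in> U - Z" using \<eta>(2) by (auto simp: dist_norm)
  then have yU: "y \<in> U" and yZ: "y \<notin> Z" by auto
  define q where "q = \<pi> y"
  have qa: "q - a \<in> cell"
    using yU pv[of y] pairing_J_uv[OF a(2)] by (auto simp: U_def q_def cell_def ell_def pairing_diff)
  have "\<exists>p\<in>cell. trop_coords (- q) \<in> tropical_tangents \<nu> A c (trop_coords p)"
  proof (rule tangent_exists[OF k _ _ qa a])
    show "\<exists>z. z \<noteq> 0 \<and> \<nu> z = q$i" if "i \<noteq> k" for i using b(1)[of i] \<pi>k[OF that, of y] by (auto simp: q_def y_def)
    show "ell v q = 0" by (simp add: q_def pv)
    let ?R = "{a. (\<forall>i. i \<notin> J \<longrightarrow> a$i = 0) \<and> (\<forall>i\<in>J. 0 \<le> a$i) \<and> (\<forall>w\<in>A - {u, v}. 0 \<le> ell w (q - a))}"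
    \<comment> \<open>For feasible slacks the point q - a of the closed cell and \<open>a\<close>
      add up to the fixed q, so the recession bound applies.\<close>
    have "?R \<subseteq> {a\<in>K. \<exists>x\<in>closure (trop_coords ` cell). norm (x + trop_coords a) \<le> norm (trop_coords q)}"
    proof
      fix a assume a: "a \<in> ?R"
      then have "pairing a v = pairing a u" by (intro pairing_J_uv) auto
      then have "ell v (q - a) = 0" using pv[of y] unfolding q_def ell_def pairing_diff by linarith
      then have "q - a \<in> closure cell" using a p by (intro closed_cell_subset) auto
      then have "trop_coords (q - a) \<in> closure (trop_coords ` cell)"
        using closure_linear_image_subset[OF linear_trop_coords] by blast
      moreover have "trop_coords (q - a) + trop_coords a = trop_coords q"
        by (simp add: linear_diff[OF linear_trop_coords])
      ultimately show "a \<in> {a\<in>K. \<exists>x\<in>closure (trop_coords ` cell). norm (x + trop_coords a) \<le> norm (trop_coords q)}"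
        using a by (auto simp: K_def intro!: bexI[of _ "trop_coords (q - a)"])
    qed
    then show "bounded ?R" using bd bounded_subset by blast
    show "card extA \<le> card ((\<lambda>w. ellx q w p) ` extA) + card J" if "p \<in> cell" "\<And>i. i \<notin> J \<Longrightarrow> p$i = q$i" for p
    proof (rule ccontr)
      assume "\<not> ?thesis"
      then have "q + (- s y) *\<^sub>R axis k 1 \<in> Z" using that by (intro few[of p]) auto
      then show False using yZ by (simp add: q_def \<pi>_def)
    qed
  qed
  moreover have "trop_coords (- q1) = - trop_coords p - trop_coords a"
    by (simp add: q1_def linear_add[OF linear_trop_coords] linear_diff[OF linear_trop_coords] linear_neg[OF linear_trop_coords])
  then have "dist (trop_coords (- q)) (- trop_coords p - trop_coords a) < \<epsilon>"
    using yU by (simp add: U_def q_def)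
  ultimately show ?thesis by blast
qed

lemma rel_interior_trop_cell: "rel_interior (closure (trop_coords ` cell)) = trop_coords ` cell"
  using rel_interior_convex_linear_image[OF linear_trop_coords convex_cell]
    convex_rel_interior_closure[OF convex_linear_image[OF linear_trop_coords convex_cell]]
  by (simp add: rel_interior_cell)

lemma dual_cell_eq:
  assumes gen: "generic_valuations \<nu> c A" and ne: "cell \<noteq> {}"
    and F: "F = closure (trop_coords ` cell)"
    and rec: "recession_cone F \<inter> uminus ` (trop_coords ` K) = {0}"
  shows "dual_cell \<nu> A c F = {- x - y | x y. x \<in> F \<and> y \<in> trop_coords ` K}"
proof -
  note lin = linear_trop_coords
  have clF: "closed F" and cvF: "convex F"
    by (auto simp: F intro!: convex_closure convex_linear_image lin convex_cell)
  have zero: "a = 0" if a: "a \<in> K" and r: "\<And>x t. x \<in> F \<Longrightarrow> 0 \<le> t \<Longrightarrow> x - t *\<^sub>R trop_coords a \<in> F" for a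
  proof -
    have "- trop_coords a \<in> recession_cone F" using r by (simp add: recession_cone_def)
    then have "- trop_coords a = 0" using rec a by blast
    then show ?thesis using trop_coords_K_zero[OF a] by simp
  qed
  have bd: "bounded {a\<in>K. \<exists>x\<in>F. norm (x + trop_coords a) \<le> M}" for M
    by (rule bounded_of_recession[OF lin clF cvF closed_K scale_K zero])
  have cl: "closed {x + trop_coords a | x a. x \<in> F \<and> a \<in> K}"
    by (rule closed_sum_of_recession[OF lin clF cvF closed_K scale_K zero])
  define D where "D = (\<Union>p\<in>rel_interior F. tropical_tangents \<nu> A c p)"
  have D: "D = (\<Union>p\<in>cell. tropical_tangents \<nu> A c (trop_coords p))"
    by (simp add: D_def F rel_interior_trop_cell)
  have eq: "{- x - y | x y. x \<in> F \<and> y \<in> trop_coords ` K} = uminus ` {x + trop_coords a | x a. x \<in> F \<and> a \<in> K}"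
    (is "?L = uminus ` ?R")
  proof (intro set_eqI iffI)
    fix z assume "z \<in> ?L"
    then obtain x a where "x \<in> F" "a \<in> K" "z = - (x + trop_coords a)" by auto
    then show "z \<in> uminus ` ?R" by blast
  next
    fix z assume "z \<in> uminus ` ?R"
    then obtain x a where "x \<in> F" "a \<in> K" "z = - x - trop_coords a" by auto
    then show "z \<in> ?L" by blast
  qed
  have "closure D \<subseteq> {- x - y | x y. x \<in> F \<and> y \<in> trop_coords ` K}"
  proof (rule closure_minimal)
    show "D \<subseteq> {- x - y | x y. x \<in> F \<and> y \<in> trop_coords ` K}"
    proof
      fix z assume "z \<in> D"
      then obtain p where p: "p \<in> cell" "z \<in> tropical_tangents \<nu> A c (trop_coords p)" using D by blast
      then obtain a where "a \<in> K" "z = - trop_coords p - trop_coords a" using tropical_tangent_form by blast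
      moreover have "trop_coords p \<in> F" using p(1) closure_subset[of "trop_coords ` cell"] by (auto simp: F)
      ultimately show "z \<in> {- x - y | x y. x \<in> F \<and> y \<in> trop_coords ` K}" by blast
    qed
    show "closed {- x - y | x y. x \<in> F \<and> y \<in> trop_coords ` K}"
      unfolding eq using cl by (rule closed_negations)
  qed
  moreover have "- x - trop_coords a \<in> closure D" if x: "x \<in> F" and a: "a \<in> K" for x a
  proof -
    obtain f where f: "\<And>n. f n \<in> trop_coords ` cell" "f \<longlonglongrightarrow> x"
      using x unfolding F closure_sequential by blast
    \<comment> \<open>Adding a small multiple of \<open>one\<close> makes the slack strictly
      positive on \<open>J\<close>, as the approximation requires; the limit removes it
      again.\<close>
    define one :: "real^4" where "one = (\<chi> i. if i \<in> J then 1 else 0)"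
    define g where "g n = a + (1 / real (Suc n)) *\<^sub>R one" for n
    have "g \<longlonglongrightarrow> a + 0 *\<^sub>R one"
      unfolding g_def using LIMSEQ_inverse_real_of_nat by (intro tendsto_intros) (simp add: inverse_eq_divide)
    then have g: "g \<longlonglongrightarrow> a" by simp
    have Tg: "(\<lambda>n. trop_coords (g n)) \<longlonglongrightarrow> trop_coords a"
      using linear_continuous_at[OF linear_conv_bounded_linear[THEN iffD1, OF lin]] g
      by (auto intro: isCont_tendsto_compose)
    have "- f n - trop_coords (g n) \<in> closure D" for n
    proof -
      obtain p where p: "p \<in> cell" "f n = trop_coords p" using f(1)[of n] by blast
      have gn: "0 < g n$i" if "i \<in> J" for i
        using a that by (auto simp: g_def one_def K_def intro: add_nonneg_pos)
      have gn0: "g n$i = 0" if "i \<notin> J" for i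
        using a that by (auto simp: g_def one_def K_def)
      show ?thesis
        unfolding closure_approachable
      proof (intro allI impI)
        fix e :: real assume "0 < e"
        from tangents_approximate[OF gen bd[unfolded F] p(1) gn gn0 this] 
        show "\<exists>z\<in>D. dist z (- f n - trop_coords (g n)) < e"
          unfolding D p(2) by blast
      qed
    qed
    moreover have "(\<lambda>n. - f n - trop_coords (g n)) \<longlonglongrightarrow> - x - trop_coords a"
      by (intro tendsto_intros f(2) Tg)
    ultimately show ?thesis by (rule closed_sequentially[OF closed_closure])
  qed
  ultimately have "closure D = {- x - y | x y. x \<in> F \<and> y \<in> trop_coords ` K}" by blast
  then show ?thesis by (simp add: dual_cell_def D_def)
qed

text \<open>The cell is relatively open in a plane with normal v - u, so a short step along e_i
  stays in it when u_i = v_i, and differences of its points are orthogonal to that normal.\<close>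

lemma std_e_in_span_iff:
  assumes ne: "cell \<noteq> {}" and i: "i \<in> {0..3}"
  shows "std_e i \<in> lin_span_diff (closure (trop_coords ` cell)) \<longleftrightarrow> of_nat i \<in> J"
proof
  let ?F = "closure (trop_coords ` cell)"
  define b where "b = exp_diff v u"
  have b: "b \<bullet> trop_coords p = pairing p v - pairing p u" for p
    using pairing_diff_eq_inner[OF sum_exp_eq[OF vA uA], of p] by (simp add: b_def)
  have F: "?F \<subseteq> {x. b \<bullet> x = \<nu> (c v) - \<nu> (c u)}"
    by (rule closure_minimal) (auto simp: cell_def b ell_def closed_hyperplane)
  have "lin_span_diff ?F \<subseteq> {z. b \<bullet> z = 0}"
    unfolding lin_span_diff_def
  proof (rule span_minimal)
    show "{x - y | x y. x \<in> ?F \<and> y \<in> ?F} \<subseteq> {z. b \<bullet> z = 0}" using F by (auto simp: inner_diff_right subset_iff)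
  qed (rule subspace_hyperplane)
  moreover assume "std_e i \<in> lin_span_diff ?F"
  ultimately have "b \<bullet> trop_coords (axis (of_nat i) 1) = 0" using trop_coords_axis[OF i] by auto
  then show "of_nat i \<in> J" unfolding b by (simp add: pairing_axis J_def)
next
  let ?F = "closure (trop_coords ` cell)"
  assume iJ: "of_nat i \<in> J"
  define ei :: "real^4" where "ei = axis (of_nat i) 1"
  obtain p where p: "p \<in> cell" using ne by blast
  have "open {t::real. \<forall>w\<in>A - {u, v}. 0 < ell w (p + t *\<^sub>R ei)}"
  proof -
    have "{t. \<forall>w\<in>A - {u, v}. 0 < ell w (p + t *\<^sub>R ei)} = (\<Inter>w\<in>A - {u, v}. {t. 0 < ell w (p + t *\<^sub>R ei)})" by auto
    moreover have "open \<dots>"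
      using finA by (intro open_INT ballI open_Collect_less continuous_intros) auto
    ultimately show ?thesis by simp
  qed
  moreover have "0 \<in> {t::real. \<forall>w\<in>A - {u, v}. 0 < ell w (p + t *\<^sub>R ei)}" using p by (simp add: cell_def)
  ultimately obtain \<epsilon> where \<epsilon>: "\<epsilon> > 0" "ball 0 \<epsilon> \<subseteq> {t::real. \<forall>w\<in>A - {u, v}. 0 < ell w (p + t *\<^sub>R ei)}"
    by (rule openE)
  define t where "t = \<epsilon> / 2"
  have t: "t \<in> ball 0 \<epsilon>" "t > 0" using \<epsilon>(1) by (auto simp: t_def)
  have "ell v (p + t *\<^sub>R ei) = 0"
    using p iJ by (simp add: ell_shift cell_def pairing_scaleR ei_def pairing_axis J_def)
  then have "p + t *\<^sub>R ei \<in> cell" using subsetD[OF \<epsilon>(2) t(1)] by (simp add: cell_def)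
  then have "trop_coords (p + t *\<^sub>R ei) \<in> ?F"
    by (rule subsetD[OF closure_subset imageI])
  moreover have "trop_coords p \<in> ?F" using p by (rule subsetD[OF closure_subset imageI])
  moreover have "trop_coords (p + t *\<^sub>R ei) - trop_coords p = t *\<^sub>R std_e i"
    using trop_coords_axis[OF i]
    by (simp add: linear_add[OF linear_trop_coords] linear_scale[OF linear_trop_coords] ei_def)
  ultimately have "t *\<^sub>R std_e i \<in> lin_span_diff ?F"
    unfolding lin_span_diff_def by (intro span_base CollectI) metis
  then have "(1 / t) *\<^sub>R (t *\<^sub>R std_e i) \<in> lin_span_diff ?F" unfolding lin_span_diff_def by (rule span_scale)
  then show "std_e i \<in> lin_span_diff ?F" using t by simp
qed

end

section \<open>Two-dimensional cells are dual to edges\<close>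

lemma parallel_of_same_kernel:
  fixes a b :: "'v::euclidean_space"
  assumes "\<And>y. a \<bullet> y = 0 \<Longrightarrow> b \<bullet> y = 0"
  obtains t where "b = t *\<^sub>R a"
proof -
  define t where "t = (a \<bullet> b) / (a \<bullet> a)"
  have "a \<bullet> (b - t *\<^sub>R a) = 0" by (cases "a = 0") (auto simp: t_def inner_diff_right)
  then have "b \<bullet> (b - t *\<^sub>R a) = 0" "a \<bullet> (b - t *\<^sub>R a) = 0" using assms by auto
  then have "(b - t *\<^sub>R a) \<bullet> (b - t *\<^sub>R a) = 0" by (subst inner_diff_left) simp
  then show ?thesis using that[of t] by simp
qed

text \<open>Every exponent of \<open>S\<close> other than \<open>u\<close> puts F into a plane,
  which must be its affine hull. A third exponent would therefore be collinear with \<open>u\<close>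
  and \<open>v\<close>, against affine independence.\<close>

lemma two_element_support:
  assumes fin: "finite A" and hom: "homogeneous_of_degree A d"
    and ind: "\<And>p. \<not> affine_dependent (real_vec ` Amin \<nu> c A p)"
    and S: "2 \<le> card S" and dim: "aff_dim (trop_cell \<nu> c A S) = 2"
  obtains u v where "S = {u, v}" "u \<noteq> v" "u \<in> A" "v \<in> A"
proof -
  define F where "F = trop_cell \<nu> c A S"
  have "F \<noteq> {}" using dim by (auto simp: F_def)
  then obtain p0 where p0: "Amin \<nu> c A p0 = S" by (auto simp: F_def trop_cell_def)
  have SA: "S \<subseteq> A" using p0 by (auto simp: Amin_def)
  have "S \<noteq> {}" using S by auto
  then obtain u where u: "u \<in> S" by blast
  have "card (S - {u}) \<noteq> 0" using S u finite_subset[OF SA fin] by simp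
  then obtain v where v: "v \<in> S" "v \<noteq> u" by (metis card.empty DiffE insertI1 ex_in_conv)
  have plane: "F \<subseteq> {x. exp_diff w u \<bullet> x = \<nu> (c w) - \<nu> (c u)}" if w: "w \<in> S" for w
    unfolding F_def trop_cell_def
  proof (rule closure_minimal)
    have s: "(\<Sum>i\<in>UNIV. w$i) = (\<Sum>i\<in>UNIV. u$i)"
      using hom SA u w by (auto simp: homogeneous_of_degree_def subset_iff)
    have "\<nu> (c w) - pairing p w = \<nu> (c u) - pairing p u" if "Amin \<nu> c A p = S" for p
      using u w that unfolding Amin_def by (force intro: antisym)
    then show "trop_coords ` {p. Amin \<nu> c A p = S} \<subseteq> {x. exp_diff w u \<bullet> x = \<nu> (c w) - \<nu> (c u)}"
      using pairing_diff_eq_inner[OF s] by (fastforce simp: algebra_simps)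
  qed (rule closed_hyperplane)
  have exp_diff_axis: "real (w$i) - real (u$i) = exp_diff w u \<bullet> trop_coords (axis i 1)" if "w \<in> S" for w i
    using pairing_diff_eq_inner[of w u "axis i 1"] hom SA u that
    by (auto simp: homogeneous_of_degree_def subset_iff pairing_axis)
  have nz: "exp_diff w u \<noteq> 0" if "w \<in> S" "w \<noteq> u" for w
  proof
    assume "exp_diff w u = 0"
    then have "w$i = u$i" for i using exp_diff_axis[OF that(1), of i] by simp
    then have "w = u" by (simp add: vec_eq_iff)
    then show False using that by simp
  qed
  have hull: "affine hull F = {x. exp_diff w u \<bullet> x = \<nu> (c w) - \<nu> (c u)}" if "w \<in> S" "w \<noteq> u" for w
  proof (rule affine_dim_equal)
    show "affine hull F \<subseteq> {x. exp_diff w u \<bullet> x = \<nu> (c w) - \<nu> (c u)}"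
      by (intro hull_minimal plane that(1) affine_hyperplane)
    show "aff_dim (affine hull F) = aff_dim {x. exp_diff w u \<bullet> x = \<nu> (c w) - \<nu> (c u)}"
      using dim nz[OF that] by (simp add: F_def aff_dim_hyperplane)
  qed (use \<open>F \<noteq> {}\<close> affine_hyperplane in auto)
  have "S = {u, v}"
  proof (rule ccontr)
    assume "S \<noteq> {u, v}"
    then obtain w where w: "w \<in> S" "w \<noteq> u" "w \<noteq> v" using u v by blast
    obtain x0 where x0: "x0 \<in> F" using \<open>F \<noteq> {}\<close> by blast
    have "exp_diff w u \<bullet> y = 0" if "exp_diff v u \<bullet> y = 0" for y
    proof -
      have x: "x0 \<in> affine hull F" using x0 by (simp add: hull_inc)
      then have "x0 + y \<in> affine hull F" using that unfolding hull[OF v] by (simp add: inner_add_right)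
      then show ?thesis using x unfolding hull[OF w(1,2)] by (simp add: inner_add_right)
    qed
    then obtain t where t: "exp_diff w u = t *\<^sub>R exp_diff v u" using parallel_of_same_kernel by blast
    have "real (w$i) - real (u$i) = t * (real (v$i) - real (u$i))" for i
      using exp_diff_axis[OF w(1), of i] exp_diff_axis[OF v(1), of i] t by simp
    then have "real_vec w = (1 - t) *\<^sub>R real_vec u + t *\<^sub>R real_vec v"
      by (simp add: real_vec_def vec_eq_iff algebra_simps)
    then have "real_vec w \<in> affine hull {real_vec u, real_vec v}"
      unfolding affine_hull_2 by (intro CollectI exI[of _ "1 - t"] exI[of _ t]) simp
    moreover have "inj real_vec" by (auto simp: inj_def real_vec_def vec_eq_iff)
    then have "{real_vec u, real_vec v} \<subseteq> real_vec ` S - {real_vec w}"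
      using u v w by (auto simp: inj_eq)
    ultimately have "real_vec w \<in> affine hull (real_vec ` S - {real_vec w})"
      using hull_mono by blast
    then have "affine_dependent (real_vec ` S)" using w(1) unfolding affine_dependent_def by blast
    then show False using ind[of p0] p0 by simp
  qed
  then show ?thesis using that[of u v] u v SA by auto
qed

theorem theorem1p9:
  fixes \<nu> :: "'a::field_char_0 \<Rightarrow> real" and A :: "(nat^4) set" and c :: "nat^4 \<Rightarrow> 'a"
    and d :: nat and F :: "(real^3) set" and S :: "(nat^4) set" and J :: "nat set"
  assumes "alg_closed_field TYPE('a)"
    and "nonarch_valuation \<nu>"
    and "finite A" and "\<forall>u\<in>A. c u \<noteq> 0"
    and "involves_all_vars A"
    and "homogeneous_of_degree A d" and "d \<ge> 2"
    and "irreducible_mpoly A c"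
    and "\<not> is_cone A c"
    and "unimodular_triangulation \<nu> c A"
    and "generic_valuations \<nu> c A"
    and "F = trop_cell \<nu> c A S" and "card S \<ge> 2" and "aff_dim F = 2"
    and "J = {i\<in>{0..3}. std_e i \<in> lin_span_diff F}"
    and "recession_cone F \<inter> nonneg_cone (\<lambda>i. - std_e i) J = {0}"
  shows "dual_cell \<nu> A c F = {- x - y | x y. x \<in> F \<and> y \<in> nonneg_cone std_e J}"
proof -
  have "\<not> affine_dependent (real_vec ` Amin \<nu> c A p)" for p
    using assms(10) by (simp add: unimodular_triangulation_def)
  then obtain u v where uv: "S = {u, v}" "u \<noteq> v" "u \<in> A" "v \<in> A"
    using two_element_support[OF assms(3,6) _ assms(13)] assms(12,14) by metis
  interpret E: tropical_edge \<nu> A c d u v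
    by unfold_locales (use assms uv in auto)
  have F: "F = closure (trop_coords ` E.cell)"
    using assms(12) by (simp add: trop_cell_def uv(1) E.Amin_eq_iff)
  have ne: "E.cell \<noteq> {}" using assms(14) F by auto
  have J: "J = {i\<in>{0..3}. of_nat i \<in> E.J}"
    using assms(15) E.std_e_in_span_iff[OF ne] F by blast
  have cone: "nonneg_cone std_e J = trop_coords ` E.K"
    unfolding J nonneg_cone_eq E.K_def ..
  have "nonneg_cone (\<lambda>i. - std_e i) J = uminus ` nonneg_cone std_e J"
    by (auto simp: nonneg_cone_def sum_negf image_iff)
  then have "recession_cone F \<inter> uminus ` (trop_coords ` E.K) = {0}" using assms(16) cone by simp
  from E.dual_cell_eq[OF assms(11) ne F this] show ?thesis by (simp add: cone)
qed

end
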